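(* Let $q$ be a fixed power of $2$. As $g\to\infty$, (1) $\sum_{u\in\mathcal{H}_{g+1}}L(\tfrac12,\chi_u)^2=\frac{2}{3\zeta_A(2)}g^2q^{2g+1}+O((\log g)\,g\,q^{2g})$; (2) $\sum_{P\in\mathcal{P}_{g+1}}\sum_{u\in\mathcal{F}_P}L(\tfrac12,\chi_u)^2=\frac{1}{3\zeta_A(2)}|P|^2(\log_q|P|)^2+O(|P|^2\log_q|P|)$; (3) $\sum_{P\in\mathcal{P}_{g+1}}\sum_{u\in\mathcal{F}'_P}L(\tfrac12,\chi_u)^2=\frac{1}{3\zeta_A(2)}|P|^2(\log_q|P|)^2+O(|P|^2\log_q|P|)$; where $|P|=q^{g+1}$.
   Context: $q$ is a power of $2$, $A=\mathbb{F}_q[T]$, $k=\mathbb{F}_q(T)$. For nonzero $f\in A$, $|f|=q^{\deg f}$. $\mathcal{P}_n$ is the set of monic irreducible polynomials of degree $n$. Let $\wp(x)=x^2+x$ and fix $\xi\in\mathbb{F}_q\setminus\wp(\mathbb{F}_q)$. Hasse symbol: for $P$ monic irreducible and $u\in k$ integral at $P$, $[u,P)\in\mathbb{F}_2$ is $0$ if $X^2+X\equiv u\pmod P$ is solvable, and $1$ otherwise; for nonzero $N=c\prod_iP_i^{e_i}$ coprime to the denominator of $u$, $[u,N)=\sum_ie_i[u,P_i)$. Set $\{\frac{u}{N}\}=(-1)^{[u,N)}$ if $N$ is coprime to the denominator of $u$, and $0$ otherwise; $\chi_u(f)=\{\frac uf\}$ for monic $f$, and $L(s,\chi_u)=\sum_{f\text{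 monic}}\chi_u(f)|f|^{-s}$ (a polynomial in $q^{-s}$). For $P$ monic irreducible, $\mathcal{F}_P=\{a/P: a\in A,\ a\neq0,\ \deg a<\deg P\}$, $\mathcal{F}'_P=\{u+\xi:u\in\mathcal{F}_P\}$, $\mathcal{F}_r=\bigcup_{P\in\mathcal{P}_r}\mathcal{F}_P$. For $s\ge1$, $\mathcal{G}_s$ is the set of polynomials $\alpha+\sum_{i=1}^s\alpha_iT^{2i-1}$ with $\alpha\in\{0,\xi\}$, $\alpha_i\in\mathbb{F}_q$, $\alpha_s\ne0$. $\mathcal{H}_{(r,s)}=\{u+F:u\in\mathcal{F}_r,F\in\mathcal{G}_s\}$ and $\mathcal{H}_n=\bigcup_{r=1}^{n-1}\mathcal{H}_{(r,n-r)}$. $\zeta_A(s)=\frac{1}{1-q^{1-s}}$. Implied constants may depend on $q$. *)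

theory Defs
  imports
    "HOL-Analysis.Analysis"
    "HOL-Library.Landau_Symbols"
    "HOL-Library.Z2"
    "HOL-Computational_Algebra.Computational_Algebra"
begin

text \<open>
  The constant field is a type of class \<open>finite_field\<close>, so \<open>q = CARD('a)\<close>; the rational function
  field is \<open>'a poly fract\<close>.
\<close>

definition monic_irreducibles :: "nat \<Rightarrow> 'a::finite_field poly set" where
  "monic_irreducibles n = {P. lead_coeff P = 1 \<and> irreducible P \<and> degree P = n}"

definition poly_abs :: "'a::finite_field poly \<Rightarrow> nat" where
  "poly_abs f = (if f = 0 then 0 else CARD('a) ^ degree f)"

definition artin_schreier :: "'b::semiring_1 \<Rightarrow> 'b" where
  "artin_schreier x = x ^ 2 + x"

text \<open>Congruence modulo \<open>P\<close> in the local ring at \<open>P\<close>: the difference lies in its maximal ideal.\<close>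

definition fract_cong :: "'a::finite_field poly fract \<Rightarrow> 'a poly fract \<Rightarrow> 'a poly \<Rightarrow> bool" where
  "fract_cong u v P \<longleftrightarrow> (\<exists>a b. \<not> P dvd b \<and> P dvd a \<and> u - v = Fract a b)"

text \<open>\<open>coprime_to_denom N u\<close>: \<open>N\<close> is coprime to the denominator of \<open>u\<close> in lowest terms,
  which is unique up to units.\<close>

definition coprime_to_denom :: "'a::finite_field poly \<Rightarrow> 'a poly fract \<Rightarrow> bool" where
  "coprime_to_denom N u \<longleftrightarrow> (\<exists>a b. b \<noteq> 0 \<and> coprime a b \<and> u = Fract a b \<and> coprime N b)"

text \<open>The symbol \<open>[u,P)\<close> with values in the two-element field \<open>bit\<close>; only meaningful for \<open>P\<close> monic
  irreducible and \<open>u\<close> integral at \<open>P\<close>.\<close>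

definition hasse_prime :: "'a::finite_field poly fract \<Rightarrow> 'a poly \<Rightarrow> bit" where
  "hasse_prime u P = (if \<exists>X. fract_cong (to_fract (artin_schreier X)) u P then 0 else 1)"

text \<open>The library's \<open>multiplicity\<close> needs a factorial structure on the polynomial ring that is not
  available from the class \<open>field\<close>; this repeats its definition.\<close>

definition poly_multiplicity :: "'a::finite_field poly \<Rightarrow> 'a poly \<Rightarrow> nat" where
  "poly_multiplicity P N = (if finite {e. P ^ e dvd N} then Max {e. P ^ e dvd N} else 0)"

definition hasse :: "'a::finite_field poly fract \<Rightarrow> 'a poly \<Rightarrow> bit" where
  "hasse u N = (\<Sum>P | lead_coeff P = 1 \<and> irreducible P \<and> P dvd N.
     of_nat (poly_multiplicity P N) * hasse_prime u P)"

definition hasse_char :: "'a::finite_field poly fract \<Rightarrow> 'a poly \<Rightarrow> int" where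
  "hasse_char u N = (if coprime_to_denom N u then (if hasse u N = 0 then 1 else - 1) else 0)"

text \<open>The Dirichlet series is summed by degree. For the characters considered here the inner sum
  vanishes for all large \<open>n\<close>, so the series is a polynomial in \<open>q powr (-s)\<close> and is defined at every
  \<open>s\<close>, including those where the sum over all monic \<open>f\<close> does not converge absolutely.\<close>

definition hasse_L :: "complex \<Rightarrow> 'a::finite_field poly fract \<Rightarrow> complex" where
  "hasse_L s u = (\<Sum>n. \<Sum>f | lead_coeff f = 1 \<and> degree f = n.
     of_int (hasse_char u f) * of_nat (poly_abs f) powr (- s))"

definition zeta_A :: "'a::finite_field itself \<Rightarrow> real \<Rightarrow> real" where
  "zeta_A _ s = 1 / (1 - real CARD('a) powr (1 - s))"

definition F_prime :: "'a::finite_field poly \<Rightarrow> 'a poly fract set" where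
  "F_prime P = {Fract a P | a. a \<noteq> 0 \<and> degree a < degree P}"

definition F_prime' :: "'a::finite_field \<Rightarrow> 'a poly \<Rightarrow> 'a poly fract set" where
  "F_prime' \<xi> P = {u + to_fract [:\<xi>:] | u. u \<in> F_prime P}"

definition F_deg :: "nat \<Rightarrow> 'a::finite_field poly fract set" where
  "F_deg r = (\<Union>P\<in>monic_irreducibles r. F_prime P)"

definition G_deg :: "'a::finite_field \<Rightarrow> nat \<Rightarrow> 'a poly set" where
  "G_deg \<xi> s = {[:\<alpha>:] + (\<Sum>i=1..s. monom (c i) (2 * i - 1)) | \<alpha> c. \<alpha> \<in> {0, \<xi>} \<and> c s \<noteq> 0}"

definition H_pair :: "'a::finite_field \<Rightarrow> nat \<Rightarrow> nat \<Rightarrow> 'a poly fract set" where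
  "H_pair \<xi> r s = {u + to_fract F | u F. u \<in> F_deg r \<and> F \<in> G_deg \<xi> s}"

definition H_deg :: "'a::finite_field \<Rightarrow> nat \<Rightarrow> 'a poly fract set" where
  "H_deg \<xi> n = (\<Union>r\<in>{1..n - 1}. H_pair \<xi> r (n - r))"

end

theory Submission imports Defs begin

text \<open>
  In characteristic two every derivative is a square. Hence \<open>inf_res\<close>, the residue at infinity,
  vanishes on \<open>pderiv f / b\<^sup>2\<close>, and the Hasse symbol of \<open>u\<close> at \<open>f\<close> is
  \<open>psi (inf_res (u * pderiv f) f)\<close> with the additive character \<open>psi\<close> of the constants whose kernel is
  \<open>range artin_schreier\<close>. This is additive in \<open>u\<close>, and by reciprocity it is a multiplicative
  character in \<open>f\<close> modulo \<open>Q\<^sup>2\<close>, whose Gauss sum is computed from a single stationary point and has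
  root number one. The functional equation gives an exact finite formula for the central value
  squared, a weighted sum over pairs \<open>(e, f)\<close> of monic polynomials of total degree at most \<open>2 g\<close>.
  Averaging over \<open>u\<close> is an orthogonality relation for \<open>psi\<close>, which up to small errors leaves only the
  pairs with \<open>pderiv (e * f) = 0\<close>, that is with \<open>e * f\<close> a square. Writing \<open>(e, f)\<close> as
  \<open>(d * y\<^sup>2, d * z\<^sup>2)\<close> with coprime \<open>y\<close> and \<open>z\<close> and counting the triples yields a main term of order
  \<open>g\<^sup>3 / (3 \<zeta>(2))\<close> for each \<open>P\<close>, and the number of primes \<open>P\<close> contributes a factor of order \<open>1 / g\<close>.
\<close>

section \<open>The residue at infinity\<close>

text \<open>The functional equation is reached without geometry. A character modulo
  \<open>Q\<^sup>2\<close> that is trivial on constants may be summed over the additive groups of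
  polynomials of bounded degree; under the residue pairing the groups of degree below
  \<open>j\<close> and below \<open>2 * degree Q - j\<close> annihilate each other, so expanding the
  character in its Gauss sums exchanges the two. For \<open>u = a / P\<close> the symbol is such a
  character with \<open>Q = P\<close>. With a polynomial part, \<open>u\<close> has a pole of odd
  order at infinity, which is first carried to \<open>0\<close> by inverting \<open>T\<close>; this
  needs \<open>P\<close> nonzero at \<open>0\<close>, and the prime \<open>T\<close> is translated
  away beforehand. For a nonsquare product the average over \<open>a\<close> is complete but for the
  class \<open>a = 0\<close>, so it is at most one in absolute value instead of \<open>|P|\<close>;
  this pays for all pairs of total degree up to \<open>2 * g\<close>. The exception would be a
  derivative divisible by \<open>P\<close>; being a square it is then divisible by
  \<open>P\<^sup>2\<close>, which the degree excludes or the average over the polynomial part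
  removes. The logarithm in the first error term is a harmonic sum over the degrees of
  \<open>P\<close>.\<close>

lemma bezout_poly:
  fixes a b :: "'a::field poly"
  obtains x y d where "x * a + y * b = d" "d dvd a" "d dvd b"
proof -
  have "\<exists>x y d. x * a + y * b = d \<and> d dvd a \<and> d dvd b"
  proof (induction "euclidean_size b" arbitrary: a b rule: less_induct)
    case less
    show ?case
    proof (cases "b = 0")
      case True
      then have "1 * a + 0 * b = a \<and> a dvd a \<and> a dvd b" by simp
      then show ?thesis by blast
    next
      case False
      then have "euclidean_size (a mod b) < euclidean_size b" by (rule mod_size_less)
      from less[OF this, of b] obtain x y d where d: "x * b + y * (a mod b) = d" "d dvd b" "d dvd a mod b"
        by blast
      have "d dvd a" using d(2,3) by (metis dvd_mod_iff)
      moreover have "y * a + (x - y * (a div b)) * b = d"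
        using d(1) by (simp add: minus_div_mult_eq_mod[symmetric] algebra_simps)
      ultimately show ?thesis using d(2) by blast
    qed
  qed
  then show ?thesis using that by blast
qed

lemma irreducible_bezout_poly:
  fixes P f :: "'a::field poly"
  assumes "irreducible P" "\<not> P dvd f"
  obtains x y where "x * P + y * f = 1"
proof -
  obtain x y d where d: "x * P + y * f = d" "d dvd P" "d dvd f" by (rule bezout_poly)
  from d(2) obtain e where e: "P = d * e" by (auto elim: dvdE)
  have "is_unit d"
  proof (rule ccontr)
    assume "\<not> is_unit d"
    then have "is_unit e" using assms(1) e by (auto dest: irreducibleD)
    then have "P dvd d" using e by (metis dvd_mult_unit_iff dvd_refl)
    with d(3) assms(2) show False using dvd_trans by blast
  qed
  then obtain c where c: "1 = d * c" by (rule dvdE)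
  have "(c * x) * P + (c * y) * f = c * (x * P + y * f)" by (simp add: algebra_simps)
  also have "\<dots> = 1" using c d(1) by (simp add: mult.commute)
  finally have "(c * x) * P + (c * y) * f = 1" .
  then show ?thesis using that by blast
qed

lemma irreducible_dvd_mult_poly:
  fixes P :: "'a::field poly"
  assumes "irreducible P" "P dvd a * b"
  shows "P dvd a \<or> P dvd b"
  using field_poly_irreducible_imp_prime[OF assms(1)] assms(2) by (simp add: prime_elem_dvd_mult_iff)

lemma irreducible_dvd_power_poly:
  fixes P :: "'a::field poly"
  assumes "irreducible P" "P dvd a ^ n"
  shows "P dvd a"
  using field_poly_irreducible_imp_prime[OF assms(1)] assms(2) by (rule prime_elem_dvd_power)

text \<open>Meant for Artin-Schreier maps, whose fibres are \<open>{x, x + 1}\<close>; it is applied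
  over the constants and over \<open>A / P\<close>, with \<open>g\<close> the translation by
  one.\<close>

lemma card_le_two_image:
  assumes "finite S" "\<And>x y. x \<in> S \<Longrightarrow> y \<in> S \<Longrightarrow> f x = f y \<Longrightarrow> y = x \<or> y = g x"
  shows "card S \<le> 2 * card (f ` S)"
proof -
  have "S = (\<Union>y\<in>f ` S. {x \<in> S. f x = y})" by auto
  also have "card \<dots> \<le> (\<Sum>y\<in>f ` S. card {x \<in> S. f x = y})"
    using assms(1) by (intro card_UN_le) auto
  also have "\<dots> \<le> (\<Sum>y\<in>f ` S. 2)"
  proof (rule sum_mono)
    fix y assume "y \<in> f ` S"
    then obtain x0 where "x0 \<in> S" "f x0 = y" by auto
    then have "{x \<in> S. f x = y} \<subseteq> {x0, g x0}" using assms(2)[of x0] by (simp add: subset_iff)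
    then have "card {x \<in> S. f x = y} \<le> card {x0, g x0}" by (intro card_mono) auto
    also have "\<dots> \<le> 2" by (simp add: card_insert_if)
    finally show "card {x \<in> S. f x = y} \<le> 2" .
  qed
  finally show ?thesis by simp
qed

text \<open>Upper bounds in place of exact degrees let factors with vanishing top coefficient, in
  particular zero, pass without a case distinction.\<close>

lemma coeff_mult_top:
  fixes p q :: "'a::comm_semiring_0 poly"
  assumes "degree p \<le> m" "degree q \<le> n"
  shows "coeff (p * q) (m + n) = coeff p m * coeff q n"
proof -
  have "coeff (p * q) (m + n) = (\<Sum>i\<le>m + n. coeff p i * coeff q (m + n - i))" by (rule coeff_mult)
  also have "\<dots> = (\<Sum>i\<in>{m}. coeff p i * coeff q (m + n - i))"
  proof (rule sum.mono_neutral_right)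
    show "\<forall>i\<in>{..m + n} - {m}. coeff p i * coeff q (m + n - i) = 0"
    proof
      fix i assume i: "i \<in> {..m + n} - {m}"
      show "coeff p i * coeff q (m + n - i) = 0"
      proof (cases "i < m")
        case True
        then have "degree q < m + n - i" using assms(2) by linarith
        then show ?thesis by (simp add: coeff_eq_0)
      next
        case False
        then have "degree p < i" using i assms(1) by auto
        then show ?thesis by (simp add: coeff_eq_0)
      qed
    qed
  qed auto
  finally show ?thesis by simp
qed

text \<open>The coefficient of \<open>T\<^sup>-\<^sup>1\<close> in the expansion of \<open>a / b\<close> at infinity.\<close>

definition inf_res :: "'a::field poly \<Rightarrow> 'a poly \<Rightarrow> 'a" where
  "inf_res a b = coeff (a mod b) (degree b - 1) / lead_coeff b"

lemma inf_res_add: "inf_res (a + c) b = inf_res a b + inf_res c b"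
  by (simp add: inf_res_def poly_mod_add_left add_divide_distrib)

lemma inf_res_0 [simp]: "inf_res 0 b = 0"
  by (simp add: inf_res_def)

lemma inf_res_smult: "inf_res (smult k a) b = k * inf_res a b"
  by (simp add: inf_res_def mod_smult_left)

lemma inf_res_mod_cong: "a mod b = c mod b \<Longrightarrow> inf_res a b = inf_res c b"
  by (simp add: inf_res_def)

lemma inf_res_dvd: "b dvd a \<Longrightarrow> inf_res a b = 0"
  by (simp add: inf_res_def mod_eq_0_iff_dvd)

lemma degree_mod_le:
  fixes a b :: "'a::field poly"
  shows "b \<noteq> 0 \<Longrightarrow> degree (a mod b) \<le> degree b - 1"
  by (metis degree_0 degree_mod_less le_less_linear less_imp_le_nat nat_less_le not_less
      Suc_pred' less_Suc_eq_le not_gr_zero zero_le)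

text \<open>Scaling numerator and denominator scales the remainder, so only the fraction matters;
  every later change of denominator rests on this.\<close>

lemma inf_res_mult_cancel:
  assumes "c \<noteq> 0"
  shows "inf_res (a * c) (b * c) = inf_res a b"
proof (cases "b = 0")
  case True
  then show ?thesis by (simp add: inf_res_def)
next
  case b: False
  have m: "(a * c) mod (b * c) = c * (a mod b)"
    by (simp add: mult.commute mod_mult_mult1)
  show ?thesis
  proof (cases "degree b = 0")
    case True
    then have "b dvd a" using b by (metis is_unit_iff_degree unit_imp_dvd)
    then show ?thesis by (simp add: inf_res_dvd)
  next
    case False
    then have "degree (b * c) - 1 = degree c + (degree b - 1)"
      using assms b by (simp add: degree_mult_eq)
    then show ?thesis unfolding inf_res_def m
      using coeff_mult_top[OF order_refl degree_mod_le[OF b], of c a] assms b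
      by (simp add: lead_coeff_mult)
  qed
qed

lemma inf_res_mult_cancel_left:
  "c \<noteq> 0 \<Longrightarrow> inf_res (c * a) (c * b) = inf_res a b"
  using inf_res_mult_cancel[of c a b] by (simp add: mult.commute)

lemma inf_res_eq_coeff:
  assumes "degree a < degree b"
  shows "inf_res a b = coeff a (degree b - 1) / lead_coeff b"
  using assms by (simp add: inf_res_def mod_poly_less)

lemma inf_res_eq_0:
  assumes "degree a + 1 < degree b"
  shows "inf_res a b = 0"
proof -
  have "coeff a (degree b - 1) = 0" using assms by (intro coeff_eq_0) auto
  then show ?thesis using assms by (subst inf_res_eq_coeff) auto
qed

lemma degree_pderiv_le: "degree (pderiv f) \<le> degree f - 1"
  by (rule degree_le) (auto simp: coeff_pderiv coeff_eq_0)

section \<open>Squares, derivatives and residues in characteristic two\<close>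

locale even_const_field =
  fixes \<xi> :: "'a::finite_field"
  assumes two_eq_0: "(2::'a) = 0" and xi_notin: "\<xi> \<notin> range artin_schreier"
begin

lemma add_self [simp]: "(x::'a) + x = 0"
  by (metis mult_2 mult_zero_left two_eq_0)

lemma poly_add_self [simp]: "(p::'a poly) + p = 0"
  by (rule poly_eqI) (simp only: coeff_add add_self coeff_0)

lemma poly_uminus_eq [simp]: "- (p::'a poly) = p"
  by (metis poly_add_self minus_unique)

lemma poly_minus_eq [simp]: "(p::'a poly) - r = p + r"
  by (metis diff_conv_add_uminus poly_uminus_eq)

lemma poly_add_self_left [simp]: "(p::'a poly) + (p + r) = r"
  by (simp flip: add.assoc)

lemma add_self_left [simp]: "(p::'a) + (p + r) = r"
  by (simp flip: add.assoc)

lemma poly_two_times [simp]: "2 * (p::'a poly) = 0"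
proof -
  have "2 * p = p + p" by (rule mult_2)
  then show ?thesis by simp
qed

lemma poly_add_eq_0_iff: "(p::'a poly) + r = 0 \<longleftrightarrow> p = r"
  by (metis add.commute add_0 poly_add_self_left poly_add_self)

lemma square_add: "((x::'a) + y)\<^sup>2 = x\<^sup>2 + y\<^sup>2"
  by (simp add: power2_eq_square algebra_simps)

lemma poly_square_add: "((x::'a poly) + y)\<^sup>2 = x\<^sup>2 + y\<^sup>2"
  by (simp add: power2_eq_square algebra_simps)

lemma of_nat_eq_parity: "(of_nat n :: 'a) = (if even n then 0 else 1)"
proof -
  have "(of_nat n :: 'a) = of_nat (2 * (n div 2) + n mod 2)" by simp
  also have "\<dots> = of_nat (n mod 2)" by (simp only: of_nat_add of_nat_mult of_nat_numeral two_eq_0) simp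
  finally show ?thesis by (simp add: mod_2_eq_odd)
qed

lemma ex_sqrt: "\<exists>y. y\<^sup>2 = (x::'a)"
proof -
  have "inj (\<lambda>y::'a. y\<^sup>2)"
  proof (rule injI)
    fix x y :: 'a assume "x\<^sup>2 = y\<^sup>2"
    then have "(x + y)\<^sup>2 = 0" by (simp add: square_add)
    then show "x = y" by (metis add.right_neutral add_self_left power_eq_0_iff zero_neq_numeral)
  qed
  then have "surj (\<lambda>y::'a. y\<^sup>2)" by (simp add: finite_UNIV_inj_surj)
  then show ?thesis by (metis surjD)
qed

lemma coeff_square: "coeff ((p::'a poly)\<^sup>2) n = (if even n then (coeff p (n div 2))\<^sup>2 else 0)"
proof (induction p arbitrary: n)
  case 0
  then show ?case by simp
next
  case (pCons a p)
  have "(pCons a p)\<^sup>2 = pCons (a\<^sup>2) (pCons 0 (p\<^sup>2))"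
  proof -
    have "(pCons a p)\<^sup>2 = ([:a:] + pCons 0 p)\<^sup>2" by simp
    also have "\<dots> = [:a:]\<^sup>2 + (pCons 0 p)\<^sup>2" by (rule poly_square_add)
    also have "\<dots> = pCons (a\<^sup>2) (pCons 0 (p\<^sup>2))" by (simp add: power2_eq_square)
    finally show ?thesis .
  qed
  then show ?case
    by (auto simp: coeff_pCons pCons.IH split: nat.split)
qed

text \<open>The constants are perfect, so the even part of \<open>f\<close> is a square and the odd
  part is \<open>T\<close> times a square; differentiation kills the squares, and the factor
  \<open>T\<close> leaves \<open>t\<^sup>2\<close>.\<close>

lemma square_decomposition:
  obtains s t where "f = s\<^sup>2 + [:0, 1:] * t\<^sup>2" "pderiv (f::'a poly) = t\<^sup>2"
proof -
  have pd: "pderiv (s\<^sup>2 + [:0, 1:] * t\<^sup>2) = t\<^sup>2" for s t :: "'a poly"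
  proof -
    have "pderiv (u\<^sup>2) = 0" for u :: "'a poly"
      by (simp add: power2_eq_square pderiv_mult mult.commute)
    then show ?thesis by (simp add: pderiv_add pderiv_mult pderiv_pCons del: mult_pCons_left)
  qed
  have "\<exists>s t. f = s\<^sup>2 + [:0, 1:] * t\<^sup>2"
  proof (induction f)
    case 0
    have "(0::'a poly) = 0\<^sup>2 + [:0, 1:] * 0\<^sup>2" by simp
    then show ?case by blast
  next
    case (pCons a p)
    then obtain s t where p: "p = s\<^sup>2 + [:0, 1:] * t\<^sup>2" by blast
    obtain b where b: "b\<^sup>2 = a" using ex_sqrt by blast
    have "pCons a p = [:a:] + [:0, 1:] * p" by simp
    \<comment> \<open>Multiplying by \<open>T\<close> exchanges the two parts: \<open>T * (s\<^sup>2
      + T * t\<^sup>2) = (T * t)\<^sup>2 + T * s\<^sup>2\<close>, and the new constant term joins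
      the square.\<close>
    also have "\<dots> = ([:b:] + [:0, 1:] * t)\<^sup>2 + [:0, 1:] * s\<^sup>2"
      unfolding poly_square_add p using b
      by (simp add: power2_eq_square algebra_simps)
    finally show ?case by blast
  qed
  then obtain s t where "f = s\<^sup>2 + [:0, 1:] * t\<^sup>2" by blast
  then show ?thesis using that pd by blast
qed

lemma pderiv_square [simp]: "pderiv ((u::'a poly)\<^sup>2) = 0"
  by (simp add: power2_eq_square pderiv_mult mult.commute)

lemma pderiv_pderiv [simp]: "pderiv (pderiv (f::'a poly)) = 0"
  by (rule square_decomposition[of f]) simp

lemma pderiv_mult_square: "pderiv ((f::'a poly) * u\<^sup>2) = pderiv f * u\<^sup>2"
  by (simp add: pderiv_mult)

lemma square_mod_square: "(a::'a poly)\<^sup>2 mod b\<^sup>2 = (a mod b)\<^sup>2"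
proof (cases "b = 0")
  case False
  have "a\<^sup>2 = (b * (a div b) + a mod b)\<^sup>2" by simp
  also have "\<dots> = b\<^sup>2 * (a div b)\<^sup>2 + (a mod b)\<^sup>2" by (simp only: poly_square_add power_mult_distrib)
  finally have "a\<^sup>2 mod b\<^sup>2 = (a mod b)\<^sup>2 mod b\<^sup>2" by simp
  also have "\<dots> = (a mod b)\<^sup>2"
  proof (cases "a mod b = 0")
    case False
    then have "degree (a mod b) < degree b" using \<open>b \<noteq> 0\<close> degree_mod_less by blast
    then show ?thesis using False \<open>b \<noteq> 0\<close> by (intro mod_poly_less) (simp add: degree_power_eq)
  qed simp
  finally show ?thesis .
qed simp

text \<open>The remainder is the square of a remainder and so has only even powers of
  \<open>T\<close>, while the residue reads the odd index \<open>2 * degree b - 1\<close>.\<close>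

lemma inf_res_square: "inf_res ((a::'a poly)\<^sup>2) (b\<^sup>2) = 0"
proof (cases "degree b = 0")
  case True
  then have "b\<^sup>2 dvd a\<^sup>2 \<or> b = 0" by (metis is_unit_iff_degree is_unit_power_iff unit_imp_dvd)
  then show ?thesis by (auto simp: inf_res_dvd inf_res_def)
next
  case False
  then have "odd (degree (b\<^sup>2) - 1)" by (cases "b = 0") (auto simp: degree_power_eq)
  then show ?thesis by (simp add: inf_res_def square_mod_square coeff_square)
qed

text \<open>Multiplication by \<open>T\<close> moves the even powers of a square to odd ones, so the
  index \<open>2 * degree b - 1\<close> now meets the square of the coefficient that
  \<open>inf_res a b\<close> reads.\<close>

lemma inf_res_X_square: "inf_res ([:0, 1:] * (a::'a poly)\<^sup>2) (b\<^sup>2) = (inf_res a b)\<^sup>2"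
proof (cases "degree b = 0")
  case True
  then have "(b\<^sup>2 dvd [:0, 1:] * a\<^sup>2 \<and> b dvd a) \<or> b = 0"
    by (metis is_unit_iff_degree is_unit_power_iff unit_imp_dvd)
  then show ?thesis by (auto simp: inf_res_dvd inf_res_def)
next
  case False
  then have b: "b \<noteq> 0" by auto
  let ?r = "a mod b"
  have r: "degree ?r \<le> degree b - 1" using degree_mod_le[OF b] .
  have "degree ([:0, 1:] * ?r\<^sup>2) < degree (b\<^sup>2)"
  proof -
    have "degree ([:0, 1:] * ?r\<^sup>2) \<le> 1 + 2 * degree ?r"
      by (rule order.trans[OF degree_mult_le]) (simp add: degree_power_le mult.commute[of 2])
    also have "\<dots> < 2 * degree b" using r False by linarith
    finally show ?thesis using b by (simp add: degree_power_eq)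
  qed
  then have "[:0, 1:] * ?r\<^sup>2 mod b\<^sup>2 = [:0, 1:] * ?r\<^sup>2" by (rule mod_poly_less)
  then have m: "[:0, 1:] * a\<^sup>2 mod b\<^sup>2 = [:0, 1:] * ?r\<^sup>2"
    by (metis mod_mult_right_eq square_mod_square)
  have "degree (b\<^sup>2) - 1 = Suc (2 * (degree b - 1))" using False b by (simp add: degree_power_eq)
  then show ?thesis
    unfolding inf_res_def m by (simp add: coeff_square power_divide lead_coeff_power)
qed

lemma inf_res_pderiv_square: "inf_res (pderiv (f::'a poly)) (b\<^sup>2) = 0"
  by (rule square_decomposition[of f]) (simp add: inf_res_square)

text \<open>By Euler's formula \<open>inf_res (x * pderiv f) f\<close> is the trace of \<open>x\<close> from \<open>A / f\<close> to the
  constants, so this says that the trace commutes with squaring.\<close>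

lemma inf_res_frobenius: "inf_res ((x::'a poly)\<^sup>2 * pderiv f) f = (inf_res (x * pderiv f) f)\<^sup>2"
proof (cases "f = 0")
  case False
  obtain s t where st: "f = s\<^sup>2 + [:0, 1:] * t\<^sup>2" "pderiv f = t\<^sup>2" by (rule square_decomposition)
  \<comment> \<open>After enlarging the denominator to \<open>f\<^sup>2\<close>, the numerator
    splits into a square, whose residue vanishes, and \<open>T\<close> times the square of
    \<open>x * pderiv f\<close>.\<close>
  have e: "x\<^sup>2 * t\<^sup>2 * f = (x * t * s)\<^sup>2 + [:0, 1:] * (x * t\<^sup>2)\<^sup>2"
    unfolding st(1) by (simp add: algebra_simps power2_eq_square)
  have "inf_res (x\<^sup>2 * pderiv f) f = inf_res (x\<^sup>2 * t\<^sup>2 * f) (f * f)"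
    using False st(2) by (simp add: inf_res_mult_cancel)
  also have "f * f = f\<^sup>2" by (simp add: power2_eq_square)
  also have "inf_res (x\<^sup>2 * t\<^sup>2 * f) (f\<^sup>2) = (inf_res (x * t\<^sup>2) f)\<^sup>2"
    unfolding e inf_res_add inf_res_square inf_res_X_square by simp
  finally show ?thesis using st(2) by simp
qed (simp add: inf_res_def)

text \<open>This is \<open>(-1) ^ Tr x\<close> for the trace to the field of two elements. The
  kernel is taken as the definition because solvability of \<open>X\<^sup>2 + X = x\<close> is how
  the symbol at a prime is given.\<close>

definition psi :: "'a \<Rightarrow> real" where
  "psi x = (if x \<in> range artin_schreier then 1 else - 1)"

lemma artin_schreier_add: "artin_schreier ((x::'a) + y) = artin_schreier x + artin_schreier y"
  by (simp add: artin_schreier_def square_add)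

lemma add_in_range_artin_schreier:
  assumes "(u::'a) \<in> range artin_schreier" "v \<in> range artin_schreier"
  shows "u + v \<in> range artin_schreier"
proof -
  from assms obtain x y :: 'a where "u = artin_schreier x" "v = artin_schreier y" by blast
  then have "u + v = artin_schreier (x + y)" by (simp add: artin_schreier_add)
  then show ?thesis by blast
qed

lemma card_range_artin_schreier: "CARD('a) \<le> 2 * card (range (artin_schreier :: 'a \<Rightarrow> 'a))"
proof (rule card_le_two_image[where g = "\<lambda>x. x + 1"])
  fix x y :: 'a assume e: "artin_schreier x = artin_schreier y"
  define z where "z = x + y"
  have "z * (z + 1) = artin_schreier z" by (simp add: artin_schreier_def power2_eq_square distrib_left)
  also have "\<dots> = 0" using e by (simp add: z_def artin_schreier_add)
  finally have "z = 0 \<or> z + 1 = 0" by simp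
  moreover have "z = 1" if "z + 1 = 0" using add_self_left[of z 1] that by simp
  ultimately have "z = 0 \<or> z = 1" by blast
  moreover have "y = x + z" by (simp add: z_def)
  ultimately show "y = x \<or> y = x + 1" by auto
qed simp

text \<open>The map is at most two to one, so its image fills at least half of the field. If
  \<open>x\<close> and \<xi> lay in different nontrivial cosets, the image and its translates by
  both would be three disjoint sets of that size.\<close>

lemma notin_range_artin_schreier:
  assumes "x \<notin> range artin_schreier"
  shows "x + \<xi> \<in> range artin_schreier"
proof (rule ccontr)
  define S where "S = range (artin_schreier :: 'a \<Rightarrow> 'a)"
  assume "x + \<xi> \<notin> range artin_schreier"
  then have n: "x + \<xi> \<notin> S" "x \<notin> S" "\<xi> \<notin> S" using assms xi_notin by (auto simp: S_def)
  have S: "u + v \<in> S" if "u \<in> S" "v \<in> S" for u v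
    using that add_in_range_artin_schreier unfolding S_def by blast
  have S': "s + z \<notin> S" if "s \<in> S" "z \<notin> S" for s z
    using S[OF that(1)] that(2) by force
  let ?A = "(\<lambda>s. s + x) ` S" and ?B = "(\<lambda>s. s + \<xi>) ` S"
  have d1: "S \<inter> ?A = {}" and d2: "S \<inter> ?B = {}" using S' n by auto
  have d3: "?A \<inter> ?B = {}"
  proof (rule equals0I)
    fix y assume "y \<in> ?A \<inter> ?B"
    then obtain s t where st: "s \<in> S" "t \<in> S" "y = s + x" "y = t + \<xi>" by blast
    have "x + \<xi> = (s + (s + x)) + (t + (t + \<xi>))" by (simp only: add_self_left)
    also have "\<dots> = (s + t) + (y + y)" unfolding st(3)[symmetric] st(4)[symmetric] by (simp only: ac_simps)
    also have "\<dots> = s + t" by simp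
    finally show False using S st n(1) by metis
  qed
  have "card (S \<union> ?A) = card S + card ?A" using d1 by (intro card_Un_disjoint) auto
  moreover have "card (S \<union> ?A \<union> ?B) = card (S \<union> ?A) + card ?B"
    using d2 d3 by (intro card_Un_disjoint) auto
  moreover have "card ?A = card S" "card ?B = card S" by (simp_all add: card_image)
  moreover have "card (S \<union> ?A \<union> ?B) \<le> CARD('a)" by (rule card_mono) auto
  moreover have "card S > 0" by (simp add: card_gt_0_iff S_def)
  ultimately show False using card_range_artin_schreier unfolding S_def[symmetric] by linarith
qed

lemma psi_add: "psi (x + y) = psi x * psi y"
proof -
  define S where "S = range (artin_schreier :: 'a \<Rightarrow> 'a)"
  have S: "u + v \<in> S" if "u \<in> S" "v \<in> S" for u v
    using that add_in_range_artin_schreier unfolding S_def by blast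
  have S': "s + z \<notin> S" if "s \<in> S" "z \<notin> S" for s z
    using S[OF that(1)] that(2) by force
  have S'': "u + v \<in> S" if "u \<notin> S" "v \<notin> S" for u v
  proof -
    have "u + \<xi> \<in> S" "v + \<xi> \<in> S"
      using that notin_range_artin_schreier unfolding S_def by auto
    then have "(u + \<xi>) + (v + \<xi>) \<in> S" by (rule S)
    moreover have "(u + \<xi>) + (v + \<xi>) = (u + v) + (\<xi> + \<xi>)" by (simp only: ac_simps)
    ultimately show ?thesis by simp
  qed
  have psi: "psi z = (if z \<in> S then 1 else - 1)" for z by (simp add: psi_def S_def)
  have "x \<notin> S \<Longrightarrow> y \<in> S \<Longrightarrow> x + y \<notin> S" using S'[of y x] by (simp add: add.commute)
  then show ?thesis using S[of x y] S'[of x y] S''[of x y] by (simp add: psi)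
qed

lemma psi_0 [simp]: "psi 0 = 1"
proof -
  have "artin_schreier (0::'a) = 0" by (simp add: artin_schreier_def)
  then show ?thesis unfolding psi_def by (metis rangeI)
qed

lemma psi_xi [simp]: "psi \<xi> = - 1"
  by (simp add: psi_def xi_notin)

lemma psi_square [simp]: "psi (x\<^sup>2) = psi x"
proof -
  have "psi (artin_schreier x) = 1" by (simp add: psi_def)
  then have "psi (x\<^sup>2) * psi x = 1" by (simp add: artin_schreier_def psi_add)
  then show ?thesis by (auto simp: psi_def split: if_splits)
qed

lemma psi_mult_self [simp]: "psi x * psi x = 1"
  by (simp add: psi_def)

lemma psi_cases: "psi x = 1 \<or> psi x = - 1"
  by (simp add: psi_def)

lemma abs_psi [simp]: "\<bar>psi x\<bar> = 1"
  by (simp add: psi_def)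

end

section \<open>Orthogonality\<close>

text \<open>Degree below \<open>n\<close>, with zero included. The condition on coefficients is
  visibly additive and sidesteps the convention \<open>degree 0 = 0\<close>, which matters for
  \<open>n = 0\<close>.\<close>

definition lowdeg :: "nat \<Rightarrow> 'a::zero poly set" where
  "lowdeg n = {f. \<forall>i\<ge>n. coeff f i = 0}"

lemma lowdeg_iff: "f \<in> lowdeg n \<longleftrightarrow> f = 0 \<or> degree f < n"
proof
  assume "f \<in> lowdeg n"
  then have "n \<le> degree f \<Longrightarrow> lead_coeff f = 0" by (simp add: lowdeg_def)
  then show "f = 0 \<or> degree f < n" by force
qed (auto simp: lowdeg_def coeff_eq_0)

lemma lowdeg_0 [simp]: "lowdeg 0 = {0}"
  by (auto simp: lowdeg_iff)

lemma zero_in_lowdeg [simp]: "0 \<in> lowdeg n"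
  by (simp add: lowdeg_def)

lemma lowdeg_add: "(f::'a::comm_monoid_add poly) \<in> lowdeg n \<Longrightarrow> g \<in> lowdeg n \<Longrightarrow> f + g \<in> lowdeg n"
  by (auto simp: lowdeg_def)

lemma lowdeg_mono: "m \<le> n \<Longrightarrow> f \<in> lowdeg m \<Longrightarrow> f \<in> lowdeg n"
  by (auto simp: lowdeg_def)

lemma lowdeg_Suc: "lowdeg (Suc n) = (\<lambda>(a, p). pCons a p) ` (UNIV \<times> lowdeg n)"
proof (intro set_eqI iffI)
  fix f :: "'a poly" assume f: "f \<in> lowdeg (Suc n)"
  obtain a p where "f = pCons a p" by (cases f)
  moreover from this f have "p \<in> lowdeg n" by (auto simp: lowdeg_def coeff_pCons split: nat.splits)
  ultimately show "f \<in> (\<lambda>(a, p). pCons a p) ` (UNIV \<times> lowdeg n)" by auto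
qed (auto simp: lowdeg_def coeff_pCons split: nat.splits)

lemma inj_on_pCons: "inj_on (\<lambda>(a, p). pCons a p) S"
  by (auto simp: inj_on_def)

lemma finite_lowdeg [simp]: "finite (lowdeg n :: 'a::{zero,finite} poly set)"
  by (induction n) (auto simp: lowdeg_Suc)

lemma card_lowdeg: "card (lowdeg n :: 'a::{zero,finite} poly set) = CARD('a) ^ n"
  by (induction n) (simp_all add: lowdeg_Suc card_image[OF inj_on_pCons] card_cartesian_product)

lemma lowdeg_mod: "(f::'a::field poly) mod b \<in> lowdeg (degree b)" if "b \<noteq> 0"
  using degree_mod_less[of b f] that by (auto simp: lowdeg_iff)

lemma mod_lowdeg: "f \<in> lowdeg (degree b) \<Longrightarrow> (f::'a::field poly) mod b = f"
  by (auto simp: lowdeg_iff mod_poly_less)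

lemma div_lowdeg: "f \<in> lowdeg (degree b) \<Longrightarrow> (f::'a::field poly) div b = 0"
  by (auto simp: lowdeg_iff div_poly_less)

text \<open>Division with remainder, arranged so that a sum over polynomials of bounded degree runs
  over residue classes modulo \<open>Q\<close>.\<close>

lemma bij_betw_lowdeg_division:
  fixes Q :: "'a::field poly"
  assumes "Q \<noteq> 0"
  shows "bij_betw (\<lambda>(r, z). r + Q * z) (lowdeg (degree Q) \<times> lowdeg m) (lowdeg (degree Q + m))"
proof (rule bij_betw_byWitness[where f' = "\<lambda>f. (f mod Q, f div Q)"])
  show "\<forall>a\<in>lowdeg (degree Q) \<times> lowdeg m. (\<lambda>f. (f mod Q, f div Q)) ((\<lambda>(r, z). r + Q * z) a) = a"
    using assms by (auto simp: mod_lowdeg div_lowdeg)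
  have "r + Q * z \<in> lowdeg (degree Q + m)" if r: "r \<in> lowdeg (degree Q)" and z: "z \<in> lowdeg m" for r z
  proof -
    have "Q * z \<in> lowdeg (degree Q + m)"
      using z assms by (cases "z = 0") (auto simp: lowdeg_iff degree_mult_eq)
    moreover have "r \<in> lowdeg (degree Q + m)" using r lowdeg_mono le_add1 by blast
    ultimately show "r + Q * z \<in> lowdeg (degree Q + m)" by (simp add: lowdeg_add)
  qed
  then show "(\<lambda>(r, z). r + Q * z) ` (lowdeg (degree Q) \<times> lowdeg m) \<subseteq> lowdeg (degree Q + m)"
    by auto
  have "f div Q \<in> lowdeg m" if f: "f \<in> lowdeg (degree Q + m)" for f
  proof (rule ccontr)
    assume "f div Q \<notin> lowdeg m"
    then have z: "f div Q \<noteq> 0" "m \<le> degree (f div Q)" by (auto simp: lowdeg_iff)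
    then have Qz: "degree (Q * (f div Q)) = degree Q + degree (f div Q)" "Q * (f div Q) \<noteq> 0"
      using assms by (auto simp: degree_mult_eq)
    have "degree (Q * (f div Q)) = degree (f - f mod Q)"
      by (simp add: minus_mod_eq_mult_div)
    also have "\<dots> < degree Q + m \<or> Q * (f div Q) = 0"
    proof -
      have "f - f mod Q = f + - (f mod Q)" by simp
      moreover have "- (f mod Q) \<in> lowdeg (degree Q)" using lowdeg_mod[OF assms, of f] by (simp add: lowdeg_def)
      then have "- (f mod Q) \<in> lowdeg (degree Q + m)" using lowdeg_mono le_add1 by blast
      ultimately have "f - f mod Q \<in> lowdeg (degree Q + m)" using f lowdeg_add by metis
      then show ?thesis by (auto simp: lowdeg_iff minus_mod_eq_mult_div)
    qed
    finally show False using Qz z by auto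
  qed
  then show "(\<lambda>f. (f mod Q, f div Q)) ` lowdeg (degree Q + m) \<subseteq> lowdeg (degree Q) \<times> lowdeg m"
    using assms lowdeg_mod by auto
qed simp

definition monics :: "nat \<Rightarrow> 'a::comm_semiring_1 poly set" where
  "monics n = {f. lead_coeff f = 1 \<and> degree f = n}"

lemma monics_eq: "(monics n :: 'a::comm_ring_1 poly set) = (\<lambda>p. monom 1 n + p) ` lowdeg n"
proof (intro set_eqI iffI)
  fix f :: "'a poly" assume f: "f \<in> monics n"
  then have "f - monom 1 n \<in> lowdeg n"
    by (auto simp: monics_def lowdeg_def coeff_eq_0)
  then show "f \<in> (\<lambda>p. monom 1 n + p) ` lowdeg n" by (rule rev_image_eqI) simp
next
  fix f :: "'a poly" assume "f \<in> (\<lambda>p. monom 1 n + p) ` lowdeg n"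
  then obtain p where p: "p \<in> lowdeg n" "f = monom 1 n + p" by blast
  then have c: "coeff f n = 1" by (simp add: lowdeg_def)
  have "degree f \<le> n" using p by (intro degree_le) (auto simp: lowdeg_def)
  moreover have "degree f \<ge> n" using c by (intro le_degree) simp
  ultimately show "f \<in> monics n" using c by (auto simp: monics_def)
qed

lemma finite_monics [simp]: "finite (monics n :: 'a::{comm_ring_1,finite} poly set)"
  by (simp add: monics_eq)

lemma card_monics: "card (monics n :: 'a::{comm_ring_1,finite} poly set) = CARD('a) ^ n"
proof -
  have "inj_on (\<lambda>p. monom 1 n + p) (lowdeg n :: 'a poly set)" by (auto simp: inj_on_def)
  then show ?thesis unfolding monics_eq by (simp add: card_image card_lowdeg)
qed

text \<open>Coprimality with explicit cofactors: \<open>x\<close> is an inverse of \<open>a\<close>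
  modulo \<open>b\<close>, and such inverses are what the representatives of fractions and the
  characters are built from.\<close>

definition comaximal :: "'a::comm_ring_1 \<Rightarrow> 'a \<Rightarrow> bool" where
  "comaximal a b \<longleftrightarrow> (\<exists>x y. x * a + y * b = 1)"

lemma comaximal_sym: "comaximal a b \<Longrightarrow> comaximal b a"
  unfolding comaximal_def by (metis add.commute)

lemma comaximal_mult:
  assumes "comaximal a b" "comaximal a c"
  shows "comaximal a (b * c)"
proof -
  obtain x y u v where 1: "x * a + y * b = 1" and 2: "u * a + v * c = 1"
    using assms unfolding comaximal_def by blast
  have "(x + y * b * u) * a + (y * v) * (b * c) = x * a + y * b * (u * a + v * c)"
    by (simp add: algebra_simps)
  also have "\<dots> = 1" using 1 2 by simp
  finally show ?thesis unfolding comaximal_def by blast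
qed

lemma comaximal_dvd: "comaximal a b \<Longrightarrow> c dvd b \<Longrightarrow> comaximal a c"
  unfolding comaximal_def dvd_def by (metis mult.assoc mult.commute)

lemma comaximal_mult_iff: "comaximal a (b * c) \<longleftrightarrow> comaximal a b \<and> comaximal a c"
  using comaximal_mult comaximal_dvd by (metis dvd_triv_left dvd_triv_right)

lemma comaximal_power: "comaximal a b \<Longrightarrow> comaximal a (b ^ n)"
proof (induction n)
  case 0
  have "0 * a + 1 * b ^ 0 = 1" by simp
  then show ?case unfolding comaximal_def by blast
qed (simp add: comaximal_mult)

lemma comaximal_one [simp]: "comaximal a 1"
  using comaximal_power[of a _ 0] unfolding comaximal_def by (metis add_0 mult_1 mult_zero_left)

lemma comaximal_dvd_mult:
  assumes "comaximal a b" "a dvd b * c"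
  shows "a dvd c"
proof -
  obtain x y where "x * a + y * b = 1" using assms unfolding comaximal_def by blast
  then have "c = (x * a + y * b) * c" by simp
  also have "\<dots> = (c * x) * a + y * (b * c)" by (simp add: algebra_simps)
  finally show ?thesis using assms(2) by (metis dvd_add dvd_mult dvd_triv_right)
qed

lemma comaximal_irreducible_iff:
  fixes P :: "'a::field poly"
  assumes "irreducible P"
  shows "comaximal P f \<longleftrightarrow> \<not> P dvd f"
proof
  assume "comaximal P f"
  then obtain x y where "x * P + y * f = 1" unfolding comaximal_def by blast
  then show "\<not> P dvd f" using assms
    by (metis dvd_add dvd_mult dvd_triv_right irreducible_not_unit)
next
  assume "\<not> P dvd f"
  then show "comaximal P f" using irreducible_bezout_poly[OF assms] unfolding comaximal_def by metis
qed

context even_const_field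
begin

text \<open>In characteristic two a translation is an involution, so it permutes \<open>S\<close>
  and pairs off opposite values. The set is arbitrary because both \<open>lowdeg\<close> and
  \<open>G_deg\<close> occur.\<close>

lemma sum_translate_0:
  fixes \<phi> :: "'a poly \<Rightarrow> real"
  assumes "\<And>h. h \<in> S \<Longrightarrow> h + e \<in> S" "\<And>h. h \<in> S \<Longrightarrow> \<phi> (h + e) = - \<phi> h"
  shows "sum \<phi> S = 0"
proof -
  have 2: "h + e + e = h" for h :: "'a poly" by (simp add: add.assoc)
  have "sum \<phi> S = (\<Sum>h\<in>S. \<phi> (h + e))"
    by (rule sum.reindex_bij_witness[of _ "\<lambda>h. h + e" "\<lambda>h. h + e"]) (auto simp: 2 assms(1))
  also have "\<dots> = - sum \<phi> S" using assms(2) by (simp add: sum_negf)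
  finally show ?thesis by simp
qed

text \<open>Duality: under the residue pairing modulo \<open>Q\<close>, polynomials of degree below
  \<open>j\<close> are annihilated exactly by those of degree below \<open>degree Q - j\<close>.
  Poisson summation in \<open>functional_equation_aux\<close> uses it for general \<open>j\<close>,
  the averages modulo primes for \<open>j = degree Q\<close>.\<close>

lemma sum_psi_inf_res:
  assumes "Q \<noteq> 0" "j \<le> degree Q"
  shows "(\<Sum>h\<in>lowdeg j. psi (inf_res (h * c) Q))
    = (if c mod Q \<in> lowdeg (degree Q - j) then real CARD('a) ^ j else 0)"
proof (cases "c mod Q \<in> lowdeg (degree Q - j)")
  case True
  have "inf_res (h * c) Q = 0" if h: "h \<in> lowdeg j" for h
  proof (cases "h = 0 \<or> c mod Q = 0")
    case True
    then show ?thesis by (auto intro: inf_res_dvd)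
  next
    case False
    have "inf_res (h * c) Q = inf_res (h * (c mod Q)) Q"
      by (rule inf_res_mod_cong) (simp add: mod_mult_right_eq)
    also have "\<dots> = 0"
      using True h False by (intro inf_res_eq_0) (auto simp: lowdeg_iff degree_mult_eq)
    finally show ?thesis .
  qed
  then show ?thesis using True by (simp add: card_lowdeg)
next
  case False
  define r where "r = c mod Q"
  define d where "d = degree r"
  have r: "r \<noteq> 0" "degree Q - j \<le> d" "d < degree Q"
    using False lowdeg_mod[OF assms(1), of c] by (auto simp: r_def d_def lowdeg_iff)
  \<comment> \<open>The exponent lifts \<open>e * r\<close> to degree \<open>degree Q - 1\<close>,
    the index the residue reads, and the coefficient is scaled so that the residue is \<xi>, where
    \<open>psi\<close> is \<open>- 1\<close>.\<close>
  define e where "e = monom (\<xi> * lead_coeff Q / lead_coeff r) (degree Q - 1 - d)"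
  have xi0: "\<xi> \<noteq> 0" using psi_0 psi_xi by force
  have e0: "e \<noteq> 0" using r xi0 assms by (simp add: e_def)
  have dege: "degree e = degree Q - 1 - d" using e0 unfolding e_def by (metis degree_monom_eq monom_eq_0)
  have ej: "e \<in> lowdeg j" using dege r by (auto simp: lowdeg_iff)
  have "inf_res (e * c) Q = inf_res (e * r) Q"
    by (rule inf_res_mod_cong) (simp add: mod_mult_right_eq r_def)
  also have "\<dots> = coeff (e * r) (degree Q - 1) / lead_coeff Q"
    using dege r e0 by (intro inf_res_eq_coeff) (simp add: degree_mult_eq d_def)
  also have "coeff (e * r) (degree Q - 1) = coeff e (degree e) * coeff r (degree r)"
    using dege r coeff_mult_degree_sum[of e r] by (simp add: d_def)
  also have "\<dots> = \<xi> * lead_coeff Q"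
    using r dege by (simp add: e_def)
  finally have ec: "inf_res (e * c) Q = \<xi>" using assms by simp
  have "(\<Sum>h\<in>lowdeg j. psi (inf_res (h * c) Q)) = 0"
  proof (rule sum_translate_0[where e = e])
    fix h :: "'a poly" assume "h \<in> lowdeg j"
    then show "h + e \<in> lowdeg j" using ej by (rule lowdeg_add)
    show "psi (inf_res ((h + e) * c) Q) = - psi (inf_res (h * c) Q)"
      by (simp add: distrib_right inf_res_add psi_add ec)
  qed
  then show ?thesis using False by simp
qed

lemma sum_psi_inf_res_full:
  assumes "Q \<noteq> 0"
  shows "(\<Sum>h\<in>lowdeg (degree Q). psi (inf_res (h * c) Q))
    = (if Q dvd c then real CARD('a) ^ degree Q else 0)"
  using sum_psi_inf_res[OF assms, of "degree Q" c] by (auto simp: mod_eq_0_iff_dvd)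

text \<open>For degree reasons the derivative would vanish, and then \<open>P\<close> would be a
  square.\<close>

lemma irreducible_not_dvd_pderiv:
  assumes "irreducible P"
  shows "\<not> P dvd pderiv (P::'a poly)"
proof
  assume "P dvd pderiv P"
  moreover obtain s t where st: "P = s\<^sup>2 + [:0, 1:] * t\<^sup>2" "pderiv P = t\<^sup>2" by (rule square_decomposition)
  moreover have "degree P > 0" using assms
    by (metis gr0I irreducible_def is_unit_iff_degree)
  ultimately have "pderiv P = 0" using degree_pderiv_le[of P]
    by (metis One_nat_def Suc_pred dvd_imp_degree_le not_less_eq_eq)
  then have "P = s\<^sup>2" using st by simp
  then show False using assms by (metis irreducible_def irreducibleD power2_eq_square is_unit_mult_iff)
qed

text \<open>The trace form \<open>X \<mapsto> inf_res (X * pderiv f) f\<close> commutes with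
  squaring, so it sends a value of \<open>X\<^sup>2 + X\<close> modulo \<open>f\<close> to a value
  of the same map on constants.\<close>

lemma inf_res_artin_schreier:
  assumes "f dvd X\<^sup>2 + X + h"
  shows "psi (inf_res (h * pderiv f) f) = 1"
proof -
  have "(X\<^sup>2 + X) * pderiv f = h * pderiv f + (X\<^sup>2 + X + h) * pderiv f"
    by (simp add: algebra_simps)
  then have "inf_res (h * pderiv f) f = inf_res ((X\<^sup>2 + X) * pderiv f) f"
    using inf_res_dvd[of f "(X\<^sup>2 + X + h) * pderiv f"] assms by (simp add: inf_res_add)
  also have "\<dots> = (inf_res (X * pderiv f) f)\<^sup>2 + inf_res (X * pderiv f) f"
    by (simp add: distrib_right inf_res_add inf_res_frobenius)
  finally show ?thesis by (simp add: psi_add)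
qed

text \<open>The solvable classes and the kernel of \<open>h \<mapsto> psi (inf_res (h * pderiv P) P)\<close> both have
  index two in \<open>A / P\<close>.\<close>

lemma solvable_iff_psi:
  assumes "irreducible (P::'a poly)"
  shows "(\<exists>X. P dvd X\<^sup>2 + X + h) \<longleftrightarrow> psi (inf_res (h * pderiv P) P) = 1"
proof
  assume "psi (inf_res (h * pderiv P) P) = 1"
  have P0: "P \<noteq> 0" using assms by auto
  let ?S = "lowdeg (degree P) :: 'a poly set"
  define A where "A = {h \<in> ?S. psi (inf_res (h * pderiv P) P) = 1}"
  define B where "B = (\<lambda>X. (X\<^sup>2 + X) mod P) ` ?S"
  have "B \<subseteq> A"
  proof
    fix b assume "b \<in> B"
    then obtain X where X: "b = (X\<^sup>2 + X) mod P" by (auto simp: B_def)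
    have "P dvd X\<^sup>2 + X + b" using X by (metis mod_eq_dvd_iff mod_mod_trivial poly_minus_eq)
    then show "b \<in> A" using X P0 lowdeg_mod by (auto simp: A_def intro: inf_res_artin_schreier)
  qed
  have "card ?S \<le> 2 * card B" unfolding B_def
  proof (rule card_le_two_image[where g = "\<lambda>X. X + 1"])
    fix X Y assume XY: "X \<in> ?S" "Y \<in> ?S" "(X\<^sup>2 + X) mod P = (Y\<^sup>2 + Y) mod P"
    then have "P dvd (X\<^sup>2 + X) + (Y\<^sup>2 + Y)" by (metis mod_eq_dvd_iff poly_minus_eq)
    also have "(X\<^sup>2 + X) + (Y\<^sup>2 + Y) = (X + Y) * (X + Y + 1)"
      by (simp add: power2_eq_square algebra_simps)
    finally have "P dvd X + Y \<or> P dvd X + 1 + Y"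
      using irreducible_dvd_mult_poly[OF assms] by (simp add: ac_simps)
    moreover have "1 \<in> ?S" using assms by (simp add: lowdeg_iff) (metis gr0I irreducible_def is_unit_iff_degree)
    ultimately have "X = Y \<or> X + 1 = Y"
      using XY lowdeg_add mod_lowdeg mod_eq_dvd_iff by (metis poly_minus_eq)
    then show "Y = X \<or> Y = X + 1" by auto
  qed simp
  \<comment> \<open>The character is nontrivial because \<open>pderiv P\<close> is invertible modulo
    \<open>P\<close>, so it takes both signs equally often. With the two-to-one bound this forces
    \<open>B\<close>, contained in \<open>A\<close>, to be all of \<open>A\<close>.\<close>
  moreover have "2 * card A = card ?S"
  proof -
    have "(\<Sum>h\<in>?S. psi (inf_res (h * pderiv P) P)) = 0"
      using sum_psi_inf_res_full[OF P0, of "pderiv P"] irreducible_not_dvd_pderiv[OF assms] by simp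
    moreover have "(\<Sum>h\<in>?S. psi (inf_res (h * pderiv P) P)) = (\<Sum>h\<in>?S. 2 * of_bool (h \<in> A) - 1)"
      using psi_cases by (intro sum.cong) (auto simp: A_def)
    moreover have "\<dots> = 2 * real (card A) - real (card ?S)"
    proof -
      have "(\<Sum>h\<in>?S. of_bool (h \<in> A)) = real (card A)"
        unfolding A_def by (subst sum_of_bool_eq) (auto intro: arg_cong[where f = card])
      then show ?thesis by (simp add: sum_subtractf flip: sum_distrib_left)
    qed
    ultimately show ?thesis by linarith
  qed
  moreover have "card B \<le> card A" using \<open>B \<subseteq> A\<close> by (intro card_mono) (auto simp: A_def)
  ultimately have "card B = card A" by linarith
  then have "B = A" using \<open>B \<subseteq> A\<close> by (intro card_subset_eq) (auto simp: A_def)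
  moreover have "h mod P \<in> A"
  proof -
    have "inf_res (h mod P * pderiv P) P = inf_res (h * pderiv P) P"
      by (rule inf_res_mod_cong) (simp add: mod_mult_left_eq)
    then show ?thesis using \<open>psi _ = 1\<close> P0 lowdeg_mod by (auto simp: A_def)
  qed
  ultimately obtain X where "h mod P = (X\<^sup>2 + X) mod P" by (auto simp: B_def)
  then have "P dvd X\<^sup>2 + X + h" by (metis mod_eq_dvd_iff poly_minus_eq)
  then show "\<exists>X. P dvd X\<^sup>2 + X + h" by blast
qed (use inf_res_artin_schreier in blast)

end

section \<open>The Hasse symbol\<close>

abbreviation monic_irreducible :: "'a::field poly \<Rightarrow> bool" where
  "monic_irreducible P \<equiv> lead_coeff P = 1 \<and> irreducible P"

lemma monic_dvd_monic_irreducible: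
  fixes P Q :: "'a::field poly"
  assumes "monic_irreducible P" "monic_irreducible Q" "P dvd Q"
  shows "P = Q"
proof -
  obtain e where e: "Q = P * e" using assms(3) by (rule dvdE)
  then have "is_unit e" using assms by (metis irreducible_def irreducibleD)
  then obtain c where c: "e = [:c:]" by (metis is_unit_polyE)
  have "lead_coeff e = 1" using assms e by (metis lead_coeff_mult mult_1)
  then show ?thesis using e c by simp
qed

lemma ex_monic_irreducible_factor:
  fixes f :: "'a::field poly"
  assumes "degree f > 0"
  obtains P where "monic_irreducible P" "P dvd f"
proof -
  have "\<exists>P. monic_irreducible P \<and> P dvd f" using assms
  proof (induction "degree f" arbitrary: f rule: less_induct)
    case less
    show ?case
    proof (cases "irreducible f")
      case True
      let ?P = "smult (inverse (lead_coeff f)) f"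
      have "f \<noteq> 0" using less.prems by auto
      then have "lead_coeff ?P = 1" "?P dvd f" by (auto simp: smult_dvd_iff)
      moreover have "irreducible ([:inverse (lead_coeff f):] * f)"
        using True \<open>f \<noteq> 0\<close> by (subst irreducible_mult_unit_left) (auto simp: is_unit_const_poly_iff dvd_field_iff)
      then have "irreducible ?P" by simp
      ultimately show ?thesis by blast
    next
      case False
      moreover have "f \<noteq> 0" using less.prems by auto
      moreover from this have "\<not> is_unit f" using less.prems by (simp add: is_unit_iff_degree)
      ultimately obtain a b where ab: "f = a * b" "\<not> is_unit a" "\<not> is_unit b"
        unfolding irreducible_def by blast
      then have "a \<noteq> 0" "b \<noteq> 0" using \<open>f \<noteq> 0\<close> by auto
      then have "degree a > 0" "degree a < degree f"
        using ab by (auto simp: degree_mult_eq is_unit_iff_degree)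
      then obtain P where "monic_irreducible P \<and> P dvd a" using less.hyps by blast
      then show ?thesis using ab(1) by auto
    qed
  qed
  then show ?thesis using that by blast
qed

lemma monic_induct [consumes 1, case_names one mult]:
  fixes f :: "'a::field poly"
  assumes "lead_coeff f = 1"
    and "R 1" "\<And>P g. monic_irreducible P \<Longrightarrow> lead_coeff g = 1 \<Longrightarrow> R g \<Longrightarrow> R (P * g)"
  shows "R f"
  using assms(1)
proof (induction "degree f" arbitrary: f rule: less_induct)
  case less
  show ?case
  proof (cases "degree f = 0")
    case True
    then obtain c where "f = [:c:]" by (rule degree_eq_zeroE)
    then have "f = 1" using less.prems by (simp add: one_pCons)
    then show ?thesis using assms(2) by simp
  next
    case False
    then obtain P where P: "monic_irreducible P" "P dvd f" using ex_monic_irreducible_factor by blast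
    then obtain g where g: "f = P * g" by (auto elim: dvdE)
    then have lg: "lead_coeff g = 1" using P less.prems by (metis lead_coeff_mult mult_1)
    have "degree P > 0" using P by (metis gr0I irreducible_def is_unit_iff_degree)
    moreover have "P \<noteq> 0" "g \<noteq> 0" using P lg by auto
    ultimately have "degree g < degree f" by (simp add: g degree_mult_eq)
    then show ?thesis using less.hyps lg assms(3) P(1) g by blast
  qed
qed

lemma finite_monic_irreducible_divisors:
  fixes f :: "'a::finite_field poly"
  assumes "f \<noteq> 0"
  shows "finite {P. lead_coeff P = 1 \<and> irreducible P \<and> P dvd f}"
proof (rule finite_subset)
  show "{P. lead_coeff P = 1 \<and> irreducible P \<and> P dvd f} \<subseteq> lowdeg (Suc (degree f))"
    using assms by (auto simp: lowdeg_iff le_imp_less_Suc dvd_imp_degree_le)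
qed simp

lemma finite_power_dvd:
  fixes P f :: "'a::finite_field poly"
  assumes "irreducible P" "f \<noteq> 0"
  shows "finite {e. P ^ e dvd f}"
proof (rule finite_subset)
  have d: "degree P > 0" using assms by (metis gr0I irreducible_def is_unit_iff_degree)
  show "{e. P ^ e dvd f} \<subseteq> {..degree f}"
  proof
    fix e assume "e \<in> {e. P ^ e dvd f}"
    then have "degree (P ^ e) \<le> degree f" using assms(2) by (simp add: dvd_imp_degree_le)
    moreover have "P \<noteq> 0" using assms by auto
    ultimately have "e * degree P \<le> degree f" by (simp add: degree_power_eq)
    moreover have "e \<le> e * degree P" using d by simp
    ultimately show "e \<in> {..degree f}" by (simp only: atMost_iff)
  qed
qed simp

lemma poly_multiplicity_mult_self:
  assumes "irreducible P" "f \<noteq> 0"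
  shows "poly_multiplicity P (P * f) = Suc (poly_multiplicity P f)"
proof -
  have P0: "P \<noteq> 0" using assms by auto
  have e: "{e. P ^ e dvd P * f} = insert 0 (Suc ` {e. P ^ e dvd f})"
  proof (rule set_eqI)
    fix e show "e \<in> {e. P ^ e dvd P * f} \<longleftrightarrow> e \<in> insert 0 (Suc ` {e. P ^ e dvd f})"
      using P0 by (cases e) auto
  qed
  have fin: "finite {e. P ^ e dvd f}" by (rule finite_power_dvd[OF assms])
  moreover have ne: "{e. P ^ e dvd f} \<noteq> {}" by (auto intro: exI[of _ 0])
  ultimately have "Max (insert 0 (Suc ` {e. P ^ e dvd f})) = Suc (Max {e. P ^ e dvd f})"
    by (subst Max_insert) (auto simp: mono_Max_commute[of Suc] mono_Suc)
  then show ?thesis using fin unfolding poly_multiplicity_def e by simp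
qed

lemma poly_multiplicity_mult_other:
  assumes "monic_irreducible P" "monic_irreducible Q" "P \<noteq> Q"
  shows "poly_multiplicity Q (P * f) = poly_multiplicity Q f"
proof -
  have "\<not> P dvd Q" using assms monic_dvd_monic_irreducible by blast
  then have "comaximal P Q" using assms by (simp add: comaximal_irreducible_iff)
  then have "comaximal (Q ^ e) P" for e by (meson comaximal_sym comaximal_power)
  then have "Q ^ e dvd P * f \<longleftrightarrow> Q ^ e dvd f" for e using comaximal_dvd_mult by (metis dvd_mult)
  then show ?thesis by (simp add: poly_multiplicity_def)
qed

lemma poly_multiplicity_not_dvd:
  assumes "\<not> P dvd f"
  shows "poly_multiplicity P f = 0"
proof -
  have "{e. P ^ e dvd f} = {0}"
  proof (rule set_eqI)
    fix e show "e \<in> {e. P ^ e dvd f} \<longleftrightarrow> e \<in> {0}"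
      using assms dvd_trans[of P "P ^ e" f] by (cases e) auto
  qed
  then show ?thesis by (simp add: poly_multiplicity_def)
qed

lemma sum_multiplicity_superset:
  fixes w :: "'a::finite_field poly \<Rightarrow> 'b::comm_semiring_1"
  assumes "f \<noteq> 0" "finite S" "{P. lead_coeff P = 1 \<and> irreducible P \<and> P dvd f} \<subseteq> S"
    and "S \<subseteq> {P. monic_irreducible P}"
  shows "(\<Sum>P | lead_coeff P = 1 \<and> irreducible P \<and> P dvd f. of_nat (poly_multiplicity P f) * w P)
    = (\<Sum>P\<in>S. of_nat (poly_multiplicity P f) * w P)"
proof (rule sum.mono_neutral_left[OF assms(2,3)], rule ballI)
  fix P assume "P \<in> S - {P. lead_coeff P = 1 \<and> irreducible P \<and> P dvd f}"
  then have "\<not> P dvd f" using assms(4) by auto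
  then show "of_nat (poly_multiplicity P f) * w P = 0" by (simp add: poly_multiplicity_not_dvd)
qed

text \<open>Only the multiplicity of \<open>Q\<close> changes, by one. The weight and its semiring
  are left open for two uses: \<open>hasse_prime\<close> with values in \<open>bit\<close>, and the
  degree with values in \<open>nat\<close> for counting primes.\<close>

lemma sum_multiplicity_mult:
  fixes w :: "'a::finite_field poly \<Rightarrow> 'b::comm_semiring_1"
  assumes "f \<noteq> 0" "monic_irreducible Q"
  shows "(\<Sum>P | lead_coeff P = 1 \<and> irreducible P \<and> P dvd Q * f. of_nat (poly_multiplicity P (Q * f)) * w P)
    = w Q + (\<Sum>P | lead_coeff P = 1 \<and> irreducible P \<and> P dvd f. of_nat (poly_multiplicity P f) * w P)"
proof -
  have Q0: "Q \<noteq> 0" using assms by auto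
  define S where "S = {P. lead_coeff P = 1 \<and> irreducible P \<and> P dvd Q * f}"
  have fin: "finite S" unfolding S_def using assms Q0 by (intro finite_monic_irreducible_divisors) auto
  have QS: "Q \<in> S" using assms by (simp add: S_def)
  have "(\<Sum>P\<in>S. of_nat (poly_multiplicity P (Q * f)) * w P)
    = of_nat (poly_multiplicity Q (Q * f)) * w Q + (\<Sum>P\<in>S - {Q}. of_nat (poly_multiplicity P (Q * f)) * w P)"
    by (rule sum.remove[OF fin QS])
  also have "(\<Sum>P\<in>S - {Q}. of_nat (poly_multiplicity P (Q * f)) * w P)
    = (\<Sum>P\<in>S - {Q}. of_nat (poly_multiplicity P f) * w P)"
    using assms by (intro sum.cong refl) (auto simp: S_def poly_multiplicity_mult_other)
  also have "of_nat (poly_multiplicity Q (Q * f)) * w Q = w Q + of_nat (poly_multiplicity Q f) * w Q"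
    using assms by (simp add: poly_multiplicity_mult_self algebra_simps)
  also have "w Q + of_nat (poly_multiplicity Q f) * w Q + (\<Sum>P\<in>S - {Q}. of_nat (poly_multiplicity P f) * w P)
    = w Q + (\<Sum>P\<in>S. of_nat (poly_multiplicity P f) * w P)"
    by (simp add: sum.remove[OF fin QS] add.assoc)
  also have "(\<Sum>P\<in>S. of_nat (poly_multiplicity P f) * w P)
    = (\<Sum>P | lead_coeff P = 1 \<and> irreducible P \<and> P dvd f. of_nat (poly_multiplicity P f) * w P)"
    using assms(1) fin by (intro sum_multiplicity_superset[symmetric]) (auto simp: S_def)
  finally show ?thesis by (simp add: S_def)
qed

lemma hasse_mult:
  assumes "f \<noteq> 0" "monic_irreducible Q"
  shows "hasse u (Q * f) = hasse_prime u Q + hasse u f"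
  unfolding hasse_def using sum_multiplicity_mult[OF assms] .

lemma hasse_1 [simp]: "hasse u 1 = 0"
proof -
  have "{P::'a poly. lead_coeff P = 1 \<and> irreducible P \<and> P dvd 1} = {}"
    by (auto simp: irreducible_def)
  then show ?thesis unfolding hasse_def by (simp only: sum.empty)
qed

lemma coprime_to_denom_Fract:
  assumes "irreducible P" "\<not> P dvd b"
  shows "coprime_to_denom f (Fract b P) \<longleftrightarrow> \<not> P dvd f"
proof
  assume "coprime_to_denom f (Fract b P)"
  then obtain a c where ac: "c \<noteq> 0" "coprime a c" "Fract b P = Fract a c" "coprime f c"
    unfolding coprime_to_denom_def by blast
  have "P \<noteq> 0" using assms by auto
  then have "b * c = a * P" using ac by (simp add: eq_fract)
  then have "P dvd b * c" by simp
  then have "P dvd c" using assms irreducible_dvd_mult_poly by blast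
  then show "\<not> P dvd f" using ac(4) assms(1) coprime_common_divisor irreducible_not_unit by blast
next
  assume f: "\<not> P dvd f"
  have cop: "coprime g P" if g: "\<not> P dvd g" for g
  proof (rule coprimeI)
    fix c assume c: "c dvd g" "c dvd P"
    obtain x y where xy: "x * P + y * g = 1" using irreducible_bezout_poly[OF assms(1) g] by blast
    have "c dvd x * P + y * g" using c by (intro dvd_add) auto
    then show "is_unit c" using xy by simp
  qed
  have "P \<noteq> 0" using assms by auto
  then show "coprime_to_denom f (Fract b P)"
    unfolding coprime_to_denom_def using cop f assms by blast
qed

section \<open>The residue formula for the symbol\<close>

context even_const_field
begin

text \<open>The explicit form of the symbol of \<open>C / D\<close> at \<open>f\<close>, for comaximal \<open>C\<close> and \<open>D\<close>;
  the \<open>h\<close> below represents \<open>C / D\<close> modulo \<open>f\<close>.\<close>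

definition symb :: "'a poly \<Rightarrow> 'a poly \<Rightarrow> 'a poly \<Rightarrow> real" where
  "symb C D f = (if \<exists>h. f dvd h * D + C then psi (inf_res ((SOME h. f dvd h * D + C) * pderiv f) f) else 0)"

text \<open>Signs do not matter in characteristic two, so \<open>f dvd h * D + C\<close> says that
  \<open>h\<close> is congruent to \<open>C / D\<close> modulo \<open>f\<close>. Comaximality of
  \<open>C\<close> and \<open>D\<close> prevents a common factor of \<open>D\<close> and
  \<open>f\<close> from being cancelled by \<open>C\<close>.\<close>

lemma ex_representative_iff:
  assumes "comaximal D C"
  shows "(\<exists>h. f dvd h * D + C) \<longleftrightarrow> comaximal D (f::'a poly)"
proof
  assume "\<exists>h. f dvd h * D + C"
  then obtain h k where hk: "h * D + C = f * k" by (auto elim: dvdE)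
  obtain x y where xy: "x * D + y * C = 1" using assms unfolding comaximal_def by blast
  have "C = f * k + h * D" using hk by (metis add.commute poly_add_self_left)
  then have "(x + y * h) * D + (y * k) * f = 1" using xy by (simp add: algebra_simps)
  then show "comaximal D f" unfolding comaximal_def by blast
next
  assume "comaximal D f"
  then obtain x y where xy: "x * D + y * f = 1" unfolding comaximal_def by blast
  have "(C * x) * D + C = (C * x) * D + C * (x * D + y * f)" using xy by simp
  also have "\<dots> = f * (C * y)" by (simp add: algebra_simps)
  finally show "\<exists>h. f dvd h * D + C" by (metis dvd_triv_left)
qed

text \<open>Two representatives differ by a multiple of \<open>f\<close>, which has no residue over
  \<open>f\<close>; hence the choice made by \<open>SOME\<close> is immaterial.\<close>

lemma symb_eq:
  assumes "comaximal D C" "f dvd h * D + C"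
  shows "symb C D f = psi (inf_res (h * pderiv f) f)"
proof -
  define h' where "h' = (SOME h. f dvd h * D + C)"
  have h': "f dvd h' * D + C" unfolding h'_def using assms(2) by (rule someI)
  have "(h' + h) * D = (h' * D + C) + (h * D + C)" by (simp add: algebra_simps)
  then have "f dvd (h' + h) * D" using h' assms(2) by (metis dvd_add)
  moreover have "comaximal f D" using assms ex_representative_iff comaximal_sym by blast
  ultimately have "f dvd h' + h" using comaximal_dvd_mult by (metis mult.commute)
  then have "inf_res ((h' + h) * pderiv f) f = 0" by (simp add: inf_res_dvd)
  then have "inf_res (h' * pderiv f) f = inf_res (h * pderiv f) f"
    by (simp add: distrib_right inf_res_add) (metis add_self_left add.right_neutral)
  then show ?thesis using assms(2) unfolding symb_def h'_def by auto
qed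

lemma symb_eq_0: "comaximal D C \<Longrightarrow> \<not> comaximal D f \<Longrightarrow> symb C D f = 0"
  using ex_representative_iff unfolding symb_def by auto

text \<open>The logarithmic derivative turns products into sums; this is where the symbol gets its
  multiplicativity in \<open>f\<close>.\<close>

lemma inf_res_log_deriv:
  assumes "f \<noteq> 0" "g \<noteq> 0"
  shows "inf_res (h * pderiv (f * g)) (f * g) = inf_res (h * pderiv f) f + inf_res (h * pderiv g) (g::'a poly)"
proof -
  have "h * pderiv (f * g) = f * (h * pderiv g) + (h * pderiv f) * g"
    by (simp add: pderiv_mult algebra_simps)
  then show ?thesis using assms
    by (simp add: inf_res_add inf_res_mult_cancel inf_res_mult_cancel_left add.commute)
qed

lemma symb_mult:
  assumes "comaximal D C" "f \<noteq> 0" "g \<noteq> 0"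
  shows "symb C D (f * g) = symb C D f * symb C D g"
proof (cases "comaximal D (f * g)")
  case True
  then obtain h where h: "f * g dvd h * D + C" using assms ex_representative_iff by blast
  then have "f dvd h * D + C" "g dvd h * D + C" by (metis dvd_mult_left dvd_mult_right)+
  then show ?thesis using h assms by (simp add: symb_eq inf_res_log_deriv psi_add)
next
  case False
  then have "\<not> comaximal D f \<or> \<not> comaximal D g" by (simp add: comaximal_mult_iff)
  then show ?thesis using False assms(1) symb_eq_0 by auto
qed

lemma symb_const: "comaximal D C \<Longrightarrow> c \<noteq> 0 \<Longrightarrow> symb C D [:c:] = 1"
proof -
  assume c: "comaximal D C" "c \<noteq> 0"
  then have "is_unit [:c:]" by (simp add: is_unit_const_poly_iff dvd_field_iff)
  then have "[:c:] dvd 0 * D + C" by (rule unit_imp_dvd)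
  then show ?thesis using symb_eq[OF c(1), of "[:c:]" 0] by (simp add: pderiv_pCons)
qed

lemma symb_1: "comaximal D C \<Longrightarrow> symb C D 1 = 1"
  using symb_const[of D C 1] by (simp add: one_pCons)

lemma symb_smult: "comaximal D C \<Longrightarrow> c \<noteq> 0 \<Longrightarrow> f \<noteq> 0 \<Longrightarrow> symb C D (smult c f) = symb C D f"
  using symb_mult[of D C "[:c:]" f] by (simp add: symb_const)

lemma symb_square:
  assumes "comaximal D C" "pderiv f = 0"
  shows "symb C D f = (if comaximal D f then 1 else 0)"
proof (cases "comaximal D f")
  case True
  then obtain h where "f dvd h * D + C" using assms ex_representative_iff by blast
  then show ?thesis using True assms by (simp add: symb_eq)
qed (simp add: assms symb_eq_0)

lemma symb_prime_eq_1_iff: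
  assumes "comaximal D C" "irreducible P" "comaximal D P"
  shows "symb C D P = 1 \<longleftrightarrow> (\<exists>X. P dvd (X\<^sup>2 + X) * D + C)"
proof -
  obtain h where h: "P dvd h * D + C" using assms ex_representative_iff by blast
  have "P dvd (X\<^sup>2 + X) * D + C \<longleftrightarrow> P dvd X\<^sup>2 + X + h" for X
  proof -
    have "(X\<^sup>2 + X) * D + C = (X\<^sup>2 + X + h) * D + (h * D + C)" by (simp add: algebra_simps)
    then have "P dvd (X\<^sup>2 + X) * D + C \<longleftrightarrow> P dvd D * (X\<^sup>2 + X + h)"
      using h by (metis dvd_add_left_iff mult.commute)
    also have "\<dots> \<longleftrightarrow> P dvd X\<^sup>2 + X + h"
      using comaximal_dvd_mult[OF comaximal_sym[OF assms(3)], of "X\<^sup>2 + X + h"] dvd_mult by blast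
    finally show ?thesis .
  qed
  then show ?thesis using solvable_iff_psi[OF assms(2), of h] by (simp add: symb_eq[OF assms(1) h])
qed

lemma symb_cases: "comaximal D C \<Longrightarrow> comaximal D f \<Longrightarrow> symb C D f = 1 \<or> symb C D f = - 1"
  using psi_cases by (auto simp: symb_def ex_representative_iff)

lemma hasse_prime_eq_0_iff:
  assumes "irreducible P" "irreducible Q" "\<not> Q dvd P"
  shows "hasse_prime (Fract b P) Q = 0 \<longleftrightarrow> (\<exists>X. Q dvd (X\<^sup>2 + X) * P + (b::'a poly))"
proof -
  have P0: "P \<noteq> 0" using assms by auto
  have cong: "fract_cong (to_fract Y) (Fract b P) Q \<longleftrightarrow> Q dvd Y * P + b" for Y
  proof -
    have s: "to_fract Y - Fract b P = Fract (Y * P + b) P"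
      using P0 by (simp add: to_fract_def)
    show ?thesis
    proof
      assume "fract_cong (to_fract Y) (Fract b P) Q"
      then obtain a c where ac: "\<not> Q dvd c" "Q dvd a" "Fract (Y * P + b) P = Fract a c"
        unfolding fract_cong_def s by blast
      then have "c \<noteq> 0" by auto
      then have "(Y * P + b) * c = a * P" using ac P0 by (simp add: eq_fract)
      then have "Q dvd (Y * P + b) * c" using ac(2) by simp
      then show "Q dvd Y * P + b" using ac(1) assms(2) irreducible_dvd_mult_poly by blast
    next
      assume "Q dvd Y * P + b"
      then show "fract_cong (to_fract Y) (Fract b P) Q"
        unfolding fract_cong_def s using assms(3) by blast
    qed
  qed
  show ?thesis unfolding hasse_prime_def artin_schreier_def cong by simp
qed

text \<open>Bridge from the given definitions to the residue formula. Both sides are completely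
  multiplicative in \<open>f\<close> and agree at primes, where they decide the same Artin-Schreier
  equation; for \<open>f\<close> divisible by \<open>P\<close> both take the default value
  \<open>0\<close>.\<close>

lemma hasse_char_eq_symb:
  assumes "irreducible P" "\<not> P dvd b" "lead_coeff f = 1"
  shows "real_of_int (hasse_char (Fract b P) f) = symb b P f"
proof -
  have cm: "comaximal P b" using assms by (simp add: comaximal_irreducible_iff)
  have main: "(if hasse (Fract b P) f = 0 then 1 else - 1) = symb b P f" if "comaximal P f"
    using assms(3) that
  proof (induction f rule: monic_induct)
    case one
    then show ?case by (simp add: symb_1 cm)
  next
    case (mult Q g)
    have g0: "g \<noteq> 0" "Q \<noteq> 0" using mult by auto
    have cm': "comaximal P Q" "comaximal P g" using mult.prems by (auto simp: comaximal_mult_iff)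
    then have "\<not> Q dvd P" using mult.hyps comaximal_sym comaximal_irreducible_iff by blast
    then have "(hasse_prime (Fract b P) Q = 0) = (symb b P Q = 1)"
      using hasse_prime_eq_0_iff symb_prime_eq_1_iff[OF cm _ cm'(1)] mult.hyps assms by blast
    then have "symb b P Q = (if hasse_prime (Fract b P) Q = 0 then 1 else - 1)"
      using symb_cases[OF cm cm'(1)] by auto
    moreover have "symb b P (Q * g) = symb b P Q * symb b P g" using g0 cm by (simp add: symb_mult)
    moreover have "hasse (Fract b P) (Q * g) = hasse_prime (Fract b P) Q + hasse (Fract b P) g"
      using g0 mult.hyps by (intro hasse_mult) auto
    ultimately show ?case using mult.IH[OF cm'(2), symmetric]
      by (cases "hasse_prime (Fract b P) Q"; cases "hasse (Fract b P) g") auto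
  qed
  show ?thesis
  proof (cases "P dvd f")
    case True
    then show ?thesis using assms cm
      by (simp add: hasse_char_def coprime_to_denom_Fract symb_eq_0 comaximal_irreducible_iff)
  next
    case False
    then show ?thesis using assms main
      by (simp add: hasse_char_def coprime_to_denom_Fract comaximal_irreducible_iff split: if_splits)
  qed
qed

end

section \<open>Gauss sums\<close>

lemma comaximal_add_mult_iff: "comaximal (a + b * z) b \<longleftrightarrow> comaximal a b"
proof -
  have 1: "comaximal (a + b * z) b" if "comaximal a b" for a z
  proof -
    obtain x y where "x * a + y * b = 1" using \<open>comaximal a b\<close> unfolding comaximal_def by blast
    then have "x * (a + b * z) + (y - x * z) * b = 1" by (simp add: algebra_simps)
    then show ?thesis unfolding comaximal_def by blast
  qed
  show ?thesis using 1[of a z] 1[of "a + b * z" "- z"] by (auto simp: algebra_simps)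
qed

lemma comaximal_mult_left_iff: "comaximal (a * b) c \<longleftrightarrow> comaximal a c \<and> comaximal b c"
  using comaximal_mult_iff comaximal_sym by metis

lemma comaximal_square_iff: "comaximal a (b\<^sup>2) \<longleftrightarrow> comaximal a b"
  by (simp add: power2_eq_square comaximal_mult_iff)

context even_const_field
begin

lemma comaximal_iff_inverse: "comaximal (a::'a poly) b \<longleftrightarrow> (\<exists>x. b dvd a * x + 1)"
proof
  assume "comaximal a b"
  then obtain x y where xy: "x * a + y * b = 1" unfolding comaximal_def by blast
  have "a * x + 1 = a * x + (x * a + y * b)" using xy by simp
  also have "\<dots> = b * y" by (simp add: mult.commute)
  finally show "\<exists>x. b dvd a * x + 1" by (metis dvd_triv_left)
next
  assume "\<exists>x. b dvd a * x + 1"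
  then obtain x y where "a * x + 1 = b * y" by (auto elim: dvdE)
  then have "x * a + y * b = 1" by (metis add.assoc mult.commute poly_add_self_left)
  then show "comaximal a b" unfolding comaximal_def by blast
qed

lemma comaximal_cong_dvd:
  assumes "comaximal a b" "b dvd a + (c::'a poly)"
  shows "comaximal c b"
proof -
  obtain z where z: "a + c = b * z" using assms(2) by (auto elim: dvdE)
  then have "c = a + b * z" by (metis poly_add_self_left)
  then show ?thesis using assms(1) comaximal_add_mult_iff by blast
qed

text \<open>The finite part of the symbol of \<open>B / Q\<^sup>2\<close>; a character modulo \<open>Q\<^sup>2\<close>.\<close>

definition fin_char :: "'a poly \<Rightarrow> 'a poly \<Rightarrow> 'a poly \<Rightarrow> real" where
  "fin_char B Q f = (if \<exists>x. Q\<^sup>2 dvd f * x + 1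
     then psi (inf_res (B * pderiv f * (SOME x. Q\<^sup>2 dvd f * x + 1)) (Q\<^sup>2)) else 0)"

lemma fin_char_eq:
  assumes "Q\<^sup>2 dvd f * x + 1"
  shows "fin_char B Q f = psi (inf_res (B * pderiv f * x) (Q\<^sup>2))"
proof -
  define y where "y = (SOME x. Q\<^sup>2 dvd f * x + 1)"
  have y: "Q\<^sup>2 dvd f * y + 1" unfolding y_def using assms by (rule someI)
  have "f * (y + x) = (f * y + 1) + (f * x + 1)" by (simp add: algebra_simps)
  then have "Q\<^sup>2 dvd f * (y + x)" using y assms by (metis dvd_add)
  moreover have "comaximal (Q\<^sup>2) f" using assms comaximal_iff_inverse comaximal_sym by blast
  ultimately have "Q\<^sup>2 dvd y + x" using comaximal_dvd_mult by blast
  then have "inf_res (B * pderiv f * (y + x)) (Q\<^sup>2) = 0" by (intro inf_res_dvd dvd_mult)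
  then have "inf_res (B * pderiv f * y) (Q\<^sup>2) + inf_res (B * pderiv f * x) (Q\<^sup>2) = 0"
    by (simp add: distrib_left inf_res_add)
  then have "inf_res (B * pderiv f * y) (Q\<^sup>2) = inf_res (B * pderiv f * x) (Q\<^sup>2)"
    by (metis add_self_left add.right_neutral)
  then show ?thesis using assms unfolding fin_char_def y_def[symmetric] by auto
qed

lemma fin_char_eq_0: "\<not> comaximal f Q \<Longrightarrow> fin_char B Q f = 0"
  using comaximal_iff_inverse comaximal_square_iff unfolding fin_char_def by metis

lemma inverse_mod_square: "comaximal f Q \<Longrightarrow> \<exists>x. Q\<^sup>2 dvd f * x + (1::'a poly)"
  using comaximal_iff_inverse comaximal_square_iff by metis

lemma fin_char_cases: "comaximal f Q \<Longrightarrow> fin_char B Q f = 1 \<or> fin_char B Q f = - 1"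
  using inverse_mod_square fin_char_eq psi_cases by metis

lemma fin_char_mult: "fin_char B Q (f * g) = fin_char B Q f * fin_char B Q g"
proof (cases "comaximal f Q \<and> comaximal g Q")
  case True
  then obtain x y where x: "Q\<^sup>2 dvd f * x + 1" and y: "Q\<^sup>2 dvd g * y + 1"
    using inverse_mod_square by blast
  have "f * g * (x * y) + 1 = (f * x + 1) * (g * y) + (g * y + 1)" by (simp add: algebra_simps)
  also have "Q\<^sup>2 dvd \<dots>" using x y by (simp add: dvd_add)
  finally have xy: "Q\<^sup>2 dvd f * g * (x * y) + 1" .
  define e where "e = (g * y + 1) * (B * pderiv f * x) + (f * x + 1) * (B * pderiv g * y)"
  have "Q\<^sup>2 dvd e" using x y by (simp add: e_def dvd_add)
  then have e0: "inf_res e (Q\<^sup>2) = 0" by (rule inf_res_dvd)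
  have "B * pderiv (f * g) * (x * y) = B * pderiv f * x + B * pderiv g * y + e"
    by (simp add: e_def pderiv_mult algebra_simps)
  then have "inf_res (B * pderiv (f * g) * (x * y)) (Q\<^sup>2)
      = inf_res (B * pderiv f * x) (Q\<^sup>2) + inf_res (B * pderiv g * y) (Q\<^sup>2)"
    by (simp only: inf_res_add e0 add_0_right)
  then show ?thesis using x y xy by (simp add: fin_char_eq psi_add)
next
  case False
  then have "\<not> comaximal (f * g) Q" by (simp add: comaximal_mult_left_iff)
  then show ?thesis using False fin_char_eq_0 by auto
qed

lemma fin_char_const: "c \<noteq> 0 \<Longrightarrow> fin_char B Q [:c:] = 1"
proof -
  assume "c \<noteq> 0"
  then have "Q\<^sup>2 dvd [:c:] * [:inverse c:] + 1" by (simp add: one_pCons[symmetric])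
  from fin_char_eq[OF this] show ?thesis by (simp add: pderiv_pCons)
qed

lemma fin_char_smult: "c \<noteq> 0 \<Longrightarrow> fin_char B Q (smult c f) = fin_char B Q f"
  using fin_char_mult[of B Q "[:c:]" f] by (simp add: fin_char_const)

lemma fin_char_1 [simp]: "fin_char B Q 1 = 1"
  using fin_char_const[of 1 B Q] by (simp add: one_pCons)

lemma fin_char_0: "degree Q > 0 \<Longrightarrow> fin_char B Q 0 = 0"
proof -
  assume "degree Q > 0"
  then have "Q \<noteq> 0" "degree Q \<noteq> 0" by auto
  then have "\<not> is_unit Q" by (simp add: is_unit_iff_degree)
  then have "\<not> comaximal 0 Q" unfolding comaximal_def by (auto simp: dvd_def mult.commute)
  then show ?thesis by (rule fin_char_eq_0)
qed

text \<open>Because \<open>pderiv (k * Q\<^sup>2) = pderiv k * Q\<^sup>2\<close>, changing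
  \<open>f\<close> by a multiple of \<open>Q\<^sup>2\<close> changes its derivative by one as well.
  This is the reason for a square modulus.\<close>

lemma fin_char_cong:
  assumes "Q\<^sup>2 dvd f + g"
  shows "fin_char B Q f = fin_char B Q g"
proof (cases "comaximal f Q")
  case True
  then obtain x where x: "Q\<^sup>2 dvd f * x + 1" using inverse_mod_square by blast
  obtain k where k: "f + g = Q\<^sup>2 * k" using assms by (auto elim: dvdE)
  then have g: "g = f + k * Q\<^sup>2" by (metis mult.commute poly_add_self_left)
  have "g * x + 1 = (f * x + 1) + Q\<^sup>2 * (k * x)" by (simp add: g algebra_simps)
  also have "Q\<^sup>2 dvd \<dots>" using x by simp
  finally have x': "Q\<^sup>2 dvd g * x + 1" .
  have "B * pderiv g * x = B * pderiv f * x + Q\<^sup>2 * (B * pderiv k * x)"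
    by (simp add: g pderiv_add pderiv_mult_square algebra_simps)
  then have "inf_res (B * pderiv g * x) (Q\<^sup>2) = inf_res (B * pderiv f * x) (Q\<^sup>2)"
    by (simp add: inf_res_add inf_res_dvd)
  then show ?thesis by (simp add: fin_char_eq[OF x] fin_char_eq[OF x'])
next
  case False
  then have "\<not> comaximal f (Q\<^sup>2)" by (simp add: comaximal_square_iff)
  then have "\<not> comaximal g (Q\<^sup>2)" using comaximal_cong_dvd[of g "Q\<^sup>2" f] assms by (auto simp: add.commute)
  then have "\<not> comaximal g Q" by (simp add: comaximal_square_iff)
  then show ?thesis using False by (simp add: fin_char_eq_0)
qed

end

text \<open>\<open>comaximal_B\<close> provides the stationary class of the Gauss sum, and
  \<open>Q_dvd\<close> removes the quadratic term of the character on \<open>1 + Q * w\<close>. The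
  two uses are \<open>Q = P\<close> with \<open>B = a * P\<close>, and, after inversion of
  \<open>T\<close>, a \<open>Q\<close> with a power of \<open>T\<close> as additional
  factor.\<close>

locale gauss_char = even_const_field \<xi> for \<xi> :: "'a::finite_field" +
  fixes B Q :: "'a poly"
  assumes degree_Q: "degree Q > 0" and comaximal_B: "comaximal (pderiv B) Q"
    and Q_dvd: "Q dvd B * pderiv Q"
begin

abbreviation "chr \<equiv> fin_char B Q"

lemma Q_nonzero: "Q \<noteq> 0" using degree_Q by auto

lemma degree_Q_square: "degree (Q\<^sup>2) = degree Q + degree Q"
  using Q_nonzero by (simp add: degree_power_eq)

lemma char_one_plus: "chr (1 + Q * w) = psi (inf_res (pderiv B * w) Q)"
proof -
  have "(1 + Q * w) * (1 + Q * w) + 1 = Q\<^sup>2 * w\<^sup>2"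
    by (simp add: algebra_simps power2_eq_square)
  then have "Q\<^sup>2 dvd (1 + Q * w) * (1 + Q * w) + 1" by simp
  then have "chr (1 + Q * w) = psi (inf_res (B * pderiv (1 + Q * w) * (1 + Q * w)) (Q\<^sup>2))"
    by (rule fin_char_eq)
  \<comment> \<open>The factor \<open>1 + Q * w\<close> is its own inverse modulo
    \<open>Q\<^sup>2\<close>. The product is sorted by its fate over \<open>Q\<^sup>2\<close>: a
    derivative, with residue zero; a term linear in \<open>w\<close>; a quadratic term, divisible by
    \<open>Q\<^sup>2\<close> thanks to \<open>Q_dvd\<close>; and a plain multiple of
    \<open>Q\<^sup>2\<close>.\<close>
  also have "B * pderiv (1 + Q * w) * (1 + Q * w)
      = pderiv (B * Q * w) + (pderiv B * w) * Q + (B * pderiv Q * w\<^sup>2) * Q + Q\<^sup>2 * (B * w * pderiv w)"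
    by (simp add: pderiv_add pderiv_mult algebra_simps power2_eq_square)
  also have "inf_res \<dots> (Q\<^sup>2) = inf_res (pderiv B * w) Q + inf_res (B * pderiv Q * w\<^sup>2) Q"
    using inf_res_mult_cancel[OF Q_nonzero, of _ Q]
    by (simp add: inf_res_add inf_res_pderiv_square inf_res_dvd power2_eq_square[symmetric])
  also have "inf_res (B * pderiv Q * w\<^sup>2) Q = 0" by (rule inf_res_dvd, rule dvd_mult2, rule Q_dvd)
  finally show ?thesis by simp
qed

lemma char_shift:
  assumes "Q\<^sup>2 dvd f * x + 1"
  shows "chr (f + Q * z) = chr f * psi (inf_res (pderiv B * x * z) Q)"
proof -
  have "(f + Q * z) + f * (1 + Q * (x * z)) = (Q * z) * (f * x + 1)"
    by (simp add: algebra_simps)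
  then have "Q\<^sup>2 dvd (f + Q * z) + f * (1 + Q * (x * z))" using assms by simp
  then have "chr (f + Q * z) = chr (f * (1 + Q * (x * z)))" by (rule fin_char_cong)
  then show ?thesis by (simp add: fin_char_mult char_one_plus mult.assoc)
qed

definition gauss_term :: "'a poly \<Rightarrow> 'a poly \<Rightarrow> real" where
  "gauss_term h f = chr f * psi (inf_res (h * f) (Q\<^sup>2))"

text \<open>Along a class modulo \<open>Q\<close> the term varies by an additive character of
  \<open>z\<close>, so summing over \<open>z\<close> leaves only the stationary classes, those where
  \<open>pderiv B * x + h\<close> vanishes modulo \<open>Q\<close>.\<close>

lemma gauss_term_shift:
  assumes "Q\<^sup>2 dvd f * x + 1"
  shows "gauss_term h (f + Q * z) = gauss_term h f * psi (inf_res (z * (pderiv B * x + h)) Q)"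
proof -
  have "h * (f + Q * z) = h * f + (h * z) * Q" by (simp add: algebra_simps)
  then have "inf_res (h * (f + Q * z)) (Q\<^sup>2) = inf_res (h * f) (Q\<^sup>2) + inf_res (h * z) Q"
    using inf_res_mult_cancel[OF Q_nonzero, of "h * z" Q] by (simp add: inf_res_add power2_eq_square)
  then show ?thesis unfolding gauss_term_def char_shift[OF assms]
    by (simp add: psi_add inf_res_add distrib_left mult.commute mult.left_commute mult.assoc)
qed

lemma Q_dvd_inverse_iff:
  assumes "Q\<^sup>2 dvd f * x + 1"
  shows "Q dvd pderiv B * x + h \<longleftrightarrow> Q dvd pderiv B + h * f"
proof -
  have Q1: "Q dvd f * x + 1" using assms by (metis dvd_mult_left power2_eq_square)
  then have "comaximal Q f" using comaximal_iff_inverse comaximal_sym by blast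
  then have "Q dvd pderiv B * x + h \<longleftrightarrow> Q dvd f * (pderiv B * x + h)"
    using comaximal_dvd_mult by (metis dvd_mult)
  also have "f * (pderiv B * x + h) = (pderiv B + h * f) + pderiv B * (f * x + 1)"
    by (simp add: algebra_simps)
  also have "Q dvd \<dots> \<longleftrightarrow> Q dvd pderiv B + h * f"
    using Q1 by (intro dvd_add_left_iff) simp
  finally show ?thesis .
qed

lemma sum_gauss_term_shift:
  "(\<Sum>z\<in>lowdeg (degree Q). gauss_term h (f + Q * z)) =
    (if comaximal f Q \<and> Q dvd pderiv B + h * f then real CARD('a) ^ degree Q * gauss_term h f else 0)"
proof (cases "comaximal f Q")
  case True
  then obtain x where x: "Q\<^sup>2 dvd f * x + 1" using inverse_mod_square by blast
  have "(\<Sum>z\<in>lowdeg (degree Q). gauss_term h (f + Q * z))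
    = gauss_term h f * (\<Sum>z\<in>lowdeg (degree Q). psi (inf_res (z * (pderiv B * x + h)) Q))"
    by (simp add: gauss_term_shift[OF x] sum_distrib_left)
  also have "\<dots> = gauss_term h f * (if Q dvd pderiv B * x + h then real CARD('a) ^ degree Q else 0)"
    by (simp only: sum_psi_inf_res_full[OF Q_nonzero])
  finally show ?thesis using True Q_dvd_inverse_iff[OF x] by simp
next
  case False
  then have "gauss_term h (f + Q * z) = 0" for z
    by (simp add: gauss_term_def fin_char_eq_0 comaximal_add_mult_iff)
  then show ?thesis using False by simp
qed

text \<open>The root number is one because the stationary point \<open>pderiv B\<close> is a derivative: the
  character is trivial on it, and so is the additive character.\<close>

lemma gauss_sum:
  "(\<Sum>f\<in>lowdeg (degree Q + degree Q). gauss_term h f) = real CARD('a) ^ degree Q * chr h"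
proof -
  let ?R = "degree Q" and ?c = "pderiv B"
  have "(\<Sum>f\<in>lowdeg (?R + ?R). gauss_term h f)
    = (\<Sum>(r, z)\<in>lowdeg ?R \<times> lowdeg ?R. gauss_term h (r + Q * z))"
    using sum.reindex_bij_betw[OF bij_betw_lowdeg_division[OF Q_nonzero], of "gauss_term h" ?R]
    by (simp add: case_prod_unfold)
  also have "\<dots> = (\<Sum>r\<in>lowdeg ?R. \<Sum>z\<in>lowdeg ?R. gauss_term h (r + Q * z))"
    by (simp add: sum.cartesian_product)
  also have "\<dots> = (\<Sum>r\<in>lowdeg ?R. if comaximal r Q \<and> Q dvd ?c + h * r
      then real CARD('a) ^ ?R * gauss_term h r else 0)"
    by (simp only: sum_gauss_term_shift)
  also have "\<dots> = real CARD('a) ^ ?R * chr h"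
  proof (cases "comaximal h Q")
    case False
    have "\<not> Q dvd ?c + h * r" for r
    proof
      assume "Q dvd ?c + h * r"
      then have "comaximal (h * r) Q" using comaximal_B comaximal_cong_dvd by blast
      then show False using False by (simp add: comaximal_mult_left_iff)
    qed
    then show ?thesis using False by (simp add: fin_char_eq_0)
  next
    case True
    then obtain y where y: "Q\<^sup>2 dvd h * y + 1" using inverse_mod_square by blast
    have Qy: "Q dvd h * y + 1" using y by (metis dvd_mult_left power2_eq_square)
    have cy: "comaximal y Q" using Qy comaximal_iff_inverse by (metis mult.commute)
    \<comment> \<open>With \<open>y\<close> the inverse of \<open>h\<close>, the stationary
      condition \<open>?c + h * r = 0\<close> modulo \<open>Q\<close> has the single solution
      \<open>?c * y\<close>.\<close>
    define r0 where "r0 = (?c * y) mod Q"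
    have r0: "r0 \<in> lowdeg ?R" using Q_nonzero lowdeg_mod by (auto simp: r0_def)
    have r0_eq: "?c * y = r0 + Q * ((?c * y) div Q)" by (simp add: r0_def)
    have hc: "Q dvd ?c + h * (?c * y)"
    proof -
      have "?c + h * (?c * y) = ?c * (h * y + 1)" by (simp add: algebra_simps)
      then show ?thesis using Qy by simp
    qed
    have cop: "comaximal r0 Q"
      using comaximal_B cy comaximal_add_mult_iff r0_eq by (metis comaximal_mult_left_iff)
    have hr0: "Q dvd ?c + h * r0"
    proof -
      have "?c + h * r0 = (?c + h * (?c * y)) + Q * (h * ((?c * y) div Q))"
      proof -
        have "h * (?c * y) = h * r0 + Q * (h * ((?c * y) div Q))"
          by (subst r0_eq) (simp only: distrib_left mult.left_commute)
        then show ?thesis by (simp only: add.assoc poly_add_self add_0_right)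
      qed
      then show ?thesis using hc by (metis dvd_add dvd_triv_left)
    qed
    have uniq: "r = r0" if r: "r \<in> lowdeg ?R" "Q dvd ?c + h * r" for r
    proof -
      have "h * (r + r0) = (?c + h * r) + (?c + h * r0)" by (simp add: algebra_simps)
      then have "Q dvd h * (r + r0)" using r hr0 by (metis dvd_add)
      then have "Q dvd r + r0" using True comaximal_dvd_mult comaximal_sym by blast
      then have "r mod Q = r0 mod Q" by (metis mod_eq_dvd_iff poly_minus_eq)
      then show ?thesis using r(1) r0 by (simp add: mod_lowdeg)
    qed
    have "(\<Sum>r\<in>lowdeg ?R. if comaximal r Q \<and> Q dvd ?c + h * r
      then real CARD('a) ^ ?R * gauss_term h r else 0) = (\<Sum>r\<in>lowdeg ?R. if r = r0 then real CARD('a) ^ ?R * gauss_term h r0 else 0)"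
    proof (rule sum.cong[OF refl])
      fix r :: "'a poly" assume "r \<in> lowdeg ?R"
      then show "(if comaximal r Q \<and> Q dvd ?c + h * r then real CARD('a) ^ ?R * gauss_term h r else 0)
        = (if r = r0 then real CARD('a) ^ ?R * gauss_term h r0 else 0)"
        using uniq[of r] cop hr0 by (cases "r = r0") auto
    qed
    also have "\<dots> = real CARD('a) ^ ?R * gauss_term h r0" using r0 by simp
    \<comment> \<open>On a stationary class the term is constant, so it may be evaluated at the
      unreduced point, where the derivative \<open>?c\<close> is still visible as a factor.\<close>
    also have "gauss_term h r0 = gauss_term h (?c * y)"
    proof -
      obtain x where x: "Q\<^sup>2 dvd r0 * x + 1" using cop inverse_mod_square by blast
      then have "Q dvd ?c * x + h" using Q_dvd_inverse_iff hr0 by blast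
      then have "inf_res (z * (?c * x + h)) Q = 0" for z by (intro inf_res_dvd dvd_mult)
      then show ?thesis by (subst r0_eq) (simp add: gauss_term_shift[OF x])
    qed
    also have "\<dots> = chr h"
    proof -
      obtain x where "Q\<^sup>2 dvd ?c * x + 1" using comaximal_B inverse_mod_square by blast
      then have "chr ?c = 1" by (simp add: fin_char_eq)
      moreover have "chr h * chr y = 1"
      proof -
        have "chr (h * y) = chr 1" using y by (rule fin_char_cong)
        then show ?thesis by (simp add: fin_char_mult)
      qed
      \<comment> \<open>The nonzero values are signs, so an element and its inverse have the same
        value.\<close>
      then have "chr y = chr h" using fin_char_cases[OF True, of B] by auto
      moreover have "inf_res (h * (?c * y)) (Q\<^sup>2) = 0"
      proof -
        have "h * (?c * y) = ?c + Q\<^sup>2 * 0 + (h * y + 1) * ?c" by (simp add: algebra_simps)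
        then show ?thesis using y by (simp add: inf_res_add inf_res_pderiv_square inf_res_dvd)
      qed
      ultimately show ?thesis by (simp add: gauss_term_def fin_char_mult)
    qed
    finally show ?thesis .
  qed
  finally show ?thesis .
qed

text \<open>The sum runs over an additive group, as the duality needs, rather than over monic
  polynomials; the character is trivial on constants, so this costs only a factor
  \<open>CARD('a) - 1\<close>.\<close>

definition partial_sum :: "nat \<Rightarrow> real" where
  "partial_sum j = (\<Sum>f\<in>lowdeg j. chr f)"

text \<open>Poisson summation: \<open>chr h\<close> is replaced by its Gauss sum over
  \<open>f\<close>, and summing over \<open>h\<close> first forces \<open>f\<close> into the dual
  range \<open>lowdeg j\<close>.\<close>

lemma functional_equation_aux:
  assumes "j \<le> 2 * degree Q"
  shows "real CARD('a) ^ degree Q * partial_sum (2 * degree Q - j)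
    = real CARD('a) ^ (2 * degree Q - j) * partial_sum j"
proof -
  let ?R = "degree Q"
  have "real CARD('a) ^ ?R * partial_sum (2 * ?R - j)
      = (\<Sum>h\<in>lowdeg (2 * ?R - j). \<Sum>f\<in>lowdeg (?R + ?R). gauss_term h f)"
    by (simp only: gauss_sum partial_sum_def sum_distrib_left)
  also have "\<dots> = (\<Sum>f\<in>lowdeg (?R + ?R). chr f * (\<Sum>h\<in>lowdeg (2 * ?R - j). psi (inf_res (h * f) (Q\<^sup>2))))"
    by (subst sum.swap) (simp add: gauss_term_def sum_distrib_left)
  also have "\<dots> = (\<Sum>f\<in>lowdeg (?R + ?R). chr f * (if f \<in> lowdeg j then real CARD('a) ^ (2 * ?R - j) else 0))"
  proof (rule sum.cong[OF refl])
    fix f :: "'a poly" assume "f \<in> lowdeg (?R + ?R)"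
    then have "f mod Q\<^sup>2 = f" using degree_Q_square by (simp add: mod_lowdeg)
    moreover have "degree (Q\<^sup>2) - (2 * ?R - j) = j" using assms degree_Q_square by simp
    ultimately show "chr f * (\<Sum>h\<in>lowdeg (2 * ?R - j). psi (inf_res (h * f) (Q\<^sup>2)))
      = chr f * (if f \<in> lowdeg j then real CARD('a) ^ (2 * ?R - j) else 0)"
      using sum_psi_inf_res[of "Q\<^sup>2" "2 * ?R - j" f] degree_Q_square Q_nonzero by simp
  qed
  also have "\<dots> = (\<Sum>f\<in>lowdeg j. chr f * real CARD('a) ^ (2 * ?R - j))"
  proof -
    have "lowdeg j \<subseteq> (lowdeg (?R + ?R) :: 'a poly set)" using assms lowdeg_mono[of j "?R + ?R"] by auto
    then show ?thesis by (intro sum.mono_neutral_cong_right) auto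
  qed
  also have "\<dots> = real CARD('a) ^ (2 * ?R - j) * partial_sum j"
    by (simp only: partial_sum_def sum_distrib_right[symmetric] mult.commute)
  finally show ?thesis .
qed

lemma partial_sum_0: "partial_sum 0 = 0"
  by (simp add: partial_sum_def fin_char_0 degree_Q)

lemma partial_sum_eq_0:
  assumes "2 * degree Q \<le> j"
  shows "partial_sum j = 0"
proof -
  let ?R = "degree Q"
  obtain m where m: "j = degree (Q\<^sup>2) + m" using assms degree_Q_square by (metis le_Suc_ex mult_2)
  have Q2: "Q\<^sup>2 \<noteq> 0" using Q_nonzero by simp
  have "partial_sum j = (\<Sum>(r, z)\<in>lowdeg (degree (Q\<^sup>2)) \<times> lowdeg m. chr (r + Q\<^sup>2 * z))"
    unfolding partial_sum_def m
    using sum.reindex_bij_betw[OF bij_betw_lowdeg_division[OF Q2], of chr m]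
    by (simp add: case_prod_unfold)
  also have "\<dots> = (\<Sum>r\<in>lowdeg (degree (Q\<^sup>2)). \<Sum>z\<in>lowdeg m. chr (r + Q\<^sup>2 * z))"
    by (simp add: sum.cartesian_product)
  also have "\<dots> = (\<Sum>r\<in>lowdeg (degree (Q\<^sup>2)). \<Sum>z\<in>(lowdeg m :: 'a poly set). chr r)"
  proof (intro sum.cong refl fin_char_cong)
    fix r z :: "'a poly"
    have "(r + Q\<^sup>2 * z) + r = Q\<^sup>2 * z" by (simp add: add.commute)
    then show "Q\<^sup>2 dvd (r + Q\<^sup>2 * z) + r" by simp
  qed
  also have "\<dots> = real (card (lowdeg m :: 'a poly set)) * partial_sum (2 * ?R)"
    by (simp add: partial_sum_def degree_Q_square mult_2 sum_distrib_left)
  \<comment> \<open>The dual of this complete sum is \<open>partial_sum 0\<close>, the single value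
    of the character at zero.\<close>
  also have "partial_sum (2 * ?R) = 0"
    using functional_equation_aux[of "2 * ?R"] by (simp add: partial_sum_0)
  finally show ?thesis by simp
qed

end

section \<open>The functional equation at the place at infinity\<close>

text \<open>This is \<open>T ^ n * f (1 / T)\<close>, the reversal with respect to a formal degree
  \<open>n\<close>; unlike \<open>reflect_poly\<close> it is additive, and involutive even if the
  constant term vanishes.\<close>

definition hrev :: "nat \<Rightarrow> 'a::comm_semiring_1 poly \<Rightarrow> 'a poly" where
  "hrev n f = monom 1 (n - degree f) * reflect_poly f"

lemma coeff_hrev:
  "degree f \<le> n \<Longrightarrow> coeff (hrev n f) i = (if i \<le> n then coeff f (n - i) else 0)"
  by (auto simp: hrev_def coeff_monom_mult coeff_reflect_poly coeff_eq_0)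

lemma degree_hrev_le: "degree f \<le> n \<Longrightarrow> degree (hrev n f) \<le> n"
  by (rule degree_le) (simp add: coeff_hrev)

lemma hrev_hrev: "degree f \<le> n \<Longrightarrow> hrev n (hrev n f) = f"
  by (rule poly_eqI) (auto simp: coeff_hrev degree_hrev_le coeff_eq_0)

lemma hrev_add: "degree f \<le> n \<Longrightarrow> degree g \<le> n \<Longrightarrow> hrev n (f + g) = hrev n f + hrev n g"
  by (rule poly_eqI) (simp add: coeff_hrev degree_add_le)

lemma hrev_mult:
  fixes f g :: "'a::idom poly"
  assumes "degree f \<le> m" "degree g \<le> n"
  shows "hrev (m + n) (f * g) = hrev m f * hrev n g"
proof (cases "f = 0 \<or> g = 0")
  case False
  then have "m + n - degree (f * g) = (m - degree f) + (n - degree g)"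
    using assms by (simp add: degree_mult_eq)
  then have "monom (1::'a) (m + n - degree (f * g)) = monom 1 (m - degree f) * monom 1 (n - degree g)"
    by (simp add: mult_monom)
  then show ?thesis by (simp add: hrev_def reflect_poly_mult mult_ac)
qed (auto simp: hrev_def)

lemma hrev_degree [simp]: "hrev (degree f) f = reflect_poly f"
  by (simp add: hrev_def)

lemma hrev_1: "hrev n 1 = (monom 1 n :: 'a::comm_semiring_1 poly)"
  by (simp add: hrev_def)

lemma hrev_add_degree:
  fixes f :: "'a::idom poly"
  assumes "degree f \<le> n"
  shows "hrev (m + n) f = monom 1 m * hrev n f"
  using hrev_mult[of 1 m f n] assms by (simp add: hrev_1)

lemma reflect_dvd_hrev: "g dvd f \<Longrightarrow> reflect_poly (g::'a::idom poly) dvd hrev n f"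
  by (auto simp: hrev_def reflect_poly_mult elim!: dvdE)

text \<open>A nonzero constant term makes reversal an involution that preserves degrees, so
  factorisations of \<open>P\<close> and of its reversal correspond.\<close>

lemma irreducible_reflect_poly:
  fixes P :: "'a::field poly"
  assumes "irreducible P" "coeff P 0 \<noteq> 0"
  shows "irreducible (reflect_poly P)"
proof (rule irreducibleI)
  show "reflect_poly P \<noteq> 0" using assms by auto
  have "degree P > 0" using assms by (metis gr0I irreducible_def is_unit_iff_degree)
  then show "\<not> is_unit (reflect_poly P)" using assms \<open>reflect_poly P \<noteq> 0\<close> by (simp add: is_unit_iff_degree)
  fix a b assume ab: "reflect_poly P = a * b"
  have P: "P = reflect_poly a * reflect_poly b"
    using arg_cong[OF ab, of reflect_poly] assms by (simp add: reflect_poly_mult)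
  have "coeff (a * b) 0 \<noteq> 0" using assms by (simp flip: ab) auto
  then have 0: "coeff a 0 \<noteq> 0" "coeff b 0 \<noteq> 0" by (auto simp: coeff_mult_0)
  then have "a \<noteq> 0" "b \<noteq> 0" by auto
  moreover have "is_unit (reflect_poly a) \<or> is_unit (reflect_poly b)"
    using P assms(1) by (metis irreducibleD)
  ultimately show "is_unit a \<or> is_unit b" using 0 by (simp add: is_unit_iff_degree)
qed

lemma X_dvd_iff: "[:0, 1:] dvd (f::'a::comm_ring_1 poly) \<longleftrightarrow> coeff f 0 = 0"
proof
  assume "coeff f 0 = 0"
  then show "[:0, 1:] dvd f" by (cases f) (auto simp: dvd_def intro: exI[of _ "_::'a poly"])
qed (auto elim!: dvdE simp: coeff_mult_0)

lemma irreducible_X: "irreducible ([:0, 1:] :: 'a::field poly)"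
  by (rule irreducible_linear_field_poly) simp

lemma irreducible_dvd_X:
  fixes P :: "'a::field poly"
  assumes "monic_irreducible P" "coeff P 0 = 0"
  shows "P = [:0, 1:]"
proof -
  have "[:0, 1:] = P"
    by (rule monic_dvd_monic_irreducible) (use assms irreducible_X X_dvd_iff[of P] in auto)
  then show ?thesis by (rule sym)
qed

lemma comaximal_X_iff: "comaximal [:0, 1:] (f::'a::field poly) \<longleftrightarrow> coeff f 0 \<noteq> 0"
  by (simp add: comaximal_irreducible_iff[OF irreducible_X] X_dvd_iff)

lemma card_field_gt_1: "1 < CARD('a::finite_field)"
proof -
  have "card {0, 1::'a} \<le> CARD('a)" by (rule card_mono) auto
  then show ?thesis by simp
qed

lemma sum_lowdeg_Suc:
  fixes \<phi> :: "'a::finite_field poly \<Rightarrow> real"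
  assumes "\<And>c f. c \<noteq> 0 \<Longrightarrow> f \<noteq> 0 \<Longrightarrow> \<phi> (smult c f) = \<phi> f"
  shows "(\<Sum>f | f \<noteq> 0 \<and> degree f = n. \<phi> f) = (real CARD('a) - 1) * (\<Sum>f\<in>monics n. \<phi> f)"
proof -
  have "(\<Sum>f | f \<noteq> 0 \<and> degree f = n. \<phi> f) = (\<Sum>(c, f)\<in>(UNIV - {0}) \<times> monics n. \<phi> (smult c f))"
    by (rule sum.reindex_bij_witness[where j = "\<lambda>f. (lead_coeff f, smult (inverse (lead_coeff f)) f)"
          and i = "\<lambda>(c, f). smult c f"])
      (auto simp: monics_def)
  also have "\<dots> = (\<Sum>(c, f)\<in>(UNIV - {0::'a}) \<times> monics n. \<phi> f)"
    by (rule sum.cong[OF refl]) (auto simp: monics_def intro!: assms)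
  also have "\<dots> = (\<Sum>c\<in>UNIV - {0::'a}. \<Sum>f\<in>monics n. \<phi> f)"
    by (rule sum.cartesian_product[symmetric])
  also have "\<dots> = real (card (UNIV - {0::'a})) * (\<Sum>f\<in>monics n. \<phi> f)" by simp
  also have "card (UNIV - {0::'a}) = CARD('a) - 1" by (simp add: card_Diff_singleton)
  finally show ?thesis by (simp add: of_nat_diff Suc_leI)
qed

lemma lowdeg_Suc_split: "lowdeg (Suc n) = lowdeg n \<union> {f. f \<noteq> 0 \<and> degree f = n}"
  by (auto simp: lowdeg_iff)

lemma finite_degree_eq: "finite {f::'a::{zero,finite} poly. f \<noteq> 0 \<and> degree f = n}"
  by (rule finite_subset[OF _ finite_lowdeg[of "Suc n"]]) (auto simp: lowdeg_iff)

section \<open>Dirichlet coefficients and reciprocity\<close>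

context even_const_field
begin

lemma psi_of_nat_mult: "psi (of_nat n * x) = psi x ^ n"
  by (induction n) (simp_all add: distrib_right psi_add)

text \<open>At infinity the logarithmic derivative behaves like \<open>degree f / T\<close>. This
  makes the twist by \<xi> the sign of the parity of the degree.\<close>

lemma inf_res_pderiv_self: "inf_res (pderiv f) f = of_nat (degree (f::'a poly))"
proof (cases "degree f = 0")
  case True
  then show ?thesis by (metis degree_eq_zeroE inf_res_0 of_nat_0 pderiv_pCons pderiv_0 add_0 pCons_0_0)
next
  case False
  then have "degree (pderiv f) < degree f" using degree_pderiv_le[of f] by linarith
  then show ?thesis using False by (subst inf_res_eq_coeff) (auto simp: coeff_pderiv)
qed

definition dcoeff :: "'a poly \<Rightarrow> 'a poly \<Rightarrow> nat \<Rightarrow> real" where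
  "dcoeff C D n = (\<Sum>f\<in>monics n. symb C D f)"

text \<open>Stated for an abstract sequence because it is satisfied by the coefficients themselves
  when infinity ramifies, but by their partial sums when infinity splits, where the trivial zero has
  to be divided out.\<close>

definition functional_eq :: "nat \<Rightarrow> (nat \<Rightarrow> real) \<Rightarrow> bool" where
  "functional_eq g S \<longleftrightarrow> (\<forall>n>2 * g. S n = 0) \<and>
    (\<forall>n\<le>2 * g. real CARD('a) ^ g * S (2 * g - n) = real CARD('a) ^ (2 * g - n) * S n)"

lemma comaximal_add_mult: "comaximal D C \<Longrightarrow> comaximal D (C + F * (D::'a poly))"
  using comaximal_add_mult_iff[of C D F] comaximal_sym[of D C] comaximal_sym[of "C + D * F" D]
  by (simp add: mult.commute)

lemma symb_add_poly:
  assumes "comaximal D C"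
  shows "symb (C + F * D) D f = symb C D f * psi (inf_res (F * pderiv f) f)"
proof (cases "comaximal D f")
  case True
  note cm = comaximal_add_mult[OF assms, of F]
  obtain h where h: "f dvd h * D + C" using True assms ex_representative_iff by blast
  have "(h + F) * D + (C + F * D) = h * D + C + (F * D + F * D)" by (simp only: distrib_right add_ac)
  also have "\<dots> = h * D + C" by (simp only: poly_add_self add_0_right)
  finally have e: "(h + F) * D + (C + F * D) = h * D + C" .
  have h': "f dvd (h + F) * D + (C + F * D)" unfolding e by (rule h)
  show ?thesis by (simp add: symb_eq[OF assms h] symb_eq[OF cm h'] distrib_right inf_res_add psi_add)
next
  case False
  note cm = comaximal_add_mult[OF assms, of F]
  then show ?thesis using False symb_eq_0[OF cm] symb_eq_0[OF assms] by simp
qed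

text \<open>Reciprocity as a sum of residues: the part of \<open>C * pderiv f / (D * f)\<close> with
  poles at \<open>f\<close> gives the symbol, the part with poles at \<open>D\<close> gives the
  character modulo \<open>Q\<^sup>2\<close>, and together they make up the residue at infinity.
  \<open>E\<close> enlarges \<open>D\<close> to a square; the last hypothesis says that this brings
  in no primes that matter.\<close>

lemma symb_eq_fin_char:
  assumes "comaximal D C" "Q\<^sup>2 = D * E" "B = C * E" "Q \<noteq> 0" "f \<noteq> 0"
    and "comaximal f D \<Longrightarrow> comaximal f Q"
  shows "symb C D f = psi (inf_res (C * pderiv f) (D * f)) * fin_char B Q f"
proof (cases "comaximal f D")
  case True
  then obtain h where h: "f dvd h * D + C" using assms(1) ex_representative_iff comaximal_sym by blast
  then obtain k where k: "h * D + C = f * k" by (auto elim: dvdE)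
  obtain x where x: "Q\<^sup>2 dvd f * x + 1" using inverse_mod_square assms(6) True by blast
  have D0: "D \<noteq> 0" "E \<noteq> 0" using assms(2,4) by (metis mult_zero_left mult_zero_right power_eq_0_iff zero_neq_numeral)+
  have "h * D = C + f * k" using k by (metis add.commute poly_add_self_left)
  then have "h * pderiv f * D = C * pderiv f + (k * pderiv f) * f"
    by (metis (no_types, opaque_lifting) distrib_right mult.assoc mult.commute)
  then have "inf_res (h * pderiv f) f = inf_res (C * pderiv f + (k * pderiv f) * f) (f * D)"
    using inf_res_mult_cancel[OF D0(1), of "h * pderiv f" f] by simp
  also have "\<dots> = inf_res (C * pderiv f) (D * f) + inf_res (k * pderiv f) D"
    using inf_res_mult_cancel[OF assms(5), of "k * pderiv f" D] by (simp add: inf_res_add mult.commute)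
  also have "inf_res (k * pderiv f) D = inf_res (k * pderiv f * E) (Q\<^sup>2)"
    using inf_res_mult_cancel[OF D0(2), of "k * pderiv f" D] assms(2) by simp
  also have "\<dots> = inf_res (B * pderiv f * x) (Q\<^sup>2)"
  proof -
    \<comment> \<open>Both \<open>e1\<close> and \<open>e2\<close> are multiples of
      \<open>Q\<^sup>2\<close>: they account for replacing \<open>f * x\<close> by \<open>1\<close>
      and for the summand \<open>h * D\<close> in \<open>f * k = h * D + C\<close>.\<close>
    define e1 where "e1 = k * E * pderiv f * (f * x + 1)"
    define e2 where "e2 = Q\<^sup>2 * (h * x * pderiv f)"
    have "inf_res e1 (Q\<^sup>2) = 0" "inf_res e2 (Q\<^sup>2) = 0"
      using x by (auto simp: e1_def e2_def intro!: inf_res_dvd)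
    moreover have "k * pderiv f * E + e1 = (f * k) * E * x * pderiv f"
      by (simp add: e1_def algebra_simps)
    then have "k * pderiv f * E + e1 = B * pderiv f * x + e2"
      unfolding k[symmetric] by (simp add: e2_def assms(2,3) algebra_simps)
    ultimately show ?thesis by (metis inf_res_add add_0_right)
  qed
  finally show ?thesis by (simp add: symb_eq[OF assms(1) h] fin_char_eq[OF x] psi_add)
next
  case False
  then have "\<not> comaximal f (Q\<^sup>2)" using assms(2) by (auto simp: comaximal_mult_iff)
  then show ?thesis using False assms(1) comaximal_sym
    by (metis symb_eq_0 fin_char_eq_0 comaximal_square_iff mult_zero_right)
qed

lemma irreducible_degree_pos: "irreducible (P::'a poly) \<Longrightarrow> degree P > 0"
  by (metis gr0I irreducible_def is_unit_iff_degree)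

text \<open>The fraction \<open>a / P\<close> is written over the square as
  \<open>a * P / P\<^sup>2\<close>; modulo \<open>P\<close> the derivative of the numerator is
  \<open>a * pderiv P\<close>.\<close>

lemma gauss_char_prime:
  assumes "irreducible P" "\<not> P dvd a"
  shows "gauss_char \<xi> (a * P) P"
proof
  show "degree P > 0" using assms irreducible_degree_pos by blast
  have "pderiv (a * P) = a * pderiv P + P * pderiv a" by (simp add: pderiv_mult)
  moreover have "\<not> P dvd a * pderiv P"
    using assms irreducible_dvd_mult_poly irreducible_not_dvd_pderiv by blast
  ultimately have "comaximal P (pderiv (a * P))"
    using assms by (simp add: comaximal_irreducible_iff dvd_add_left_iff)
  then show "comaximal (pderiv (a * P)) P" by (rule comaximal_sym)
qed simp

lemma not_dvd_of_degree_less: "a \<noteq> 0 \<Longrightarrow> degree a < degree P \<Longrightarrow> \<not> P dvd (a::'a poly)"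
  by (meson dvd_imp_degree_le not_le)

text \<open>For a proper fraction the term at infinity in \<open>symb_eq_fin_char\<close> vanishes:
  differentiation lowers the degree of \<open>f\<close> and \<open>a\<close> lies below
  \<open>P\<close>, so the numerator is at least two degrees below the denominator.\<close>

lemma symb_proper:
  assumes "irreducible P" "a \<noteq> 0" "degree a < degree P" "f \<noteq> 0"
  shows "symb a P f = fin_char (a * P) P f"
proof -
  have "\<not> P dvd a" using assms not_dvd_of_degree_less by blast
  then have cm: "comaximal P a" using assms by (simp add: comaximal_irreducible_iff)
  have P0: "P \<noteq> 0" using assms by auto
  have "inf_res (a * pderiv f) (P * f) = 0"
  proof (cases "pderiv f = 0")
    case False
    then have "degree f > 0" by (metis degree_eq_zeroE gr0I pderiv_pCons pderiv_0 add_0 pCons_0_0)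
    then have "degree (pderiv f) + 1 \<le> degree f" using degree_pderiv_le[of f] by linarith
    then show ?thesis using assms P0 False by (intro inf_res_eq_0) (simp add: degree_mult_eq)
  qed simp
  then show ?thesis
    using symb_eq_fin_char[OF cm _ refl P0 assms(4), of P] by (simp add: power2_eq_square)
qed

text \<open>Nonzero polynomials are constants times monic ones, so the additive sums are
  \<open>CARD('a) - 1\<close> times partial sums of Dirichlet coefficients. The modulus has degree
  \<open>2 * g + 2\<close>; passing from degree below \<open>n + 1\<close> to degree at most
  \<open>n\<close>, on both sides, turns this into the symmetry about \<open>g\<close>.\<close>

lemma dcoeff_proper_functional_eq:
  assumes "irreducible P" "a \<noteq> 0" "degree a < degree P" "degree P = Suc g"
  shows "functional_eq g (\<lambda>n. \<Sum>i\<le>n. dcoeff a P i)"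
proof -
  interpret gauss_char \<xi> "a * P" P
    using assms not_dvd_of_degree_less by (intro gauss_char_prime) auto
  have M: "partial_sum (Suc n) = (real CARD('a) - 1) * (\<Sum>i\<le>n. dcoeff a P i)" for n
  proof -
    have step: "partial_sum (Suc n) = partial_sum n + (real CARD('a) - 1) * dcoeff a P n" for n
    proof -
      have "partial_sum (Suc n) = partial_sum n + (\<Sum>f | f \<noteq> 0 \<and> degree f = n. chr f)"
        unfolding partial_sum_def lowdeg_Suc_split
        by (intro sum.union_disjoint finite_lowdeg finite_degree_eq) (auto simp: lowdeg_iff)
      also have "(\<Sum>f | f \<noteq> 0 \<and> degree f = n. chr f) = (real CARD('a) - 1) * (\<Sum>f\<in>monics n. chr f)"
        by (rule sum_lowdeg_Suc) (rule fin_char_smult)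
      also have "(\<Sum>f\<in>monics n. chr f) = dcoeff a P n"
        unfolding dcoeff_def using assms by (intro sum.cong refl symb_proper[symmetric]) (auto simp: monics_def)
      finally show ?thesis .
    qed
    show ?thesis by (induction n) (simp_all add: step[of 0] step[of "Suc _"] partial_sum_0 distrib_left)
  qed
  have q1: "real CARD('a) - 1 \<noteq> 0" using card_field_gt_1[where 'a = 'a] by simp
  show ?thesis unfolding functional_eq_def
  proof (intro conjI allI impI)
    fix n assume "2 * g < n"
    then have "partial_sum (Suc n) = 0" using assms by (intro partial_sum_eq_0) simp
    then show "(\<Sum>i\<le>n. dcoeff a P i) = 0" using M[of n] q1 by simp
  next
    fix n assume n: "n \<le> 2 * g"
    have "real CARD('a) ^ Suc g * partial_sum (Suc (2 * g - n)) = real CARD('a) ^ Suc (2 * g - n) * partial_sum (Suc n)"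
      using functional_equation_aux[of "Suc n"] n assms(4) by (simp add: Suc_diff_le)
    then show "real CARD('a) ^ g * (\<Sum>i\<le>2 * g - n. dcoeff a P i) = real CARD('a) ^ (2 * g - n) * (\<Sum>i\<le>n. dcoeff a P i)"
      unfolding M using q1 by simp
  qed
qed

text \<open>Substituting \<open>1 / T\<close> into a solution gives a fraction with a power of
  \<open>T\<close> as denominator; modulo the reversed prime, whose constant term is nonzero,
  \<open>T\<close> is invertible and the fraction can be replaced by a polynomial.\<close>

lemma ex_root_hrev:
  fixes C D R :: "'a poly"
  assumes R: "coeff R 0 \<noteq> 0" "irreducible R" and deg: "degree C \<le> K" "degree D \<le> K"
    and X: "R dvd (X\<^sup>2 + X) * D + C"
  shows "\<exists>Y. reflect_poly R dvd (Y\<^sup>2 + Y) * hrev K D + hrev K C"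
proof -
  let ?k = "degree X" and ?d = "degree R" and ?R = "reflect_poly R"
  define x where "x = hrev ?k X"
  define G where "G = (X\<^sup>2 + X) * D + C"
  define M where "M = monom (1::'a) ?k"
  have dX: "degree (X\<^sup>2 + X) \<le> 2 * ?k"
    by (intro degree_add_le) (simp_all add: degree_power_le mult.commute[of 2])
  have dG: "degree ((X\<^sup>2 + X) * D) \<le> 2 * ?k + K"
    using dX deg by (intro order.trans[OF degree_mult_le] add_mono)
  have MM: "monom (1::'a) (2 * ?k) = M\<^sup>2" by (simp add: M_def power2_eq_square mult_monom mult_2)
  have h1: "hrev (2 * ?k) (X\<^sup>2 + X) = x\<^sup>2 + M * x"
  proof -
    have "hrev (2 * ?k) (X\<^sup>2) = x\<^sup>2"
      using hrev_mult[of X ?k X ?k] by (simp add: x_def power2_eq_square mult_2)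
    moreover have "hrev (2 * ?k) X = M * x"
      using hrev_add_degree[of X ?k ?k] by (simp add: x_def M_def mult_2)
    ultimately show ?thesis
      by (subst hrev_add) (simp_all add: degree_power_le mult.commute[of 2])
  qed
  have "hrev (2 * ?k + K) G = hrev (2 * ?k + K) ((X\<^sup>2 + X) * D) + hrev (2 * ?k + K) C"
    unfolding G_def using dG deg by (intro hrev_add) auto
  also have "\<dots> = (x\<^sup>2 + M * x) * hrev K D + M\<^sup>2 * hrev K C"
    using hrev_mult[OF dX deg(2)] hrev_add_degree[OF deg(1), of "2 * ?k"] by (simp add: h1 MM)
  finally have "?R dvd (x\<^sup>2 + M * x) * hrev K D + M\<^sup>2 * hrev K C"
    using reflect_dvd_hrev[OF X] unfolding G_def by metis
  moreover have "comaximal [:0, 1:] ?R" using R by (auto simp: comaximal_X_iff)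
  then have cM: "comaximal ?R M" unfolding M_def monom_altdef using comaximal_sym comaximal_power
    by (simp add: comaximal_power comaximal_sym)
  then obtain t where t: "?R dvd M * t + 1" using comaximal_iff_inverse comaximal_sym by blast
  \<comment> \<open>The transformed solution is \<open>x / M\<close>, and \<open>t\<close> stands
    for the inverse of \<open>M\<close>; the correction is a multiple of
    \<open>M * t + 1\<close>.\<close>
  have "M\<^sup>2 * (((t * x)\<^sup>2 + t * x) * hrev K D + hrev K C)
    = ((x\<^sup>2 + M * x) * hrev K D + M\<^sup>2 * hrev K C) + (M * t + 1) * (((M * t + 1) * x\<^sup>2 + M * x) * hrev K D)"
    by (simp add: algebra_simps power2_eq_square)
  ultimately have "?R dvd M\<^sup>2 * (((t * x)\<^sup>2 + t * x) * hrev K D + hrev K C)"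
    using t by (metis dvd_add dvd_mult2)
  then show ?thesis using comaximal_dvd_mult[OF comaximal_power[OF cM]] by blast
qed

lemma ex_root_hrev_iff:
  fixes C D R :: "'a poly"
  assumes R: "coeff R 0 \<noteq> 0" "irreducible R" and deg: "degree C \<le> K" "degree D \<le> K"
  shows "(\<exists>Y. reflect_poly R dvd (Y\<^sup>2 + Y) * hrev K D + hrev K C)
    \<longleftrightarrow> (\<exists>X. R dvd (X\<^sup>2 + X) * D + C)"
proof
  assume "\<exists>Y. reflect_poly R dvd (Y\<^sup>2 + Y) * hrev K D + hrev K C"
  then obtain Y where "reflect_poly R dvd (Y\<^sup>2 + Y) * hrev K D + hrev K C" by blast
  moreover have "coeff (reflect_poly R) 0 \<noteq> 0" using R by auto
  ultimately have "\<exists>X. reflect_poly (reflect_poly R) dvd (X\<^sup>2 + X) * hrev K (hrev K D) + hrev K (hrev K C)"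
    using irreducible_reflect_poly[OF R(2,1)] deg by (intro ex_root_hrev) (auto simp: degree_hrev_le)
  then show "\<exists>X. R dvd (X\<^sup>2 + X) * D + C" using R deg by (simp add: hrev_hrev)
qed (use ex_root_hrev assms in blast)

end

text \<open>Here \<open>b / P\<close> has a pole of odd order \<open>2 * s - 1\<close> at infinity.
  Inverting \<open>T\<close> carries it to a pole of \<open>br / D\<close> at \<open>0\<close>, and
  multiplying \<open>D\<close> by \<open>Pr * X\<close> completes the denominator to the square of
  \<open>Q = Pr * X ^ s\<close>. \<open>P0\<close> keeps the degree of \<open>P\<close> under
  reversal and leaves the point \<open>0\<close> free to receive infinity. The constant
  \<open>v\<close> is the value of \<open>b / P\<close> at \<open>0\<close>, hence of the inverted
  fraction at infinity.\<close>

locale ramified_infinity = even_const_field \<xi> for \<xi> :: "'a::finite_field" +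
  fixes b P :: "'a poly" and r s :: nat
  assumes P: "lead_coeff P = 1" "irreducible P" "degree P = r" and b: "\<not> P dvd b" "degree b + 1 = r + 2 * s"
    and s: "s \<ge> 1" and P0: "coeff P 0 \<noteq> 0"
begin

definition "K = degree b"
definition "Pr = reflect_poly P"
definition "br = reflect_poly b"
definition "X = ([:0, 1:] :: 'a poly)"
definition "D = hrev K P"
definition "Q = Pr * X ^ s"
definition "B = br * (Pr * X)"
definition "v = coeff b 0 / coeff P 0"

lemma K: "K + 1 = r + 2 * s" using b by (simp add: K_def)

lemma nz: "P \<noteq> 0" "b \<noteq> 0" "Pr \<noteq> 0" "br \<noteq> 0" "X \<noteq> 0" "Q \<noteq> 0"
  using P b by (auto simp: Pr_def br_def X_def Q_def)

lemma degree_Pr: "degree Pr = r" using P P0 by (simp add: Pr_def)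

lemma irreducible_Pr: "irreducible Pr"
  unfolding Pr_def using P P0 by (intro irreducible_reflect_poly)

lemma D_eq: "D = Pr * X ^ (2 * s - 1)"
proof -
  have "K - r = 2 * s - 1" using K s by linarith
  then show ?thesis by (simp add: D_def hrev_def P Pr_def X_def monom_altdef mult.commute)
qed

lemma Q_square: "Q\<^sup>2 = D * (Pr * X)"
proof -
  have "X ^ (2 * s - 1) * X = X ^ (2 * s)" using s by (metis power_minus_mult mult_pos_pos less_le_trans zero_less_one zero_less_numeral)
  then have "D * (Pr * X) = Pr\<^sup>2 * X ^ (2 * s)"
    by (simp add: D_eq power2_eq_square mult_ac)
  then show ?thesis by (simp add: Q_def power_mult_distrib power_mult[symmetric] mult.commute)
qed

lemma comaximal_Pr_X: "comaximal X Pr"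
  using nz by (simp add: comaximal_X_iff X_def Pr_def)

lemma comaximal_X_br: "comaximal X br"
  using nz by (simp add: comaximal_X_iff X_def br_def)

lemma br_eq: "br = hrev K b"
  by (simp add: br_def K_def)

lemma comaximal_Pr_br: "comaximal Pr br"
proof -
  have "\<not> Pr dvd br"
  proof
    assume "Pr dvd br"
    then have "reflect_poly Pr dvd hrev K br" by (rule reflect_dvd_hrev)
    moreover have "hrev K br = b" unfolding br_eq by (rule hrev_hrev) (simp add: K_def)
    ultimately show False using b P0 by (simp add: Pr_def)
  qed
  then show ?thesis using irreducible_Pr by (simp add: comaximal_irreducible_iff)
qed

lemma comaximal_P_b: "comaximal P b"
  using P b by (simp add: comaximal_irreducible_iff)

lemma comaximal_D_br: "comaximal D br"
  unfolding D_eq using comaximal_Pr_br comaximal_X_br comaximal_sym comaximal_power comaximal_mult by metis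

lemma comaximal_D_imp_Q: "comaximal f D \<Longrightarrow> comaximal f Q"
proof -
  assume "comaximal f D"
  then have "comaximal f Pr" "comaximal f (X ^ (2 * s - 1))" by (auto simp: D_eq comaximal_mult_iff)
  moreover have "X dvd X ^ (2 * s - 1)" using s by (simp add: dvd_power)
  ultimately show ?thesis unfolding Q_def using comaximal_dvd comaximal_power comaximal_mult by blast
qed

lemma gauss: "gauss_char \<xi> B Q"
proof
  show "degree Q > 0" using s nz by (simp add: Q_def degree_mult_eq degree_power_eq X_def)
  have Bp: "pderiv B = br * X * pderiv Pr + Pr * pderiv (br * X)"
    by (simp add: B_def pderiv_mult algebra_simps)
  have "\<not> Pr dvd br * X * pderiv Pr"
    using irreducible_dvd_mult_poly[OF irreducible_Pr] irreducible_not_dvd_pderiv[OF irreducible_Pr]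
      comaximal_Pr_br comaximal_sym[OF comaximal_Pr_X] comaximal_irreducible_iff[OF irreducible_Pr] by metis
  then have "comaximal Pr (pderiv B)"
    unfolding Bp comaximal_irreducible_iff[OF irreducible_Pr] by (simp add: dvd_add_left_iff)
  moreover have "comaximal X (pderiv B)"
  proof -
    have "pderiv B = br * Pr + X * pderiv (br * Pr)"
      by (simp add: B_def pderiv_mult X_def pderiv_pCons algebra_simps one_pCons[symmetric])
    then have "coeff (pderiv B) 0 = coeff br 0 * coeff Pr 0"
      by (simp add: coeff_mult_0 X_def)
    then show ?thesis using nz by (simp add: X_def comaximal_X_iff br_def Pr_def)
  qed
  ultimately show "comaximal (pderiv B) Q"
    unfolding Q_def using comaximal_sym comaximal_power comaximal_mult by metis
  \<comment> \<open>Differentiating \<open>X ^ s\<close> may lose one factor \<open>X\<close>; the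
    one contained in \<open>B\<close> restores it.\<close>
  have "X ^ s dvd X * pderiv (X ^ s)"
  proof -
    obtain t where t: "s = Suc t" using s by (cases s) auto
    have "X * pderiv (X ^ s) = X ^ s * smult (of_nat s) (pderiv X)"
      unfolding t pderiv_power_Suc by (simp add: mult_ac)
    then show ?thesis by (simp add: dvd_smult)
  qed
  then have "Pr * X ^ s dvd Pr * (X * pderiv (X ^ s))" by (rule mult_dvd_mono[OF dvd_refl])
  then have "Pr * X ^ s dvd Pr * (X * pderiv (X ^ s)) * (br * Pr)" by (rule dvd_mult2)
  moreover have "B * pderiv Q = Pr * X ^ s * (br * X * pderiv Pr) + Pr * (X * pderiv (X ^ s)) * (br * Pr)"
    by (simp add: B_def Q_def pderiv_mult algebra_simps)
  ultimately show "Q dvd B * pderiv Q" unfolding Q_def by simp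
qed

sublocale gauss_char \<xi> B Q by (rule gauss)

lemma degree_Q': "degree Q = r + s"
  using nz by (simp add: Q_def degree_mult_eq degree_power_eq degree_Pr X_def)

text \<open>Now the term at infinity survives: the fraction has the value \<open>v\<close> there,
  and the logarithmic derivative contributes the degree of \<open>f\<close>.\<close>

lemma symb_reversed:
  assumes "f \<noteq> 0"
  shows "symb br D f = psi v ^ degree f * fin_char B Q f"
proof -
  have D0: "D \<noteq> 0" using nz by (simp add: D_eq)
  have degP: "degree P \<le> K" using K P s by linarith
  have degD: "degree D = K" using nz K s by (simp add: D_eq degree_mult_eq degree_power_eq degree_Pr X_def)
  have lD: "lead_coeff D = coeff P 0" using degD degP by (simp add: D_def coeff_hrev)
  have dbr: "degree br \<le> K" unfolding br_def K_def by (rule degree_reflect_poly_le)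
  have cbr: "coeff br K = coeff b 0" by (simp add: br_def K_def coeff_reflect_poly)
  have "inf_res (br * pderiv f) (D * f) = of_nat (degree f) * v"
  proof (cases "degree f = 0")
    case True
    then have "pderiv f = 0" by (metis degree_eq_zeroE pderiv_pCons pderiv_0 add_0 pCons_0_0)
    then show ?thesis using True by simp
  next
    case False
    let ?n = "degree f"
    have dDf: "degree (D * f) = K + ?n" using D0 assms by (simp add: degree_mult_eq degD)
    have "degree (br * pderiv f) \<le> K + (?n - 1)"
      using dbr degree_pderiv_le[of f] by (intro order.trans[OF degree_mult_le] add_mono)
    then have "inf_res (br * pderiv f) (D * f) = coeff (br * pderiv f) (K + (?n - 1)) / (lead_coeff D * lead_coeff f)"
      using False by (subst inf_res_eq_coeff) (simp_all add: dDf lead_coeff_mult[of D f, unfolded dDf])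
    also have "coeff (br * pderiv f) (K + (?n - 1)) = coeff b 0 * (of_nat ?n * lead_coeff f)"
      using coeff_mult_top[OF dbr degree_pderiv_le[of f]] False by (simp add: cbr coeff_pderiv)
    finally show ?thesis using assms by (simp add: lD v_def)
  qed
  then show ?thesis
    using symb_eq_fin_char[OF comaximal_D_br Q_square _ nz(6) assms, of B] comaximal_D_imp_Q[of f]
    by (simp add: B_def psi_of_nat_mult)
qed

text \<open>For \<open>R\<close> other than \<open>T\<close> both symbols decide Artin-Schreier
  equations that inversion carries into each other. For \<open>R = T\<close> the fraction has the
  value \<open>v\<close> modulo \<open>T\<close>, while the reversal is a constant, on which the
  character is trivial; so the factor \<open>psi v\<close> is right in this case too.\<close>

lemma symb_reflect_prime:
  assumes R: "monic_irreducible R"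
  shows "symb b P R = psi v ^ degree R * fin_char B Q (reflect_poly R)"
proof (cases "coeff R 0 = 0")
  case True
  then have RX: "R = [:0, 1:]" using R irreducible_dvd_X by blast
  have "coeff ([:v:] * P + b) 0 = 0" using P0 by (simp add: v_def coeff_mult_0)
  then have "R dvd [:v:] * P + b" by (simp only: RX X_dvd_iff)
  then have "symb b P R = psi (inf_res ([:v:] * pderiv R) R)" by (rule symb_eq[OF comaximal_P_b])
  also have "inf_res ([:v:] * pderiv R) R = v"
    by (subst inf_res_eq_coeff) (simp_all add: RX pderiv_pCons)
  finally show ?thesis by (simp add: RX reflect_poly_pCons' fin_char_const)
next
  case R0: False
  have degP: "degree P \<le> K" using K P s by linarith
  have Rr: "irreducible (reflect_poly R)" using R R0 by (intro irreducible_reflect_poly) auto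
  have Rr0: "reflect_poly R \<noteq> 0" using R by auto
  have D': "hrev K D = P" using degP by (simp add: D_def hrev_hrev)
  have dvd_iff: "reflect_poly R dvd D \<longleftrightarrow> R dvd P"
  proof
    assume "reflect_poly R dvd D"
    then have "reflect_poly (reflect_poly R) dvd hrev K D" by (rule reflect_dvd_hrev)
    then show "R dvd P" using R0 D' by simp
  qed (simp add: D_def reflect_dvd_hrev)
  show ?thesis
  proof (cases "comaximal P R")
    case True
    then have "\<not> R dvd P" using R comaximal_irreducible_iff comaximal_sym by blast
    then have c2: "comaximal D (reflect_poly R)"
      using Rr dvd_iff comaximal_irreducible_iff comaximal_sym by blast
    have "symb b P R = 1 \<longleftrightarrow> symb br D (reflect_poly R) = 1"
      unfolding symb_prime_eq_1_iff[OF comaximal_P_b conjunct2[OF R] True]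
        symb_prime_eq_1_iff[OF comaximal_D_br Rr c2]
      using ex_root_hrev_iff[OF R0 conjunct2[OF R], of b K P] degP by (simp add: br_eq D_def K_def)
    then have "symb b P R = symb br D (reflect_poly R)"
      using symb_cases[OF comaximal_P_b True] symb_cases[OF comaximal_D_br c2] by auto
    then show ?thesis using symb_reversed[OF Rr0] R0 by simp
  next
    case False
    then have "R dvd P" using R comaximal_irreducible_iff comaximal_sym by blast
    then have "reflect_poly R dvd D" using dvd_iff by blast
    then have "\<not> comaximal (reflect_poly R) D" using Rr by (simp add: comaximal_irreducible_iff)
    then have "\<not> comaximal (reflect_poly R) (Q\<^sup>2)" by (auto simp: Q_square comaximal_mult_iff)
    then show ?thesis using False by (simp add: symb_eq_0[OF comaximal_P_b] fin_char_eq_0 comaximal_square_iff)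
  qed
qed

lemma symb_reflect_monic:
  "lead_coeff f = 1 \<Longrightarrow> symb b P f = psi v ^ degree f * fin_char B Q (reflect_poly f)"
proof (induction f rule: monic_induct)
  case one
  then show ?case by (simp add: symb_1 comaximal_P_b)
next
  case (mult R f)
  have "R \<noteq> 0" "f \<noteq> 0" using mult by auto
  then show ?case using symb_reflect_prime[OF mult(1)] mult(3)
    by (simp add: symb_mult[OF comaximal_P_b] reflect_poly_mult fin_char_mult degree_mult_eq power_add)
qed

lemma symb_reflect:
  assumes "f \<noteq> 0"
  shows "symb b P f = psi v ^ degree f * fin_char B Q (reflect_poly f)"
proof -
  define c where "c = lead_coeff f"
  define g where "g = smult (inverse c) f"
  have c: "c \<noteq> 0" using assms by (simp add: c_def)
  then have f: "f = smult c g" and g: "lead_coeff g = 1" by (simp_all add: g_def c_def)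
  then have g0: "g \<noteq> 0" by auto
  show ?thesis using symb_reflect_monic[OF g] c g0
    by (simp add: f symb_smult[OF comaximal_P_b] reflect_poly_smult fin_char_smult)
qed

text \<open>Reversal sends degree exactly \<open>n\<close> to degree at most \<open>n\<close> with
  nonzero constant term, and polynomials without constant term contribute nothing since
  \<open>X\<close> divides \<open>Q\<close>. So a single Dirichlet coefficient, not a partial sum,
  corresponds to an additive sum here.\<close>

lemma partial_sum_eq_dcoeff:
  "psi v ^ n * partial_sum (Suc n) = (real CARD('a) - 1) * dcoeff b P n"
proof -
  have "(real CARD('a) - 1) * dcoeff b P n = (\<Sum>f | f \<noteq> 0 \<and> degree f = n. symb b P f)"
    unfolding dcoeff_def by (rule sum_lowdeg_Suc[symmetric]) (rule symb_smult[OF comaximal_P_b])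
  also have "\<dots> = (\<Sum>f | f \<noteq> 0 \<and> degree f = n. psi v ^ n * chr (hrev n f))"
    by (rule sum.cong) (auto simp: symb_reflect)
  also have "\<dots> = (\<Sum>g | g \<in> lowdeg (Suc n) \<and> coeff g 0 \<noteq> 0. psi v ^ n * chr g)"
  proof (rule sum.reindex_bij_witness[where i = "hrev n" and j = "hrev n"])
    fix g :: "'a poly" assume "g \<in> {g \<in> lowdeg (Suc n). coeff g 0 \<noteq> 0}"
    then have g: "degree g \<le> n" "coeff g 0 \<noteq> 0" by (auto simp: lowdeg_iff)
    then have "coeff (hrev n g) n \<noteq> 0" by (simp add: coeff_hrev)
    then have "degree (hrev n g) \<ge> n" by (rule le_degree)
    then have "degree (hrev n g) = n" using degree_hrev_le[OF g(1)] by linarith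
    then show "hrev n g \<in> {f. f \<noteq> 0 \<and> degree f = n}" using \<open>coeff (hrev n g) n \<noteq> 0\<close> by auto
    show "hrev n (hrev n g) = g" using g by (simp add: hrev_hrev)
  next
    fix f :: "'a poly" assume "f \<in> {f. f \<noteq> 0 \<and> degree f = n}"
    then have f: "f \<noteq> 0" "degree f = n" by auto
    then show "hrev n f \<in> {g \<in> lowdeg (Suc n). coeff g 0 \<noteq> 0}"
      using degree_hrev_le[of f n] by (auto simp: coeff_hrev lowdeg_iff)
    show "hrev n (hrev n f) = f" using f by (simp add: hrev_hrev)
  qed auto
  also have "\<dots> = (\<Sum>g\<in>lowdeg (Suc n). psi v ^ n * chr g)"
  proof (rule sum.mono_neutral_left)
    show "\<forall>g\<in>lowdeg (Suc n) - {g \<in> lowdeg (Suc n). coeff g 0 \<noteq> 0}. psi v ^ n * chr g = 0"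
    proof
      fix g :: "'a poly" assume "g \<in> lowdeg (Suc n) - {g \<in> lowdeg (Suc n). coeff g 0 \<noteq> 0}"
      then have "\<not> comaximal X g" by (simp add: X_def comaximal_X_iff)
      then have "\<not> comaximal g X" using comaximal_sym by blast
      then have "\<not> comaximal g Q" unfolding Q_def using comaximal_dvd[of g _ X] s
        by (metis dvd_mult dvd_power less_le_trans zero_less_one)
      then show "psi v ^ n * chr g = 0" by (simp add: fin_char_eq_0)
    qed
  qed auto
  finally show ?thesis by (simp add: partial_sum_def sum_distrib_left)
qed

lemma dcoeff_functional_eq:
  assumes "r + s = Suc g"
  shows "functional_eq g (dcoeff b P)"
  unfolding functional_eq_def
proof (intro conjI allI impI)
  have q1: "real CARD('a) - 1 \<noteq> 0" using card_field_gt_1[where 'a = 'a] by simp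
  {
    fix n assume "2 * g < n"
    then have "partial_sum (Suc n) = 0" using assms by (intro partial_sum_eq_0) (simp add: degree_Q')
    then show "dcoeff b P n = 0" using partial_sum_eq_dcoeff[of n] q1 by simp
  next
    fix n assume n: "n \<le> 2 * g"
    have "real CARD('a) ^ Suc g * partial_sum (Suc (2 * g - n)) = real CARD('a) ^ Suc (2 * g - n) * partial_sum (Suc n)"
      using functional_equation_aux[of "Suc n"] n assms by (simp add: Suc_diff_le degree_Q')
    \<comment> \<open>The exponents have the same parity, so the sign from infinity drops out of the
      functional equation.\<close>
    moreover have "psi v ^ (2 * g - n) = psi v ^ n"
      using n psi_cases[of v] by (auto simp: minus_one_power_iff)
    ultimately have "real CARD('a) ^ Suc g * (psi v ^ (2 * g - n) * partial_sum (Suc (2 * g - n)))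
      = real CARD('a) ^ Suc (2 * g - n) * (psi v ^ n * partial_sum (Suc n))" by (simp add: mult_ac)
    then show "real CARD('a) ^ g * dcoeff b P (2 * g - n) = real CARD('a) ^ (2 * g - n) * dcoeff b P n"
      unfolding partial_sum_eq_dcoeff using q1 by simp
  }
qed

end

section \<open>Translation of the variable by one\<close>

context even_const_field
begin

abbreviation shift :: "'a poly \<Rightarrow> 'a poly" where
  "shift f \<equiv> pcompose f [:1, 1:]"

lemma shift_shift: "shift (shift f) = f"
proof -
  have "pcompose [:1, 1:] [:1, 1:] = ([:0, 1:] :: 'a poly)"
    by (simp add: pcompose_pCons)
  then show ?thesis by (simp add: pcompose_assoc[symmetric] pcompose_idR)
qed

lemma degree_shift [simp]: "degree (shift f) = degree f"
  by (simp add: degree_pcompose)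

lemma lead_coeff_shift: "lead_coeff (shift f) = lead_coeff f"
  using lead_coeff_comp[of "[:1, 1:]" f] by simp

lemma coeff_shift_degree [simp]: "coeff (shift f) (degree f) = lead_coeff f"
  using lead_coeff_shift[of f] by simp

lemma coeff_shift_top: "degree f \<le> n \<Longrightarrow> coeff (shift f) n = coeff f n"
  using lead_coeff_shift[of f] by (cases "degree f = n") (auto simp: coeff_eq_0)

lemma shift_mod: "shift (a mod b) = shift a mod shift b"
proof (cases "b = 0")
  case False
  have "shift a = shift (a mod b + b * (a div b))" by simp
  then have "shift a = shift (a mod b) + shift b * shift (a div b)"
    by (simp only: pcompose_add pcompose_mult)
  then have "shift a mod shift b = shift (a mod b) mod shift b" by simp
  also have "\<dots> = shift (a mod b)"
  proof (rule mod_lowdeg)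
    show "shift (a mod b) \<in> lowdeg (degree (shift b))"
      using lowdeg_mod[OF False, of a] by (auto simp: lowdeg_iff)
  qed
  finally show ?thesis by simp
qed simp

lemma inf_res_shift: "inf_res (shift a) (shift b) = inf_res a b"
proof (cases "b = 0")
  case False
  then show ?thesis using degree_mod_le[OF False, of a]
    by (simp add: inf_res_def lead_coeff_shift coeff_shift_top flip: shift_mod)
qed (simp add: inf_res_def)

lemma shift_dvd_iff: "shift a dvd shift b \<longleftrightarrow> a dvd b"
proof -
  have "shift a dvd shift b" if "a dvd b" for a b
    using that by (auto elim!: dvdE simp: pcompose_mult)
  then show ?thesis by (metis shift_shift)
qed

lemma comaximal_shift: "comaximal a b \<Longrightarrow> comaximal (shift a) (shift b)"
proof -
  assume "comaximal a b"
  then obtain x y where "x * a + y * b = 1" unfolding comaximal_def by blast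
  then have "shift (x * a + y * b) = shift 1" by simp
  then have "shift x * shift a + shift y * shift b = 1" by (simp add: pcompose_add pcompose_mult pcompose_1)
  then show ?thesis unfolding comaximal_def by blast
qed

lemma symb_shift:
  assumes "comaximal D C"
  shows "symb (shift C) (shift D) (shift f) = symb C D f"
proof (cases "comaximal D f")
  case True
  then obtain h where h: "f dvd h * D + C" using assms ex_representative_iff by blast
  then have "shift f dvd shift (h * D + C)" by (simp add: shift_dvd_iff)
  then have h': "shift f dvd shift h * shift D + shift C" by (simp add: pcompose_add pcompose_mult)
  have "shift h * pderiv (shift f) = shift (h * pderiv f)"
    by (simp add: pderiv_pcompose pcompose_mult pderiv_pCons one_pCons[symmetric])
  then show ?thesis
    by (simp add: symb_eq[OF assms h] symb_eq[OF comaximal_shift[OF assms] h'] inf_res_shift)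
next
  case False
  then have "\<not> comaximal (shift D) (shift f)" using comaximal_shift shift_shift by metis
  then show ?thesis using False by (simp add: symb_eq_0[OF assms] symb_eq_0[OF comaximal_shift[OF assms]])
qed

lemma dcoeff_shift:
  assumes "comaximal D C"
  shows "dcoeff (shift C) (shift D) n = dcoeff C D n"
  unfolding dcoeff_def
  by (rule sum.reindex_bij_witness[where i = shift and j = shift])
    (auto simp: monics_def shift_shift lead_coeff_shift symb_shift[OF assms, of "shift _", unfolded shift_shift])

text \<open>Only \<open>P = T\<close> escapes the preceding locale. Substituting
  \<open>T + 1\<close> for \<open>T\<close> is an automorphism that preserves residues and symbols
  and turns this prime into \<open>T + 1\<close>, whose constant term is nonzero.\<close>

lemma dcoeff_ramified_functional_eq:
  assumes P: "monic_irreducible P" "degree P = r" and b: "\<not> P dvd b" "degree b + 1 = r + 2 * s"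
    and s: "s \<ge> 1" and g: "r + s = Suc g"
  shows "functional_eq g (dcoeff b P)"
proof (cases "coeff P 0 = 0")
  case False
  then interpret ramified_infinity \<xi> b P r s using assms by unfold_locales auto
  show ?thesis using g by (rule dcoeff_functional_eq)
next
  case True
  then have PX: "P = [:0, 1:]" using P(1) irreducible_dvd_X by blast
  then have PX': "shift P = [:1, 1:]" by (simp add: pcompose_idR pcompose_pCons)
  interpret ramified_infinity \<xi> "shift b" "shift P" r s
  proof
    show "irreducible (shift P)" unfolding PX' by (rule irreducible_linear_field_poly) simp
    show "coeff (shift P) 0 \<noteq> 0" unfolding PX' by simp
    show "\<not> shift P dvd shift b" using b by (simp only: shift_dvd_iff) simp
  qed (use assms in \<open>auto simp: lead_coeff_shift\<close>)
  have "comaximal P b" using assms(1,3) by (simp add: comaximal_irreducible_iff)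
  then have "dcoeff (shift b) (shift P) = dcoeff b P" using dcoeff_shift by blast
  then show ?thesis using dcoeff_functional_eq[OF g] by simp
qed

end

section \<open>Averages over the families\<close>

definition monic_pairs :: "nat \<Rightarrow> ('a::comm_semiring_1 poly \<times> 'a poly) set" where
  "monic_pairs n = (\<Union>i\<le>n. monics i \<times> monics (n - i))"

lemma finite_monic_pairs [simp]: "finite (monic_pairs n :: ('a::finite_field poly \<times> 'a poly) set)"
  by (simp add: monic_pairs_def)

lemma sum_monic_pairs:
  fixes \<phi> :: "'a::finite_field poly \<Rightarrow> 'a poly \<Rightarrow> 'b::comm_monoid_add"
  shows "(\<Sum>(e, f)\<in>monic_pairs n. \<phi> e f) = (\<Sum>i\<le>n. \<Sum>e\<in>monics i. \<Sum>f\<in>monics (n - i). \<phi> e f)"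
proof -
  have "(\<Sum>(e, f)\<in>monic_pairs n. \<phi> e f) = (\<Sum>i\<le>n. \<Sum>(e, f)\<in>monics i \<times> monics (n - i). \<phi> e f)"
    unfolding monic_pairs_def by (rule sum.UNION_disjoint) (simp, simp, auto simp: monics_def)
  then show ?thesis by (simp add: sum.cartesian_product)
qed

lemma card_monic_pairs: "card (monic_pairs n :: ('a::finite_field poly \<times> 'a poly) set) = (n + 1) * CARD('a) ^ n"
proof -
  have "card (monic_pairs n :: ('a poly \<times> 'a poly) set) = (\<Sum>(e, f)\<in>(monic_pairs n :: ('a poly \<times> 'a poly) set). 1)"
    by (simp add: case_prod_unfold)
  also have "\<dots> = (\<Sum>i\<le>n. \<Sum>e\<in>(monics i :: 'a poly set). \<Sum>f\<in>(monics (n - i) :: 'a poly set). 1)"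
    by (rule sum_monic_pairs)
  also have "\<dots> = (\<Sum>i\<le>n. CARD('a) ^ n)"
    by (rule sum.cong) (auto simp: card_monics power_add[symmetric])
  finally show ?thesis by simp
qed

lemma monic_pairs_monic: "(e, f) \<in> monic_pairs n \<Longrightarrow> e * f \<in> monics (n::nat)" for e :: "'a::field poly"
  by (auto simp: monic_pairs_def monics_def lead_coeff_mult degree_mult_eq)
    (metis degree_mult_eq lead_coeff_mult le_add_diff_inverse leading_coeff_0_iff mult_1 one_neq_zero)+

text \<open>For power series, taking partial sums is multiplication by \<open>1 / (1 - X)\<close>,
  whose square has the coefficients \<open>n + 1\<close>.\<close>

lemma convolution_square:
  fixes A :: "nat \<Rightarrow> 'b::comm_ring_1"
  shows "(\<Sum>i\<le>n. (\<Sum>a\<le>i. A a) * (\<Sum>a\<le>n - i. A a)) =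
    (\<Sum>k\<le>n. of_nat (n - k + 1) * (\<Sum>i\<le>k. A i * A (k - i)))"
proof -
  define FA where "FA = Abs_fps A"
  define one :: "'b fps" where "one = Abs_fps (\<lambda>_. 1)"
  have S: "(FA * one) $ n = (\<Sum>a\<le>n. A a)" for n
    by (simp add: fps_mult_nth FA_def one_def atLeast0AtMost)
  have oo: "(one * one) $ n = of_nat (n + 1)" for n
    by (simp add: fps_mult_nth one_def)
  have "(\<Sum>i\<le>n. (\<Sum>a\<le>i. A a) * (\<Sum>a\<le>n - i. A a)) = ((FA * one) * (FA * one)) $ n"
    unfolding fps_mult_nth[of "FA * one" "FA * one"] S by (simp add: atLeast0AtMost)
  also have "(FA * one) * (FA * one) = (FA * FA) * (one * one)" by (simp add: mult_ac)
  also have "\<dots> $ n = (\<Sum>k\<le>n. (\<Sum>i\<le>k. A i * A (k - i)) * of_nat (n - k + 1))"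
    unfolding fps_mult_nth[of "FA * FA" "one * one"] oo
    by (simp add: fps_mult_nth FA_def atLeast0AtMost)
  finally show ?thesis by (simp add: mult.commute)
qed

lemma pairs_sum_by_total:
  fixes t :: "nat \<Rightarrow> 'b::comm_ring_1"
  shows "(\<Sum>(i, j) | i + j = n. t i * t j) = (\<Sum>i\<le>n. t i * t (n - i))"
  by (rule sum.reindex_bij_witness[where i = "\<lambda>i. (i, n - i)" and j = fst]) auto

text \<open>The reflection \<open>(i, j) \<mapsto> (d - i, d - j)\<close> exchanges the totals above
  \<open>d\<close> with those below it; folding the upper ones down doubles every total except
  \<open>d\<close> itself.\<close>

lemma square_sum_symmetric:
  fixes t :: "nat \<Rightarrow> real"
  assumes "\<And>i. i \<le> d \<Longrightarrow> t (d - i) = t i"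
  shows "(\<Sum>i\<le>d. t i)\<^sup>2 = (\<Sum>n\<le>d. (if n < d then 2 else 1) * (\<Sum>i\<le>n. t i * t (n - i)))"
proof -
  let ?f = "\<lambda>(i, j). t i * t j"
  define L where "L = {(i, j). i + j < d}"
  define E where "E = {(i, j). i + j = d}"
  define U where "U = {(i, j). i \<le> d \<and> j \<le> d \<and> i + j > d}"
  have fL: "finite L" by (rule finite_subset[of _ "{..d} \<times> {..d}"]) (auto simp: L_def)
  have fE: "finite E" by (rule finite_subset[of _ "{..d} \<times> {..d}"]) (auto simp: E_def)
  have fU: "finite U" by (rule finite_subset[of _ "{..d} \<times> {..d}"]) (auto simp: U_def)
  have "(\<Sum>i\<le>d. t i)\<^sup>2 = sum ?f ({..d} \<times> {..d})"
    by (simp add: power2_eq_square sum_product sum.cartesian_product)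
  also have "{..d} \<times> {..d} = L \<union> E \<union> U" by (auto simp: L_def E_def U_def)
  also have "sum ?f (L \<union> E \<union> U) = sum ?f L + sum ?f E + sum ?f U"
    using fL fE fU by (subst sum.union_disjoint; (subst sum.union_disjoint)?) (auto simp: L_def E_def U_def)
  also have "sum ?f U = sum ?f L"
    by (rule sum.reindex_bij_witness[where i = "\<lambda>(i, j). (d - i, d - j)" and j = "\<lambda>(i, j). (d - i, d - j)"])
      (auto simp: L_def U_def assms)
  also have "sum ?f L = (\<Sum>n<d. \<Sum>i\<le>n. t i * t (n - i))"
  proof -
    have "L = (\<Union>n<d. {(i, j). i + j = n})" by (auto simp: L_def)
    moreover have "finite {(i, j). i + j = (n::nat)}" for n
      by (rule finite_subset[of _ "{..n} \<times> {..n}"]) auto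
    ultimately have "sum ?f L = (\<Sum>n<d. sum ?f {(i, j). i + j = n})"
      by (simp only:) (rule sum.UNION_disjoint, auto)
    then show ?thesis by (simp add: pairs_sum_by_total)
  qed
  also have "sum ?f E = (\<Sum>i\<le>d. t i * t (d - i))"
    unfolding E_def by (rule pairs_sum_by_total)
  finally have "(\<Sum>i\<le>d. t i)\<^sup>2 = 2 * (\<Sum>n<d. \<Sum>i\<le>n. t i * t (n - i)) + (\<Sum>i\<le>d. t i * t (d - i))"
    by simp
  also have "\<dots> = (\<Sum>n\<le>d. (if n < d then 2 else 1) * (\<Sum>i\<le>n. t i * t (n - i)))"
    by (simp add: lessThan_Suc_atMost[symmetric] sum_distrib_left)
  finally show ?thesis .
qed

text \<open>The multiplicities of \<open>square_sum_symmetric\<close> for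
  \<open>d = 2 * g\<close>.\<close>

definition afe_weight :: "nat \<Rightarrow> nat \<Rightarrow> real" where
  "afe_weight g n = (if n < 2 * g then 2 else 1)"

section \<open>The polynomial parts in \<open>G_deg\<close>\<close>

lemma coeff_pcompose_square: "coeff (pcompose p [:0, 0, 1:]) n = (if even n then coeff p (n div 2) else 0)"
  for p :: "'a::comm_ring_1 poly"
proof (induction p arbitrary: n)
  case 0
  then show ?case by simp
next
  case (pCons a p)
  have "pcompose (pCons a p) [:0, 0, 1:] = pCons a (pCons 0 (pcompose p [:0, 0, 1:]))"
    by (simp add: pcompose_pCons)
  then show ?case by (auto simp: coeff_pCons pCons.IH split: nat.split)
qed

lemma pcompose_square_inject:
  fixes p r :: "'a::comm_ring_1 poly"
  assumes "pcompose p [:0, 0, 1:] = pcompose r [:0, 0, 1:]"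
  shows "p = r"
proof (rule poly_eqI)
  fix n
  have "coeff p n = coeff (pcompose p [:0, 0, 1:]) (2 * n)" by (simp add: coeff_pcompose_square)
  also have "\<dots> = coeff r n" unfolding assms by (simp add: coeff_pcompose_square)
  finally show "coeff p n = coeff r n" .
qed

lemma coeff_sum_odd_monoms:
  "coeff (\<Sum>i=1..s. monom (c i) (2 * i - 1)) n = (if odd n \<and> n < 2 * s then c (Suc (n div 2)) else (0::'a::comm_ring_1))"
proof -
  have "coeff (\<Sum>i=1..s. monom (c i) (2 * i - 1)) n = (\<Sum>i=1..s. if i = Suc (n div 2) \<and> odd n then c i else 0)"
    by (auto simp: coeff_sum intro!: sum.cong) (presburger+)?
  also have "\<dots> = (if odd n \<and> n < 2 * s then c (Suc (n div 2)) else 0)"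
  proof (cases "odd n")
    case True
    then have "(\<Sum>i=1..s. if i = Suc (n div 2) \<and> odd n then c i else 0)
      = (if Suc (n div 2) \<in> {1..s} then c (Suc (n div 2)) else 0)"
      by simp
    moreover have "Suc (n div 2) \<in> {1..s} \<longleftrightarrow> n < 2 * s" using True by (auto elim!: oddE)
    ultimately show ?thesis using True by simp
  qed simp
  finally show ?thesis .
qed

text \<open>Coordinates for counting: the odd part is \<open>T * p (T\<^sup>2)\<close> with
  \<open>p\<close> of exact degree \<open>s - 1\<close>. The functions \<open>c\<close> in
  \<open>G_deg\<close> do not serve as coordinates, since their values outside \<open>1..s\<close>
  are free.\<close>

lemma G_deg_eq:
  assumes "s \<ge> 1"
  shows "G_deg \<xi> s = (\<lambda>(\<alpha>, p). pCons \<alpha> (pcompose p [:0, 0, 1:])) `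
    ({0, \<xi>} \<times> {p. p \<noteq> 0 \<and> degree p = s - 1})"
proof -
  have eq: "[:\<alpha>:] + (\<Sum>i=1..s. monom (c i) (2 * i - 1)) = pCons \<alpha> (pcompose p [:0, 0, 1:])"
    if "\<And>i. i < s \<Longrightarrow> coeff p i = c (Suc i)" "\<And>i. i \<ge> s \<Longrightarrow> coeff p i = 0" for \<alpha> and c :: "nat \<Rightarrow> 'a" and p
  proof (rule poly_eqI)
    fix n
    show "coeff ([:\<alpha>:] + (\<Sum>i=1..s. monom (c i) (2 * i - 1))) n = coeff (pCons \<alpha> (pcompose p [:0, 0, 1:])) n"
      unfolding coeff_add coeff_sum_odd_monoms
      using that by (cases n) (auto simp: coeff_pCons coeff_pcompose_square elim!: evenE oddE)
  qed
  show ?thesis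
  proof (intro set_eqI iffI)
    fix F assume "F \<in> G_deg \<xi> s"
    then obtain \<alpha> c where F: "F = [:\<alpha>:] + (\<Sum>i=1..s. monom (c i) (2 * i - 1))" "\<alpha> \<in> {0, \<xi>}" "c s \<noteq> 0"
      unfolding G_deg_def by blast
    define p where "p = (\<Sum>i<s. monom (c (Suc i)) i)"
    have cp: "coeff p i = (if i < s then c (Suc i) else 0)" for i
      by (simp add: p_def coeff_sum)
    have "coeff p (s - 1) \<noteq> 0" using F(3) assms by (simp add: cp)
    moreover have "degree p \<le> s - 1" by (rule degree_le) (auto simp: cp)
    ultimately have "p \<noteq> 0" "degree p = s - 1" by (auto intro: antisym le_degree)
    moreover have "F = pCons \<alpha> (pcompose p [:0, 0, 1:])" unfolding F(1) by (rule eq) (auto simp: cp)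
    ultimately show "F \<in> (\<lambda>(\<alpha>, p). pCons \<alpha> (pcompose p [:0, 0, 1:])) ` ({0, \<xi>} \<times> {p. p \<noteq> 0 \<and> degree p = s - 1})"
      using F(2) by (intro image_eqI[of _ _ "(\<alpha>, p)"]) auto
  next
    fix F assume "F \<in> (\<lambda>(\<alpha>, p). pCons \<alpha> (pcompose p [:0, 0, 1:])) ` ({0, \<xi>} \<times> {p. p \<noteq> 0 \<and> degree p = s - 1})"
    then obtain \<alpha> p where F: "F = pCons \<alpha> (pcompose p [:0, 0, 1:])" "\<alpha> \<in> {0, \<xi>}" "p \<noteq> 0" "degree p = s - 1"
      by auto
    define c where "c i = coeff p (i - 1)" for i
    have "F = [:\<alpha>:] + (\<Sum>i=1..s. monom (c i) (2 * i - 1))"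
      unfolding F(1) using F(4) assms by (intro eq[symmetric]) (auto simp: c_def intro!: coeff_eq_0)
    moreover have "c s \<noteq> 0" using F(3) unfolding c_def F(4)[symmetric] by simp
    ultimately show "F \<in> G_deg \<xi> s" unfolding G_deg_def using F(2) by blast
  qed
qed

lemma card_degree_eq:
  "real (card {p::'a::finite_field poly. p \<noteq> 0 \<and> degree p = n}) = (real CARD('a) - 1) * real CARD('a) ^ n"
  using sum_lowdeg_Suc[of "\<lambda>_::'a poly. 1" n] by (simp add: card_monics)

lemma finite_G_deg: "s \<ge> 1 \<Longrightarrow> finite (G_deg (\<xi>::'a::finite_field) s)"
  by (simp add: G_deg_eq finite_degree_eq)

lemma card_G_deg:
  assumes "s \<ge> 1" "\<xi> \<noteq> 0"
  shows "real (card (G_deg (\<xi>::'a::finite_field) s)) = 2 * (real CARD('a) - 1) * real CARD('a) ^ (s - 1)"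
proof -
  have "inj_on (\<lambda>(\<alpha>, p). pCons \<alpha> (pcompose p [:0, 0, 1:])) ({0, \<xi>} \<times> {p. p \<noteq> 0 \<and> degree p = s - 1})"
    by (auto simp: inj_on_def dest: pcompose_square_inject)
  then have "card (G_deg \<xi> s) = card ({0, \<xi>} \<times> {p::'a poly. p \<noteq> 0 \<and> degree p = s - 1})"
    by (simp add: G_deg_eq[OF assms(1)] card_image)
  then show ?thesis using assms(2) by (simp add: card_cartesian_product card_degree_eq)
qed

lemma degree_G_deg:
  assumes "s \<ge> 1" "F \<in> G_deg \<xi> s"
  shows "degree F = 2 * s - 1" "coeff F (2 * s - 1) \<noteq> 0"
proof -
  obtain \<alpha> c where F: "F = [:\<alpha>:] + (\<Sum>i=1..s. monom (c i) (2 * i - 1))" "c s \<noteq> 0"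
    using assms(2) unfolding G_deg_def by blast
  have cF: "coeff F n = (if n = 0 then \<alpha> else 0) + (if odd n \<and> n < 2 * s then c (Suc (n div 2)) else 0)" for n
    unfolding F(1) coeff_add coeff_sum_odd_monoms by (cases n) simp_all
  obtain t where t: "s = Suc t" using assms(1) by (cases s) auto
  then have top: "coeff F (2 * s - 1) = c s" by (simp add: cF)
  then show "coeff F (2 * s - 1) \<noteq> 0" using F(2) by simp
  then have "degree F \<ge> 2 * s - 1" by (rule le_degree)
  moreover have "degree F \<le> 2 * s - 1" by (rule degree_le) (auto simp: cF)
  ultimately show "degree F = 2 * s - 1" by simp
qed

text \<open>Below the top index the coefficients are free; excluding \<open>j = s\<close> protects
  the condition \<open>c s \<noteq> 0\<close>.\<close>

lemma G_deg_add_monom: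
  assumes "1 \<le> j" "j < s" "F \<in> G_deg \<xi> s"
  shows "F + monom k (2 * j - 1) \<in> G_deg \<xi> s"
proof -
  obtain \<alpha> c where F: "F = [:\<alpha>:] + (\<Sum>i=1..s. monom (c i) (2 * i - 1))" "\<alpha> \<in> {0, \<xi>}" "c s \<noteq> 0"
    using assms(3) unfolding G_deg_def by blast
  define d where "d = c(j := c j + k)"
  have "(\<Sum>i=1..s. monom (d i) (2 * i - 1)) = (\<Sum>i=1..s. monom (c i) (2 * i - 1)) + monom k (2 * j - 1)"
  proof -
    have "(\<Sum>i=1..s. monom (d i) (2 * i - 1))
      = (\<Sum>i=1..s. monom (c i) (2 * i - 1) + (if i = j then monom k (2 * j - 1) else 0))"
      by (rule sum.cong) (auto simp: d_def add_monom)
    then show ?thesis using assms by (simp add: sum.distrib)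
  qed
  then have "F + monom k (2 * j - 1) = [:\<alpha>:] + (\<Sum>i=1..s. monom (d i) (2 * i - 1))"
    unfolding F(1) by (simp only: add.assoc)
  moreover have "d s \<noteq> 0" using F assms by (simp add: d_def)
  ultimately show ?thesis unfolding G_deg_def using F(2) by blast
qed

section \<open>Orthogonality over the families\<close>

context even_const_field
begin

lemma xi_nonzero: "\<xi> \<noteq> 0"
  using psi_0 psi_xi by force

lemma G_deg_add_xi:
  assumes "F \<in> G_deg \<xi> s"
  shows "F + [:\<xi>:] \<in> G_deg \<xi> s"
proof -
  obtain \<alpha> c where F: "F = [:\<alpha>:] + (\<Sum>i=1..s. monom (c i) (2 * i - 1))" "\<alpha> \<in> {0, \<xi>}" "c s \<noteq> 0"
    using assms unfolding G_deg_def by blast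
  have "F + [:\<xi>:] = ([:\<alpha>:] + [:\<xi>:]) + (\<Sum>i=1..s. monom (c i) (2 * i - 1))"
    unfolding F(1) by (simp only: ac_simps)
  also have "[:\<alpha>:] + [:\<xi>:] = [:\<alpha> + \<xi>:]" by simp
  finally show ?thesis unfolding G_deg_def using F(2,3) by (auto intro!: exI[of _ "\<alpha> + \<xi>"] exI[of _ c])
qed

text \<open>For a nonsquare \<open>f\<close> whose derivative vanishes modulo \<open>P\<close> the average over \<open>F\<close> vanishes:
  otherwise all power sums of the roots of \<open>f\<close> up to order \<open>2 s - 2\<close> vanish, and \<open>pderiv f\<close> is too
  small to be divisible by \<open>P\<^sup>2\<close>.\<close>

lemma sum_G_deg_eq_0:
  assumes P: "irreducible P" "P dvd pderiv f" and f: "pderiv f \<noteq> 0"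
    and deg: "degree f < 2 * (degree P + s)"
  shows "(\<Sum>F\<in>G_deg \<xi> s. psi (inf_res (F * pderiv f) f)) = 0"
proof -
  have f0: "f \<noteq> 0" using f by auto
  have "degree (pderiv f) \<ge> 2 * degree P"
  proof -
    obtain u t where t: "f = u\<^sup>2 + [:0, 1:] * t\<^sup>2" "pderiv f = t\<^sup>2" by (rule square_decomposition)
    then have "P dvd t" using P irreducible_dvd_power_poly by metis
    moreover have "t \<noteq> 0" using f t by auto
    ultimately show ?thesis using t(2) by (simp add: degree_power_eq dvd_imp_degree_le)
  qed
  have trans: "(\<Sum>F\<in>G_deg \<xi> s. psi (inf_res (F * pderiv f) f)) = 0"
    if "\<And>F. F \<in> G_deg \<xi> s \<Longrightarrow> F + E \<in> G_deg \<xi> s" "inf_res (E * pderiv f) f = \<xi>" for E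
    using that by (intro sum_translate_0[where e = E]) (simp_all add: distrib_right inf_res_add psi_add)
  show ?thesis
  proof (cases "odd (degree f)")
    case True
    \<comment> \<open>In odd degree the constant term of \<open>F\<close> alone produces the
      cancellation: the residue of \<open>pderiv f / f\<close> is \<open>degree f\<close>, which is
      \<open>1\<close> in the field.\<close>
    have "inf_res ([:\<xi>:] * pderiv f) f = \<xi>"
      using True by (simp add: inf_res_smult inf_res_pderiv_self of_nat_eq_parity)
    then show ?thesis using G_deg_add_xi by (rule trans[rotated])
  next
    case even: False
    \<comment> \<open>These are the power sums of the roots of \<open>f\<close>. Odd indices below
      \<open>2 * s - 1\<close> are within reach of translations inside \<open>G_deg\<close>; even
      indices reduce to half the index by squaring.\<close>
    define p where "p j = inf_res ([:0, 1:] ^ j * pderiv f) f" for j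
    have "\<exists>j. 1 \<le> j \<and> j < s \<and> p (2 * j - 1) \<noteq> 0"
    proof (rule ccontr)
      assume "\<not> (\<exists>j. 1 \<le> j \<and> j < s \<and> p (2 * j - 1) \<noteq> 0)"
      then have odd0: "p (2 * j - 1) = 0" if "1 \<le> j" "j < s" for j using that by blast
      have p0: "j + 1 < 2 * s \<Longrightarrow> p j = 0" for j
      proof (induction j rule: less_induct)
        case (less j)
        show ?case
        proof (cases "j = 0")
          case True
          then show ?thesis using even by (simp add: p_def inf_res_pderiv_self of_nat_eq_parity)
        next
          case j: False
          show ?thesis
          proof (cases "even j")
            case True
            then obtain k where k: "j = 2 * k" by (rule evenE)
            have "p j = (p k)\<^sup>2"
              unfolding p_def k using inf_res_frobenius[of "[:0, 1:] ^ k" f] by (simp add: power_mult[symmetric] mult.commute)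
            then show ?thesis using less k j by simp
          next
            case False
            then obtain k where k: "j = 2 * k + 1" by (rule oddE)
            then show ?thesis using odd0[of "k + 1"] less.prems by simp
          qed
        qed
      qed
      let ?e = "degree (pderiv f)" and ?n = "degree f"
      have n0: "?n > 0" using f by (metis degree_eq_zeroE gr0I pderiv_pCons pderiv_0 add_0 pCons_0_0)
      have e: "?e \<le> ?n - 1" by (rule degree_pderiv_le)
      \<comment> \<open>With this \<open>j\<close> the product has degree \<open>?n - 1\<close>, so
        its leading coefficient is what the residue reads and the power sum is nonzero. Then
        \<open>j + 1 \<ge> 2 * s\<close> bounds \<open>?e\<close> by \<open>?n - 2 * s\<close>,
        against the lower bound \<open>2 * degree P\<close>.\<close>
      define j where "j = ?n - 1 - ?e"
      have dj: "degree ([:0, 1:] ^ j * pderiv f) = j + ?e" using f by (simp add: degree_mult_eq degree_power_eq)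
      then have "p j = coeff ([:0, 1:] ^ j * pderiv f) (?n - 1) / lead_coeff f"
        unfolding p_def using e n0 by (intro inf_res_eq_coeff) (simp add: j_def)
      also have "?n - 1 = degree ([:0, 1:] ^ j * pderiv f)" using dj e by (simp add: j_def)
      also have "coeff ([:0, 1:] ^ j * pderiv f) \<dots> \<noteq> 0" using f by simp
      ultimately have "p j \<noteq> 0" using f0 by simp
      then have "2 * s \<le> j + 1" using p0 by force
      then show False using \<open>degree (pderiv f) \<ge> 2 * degree P\<close> deg e n0 by (simp add: j_def)
    qed
    then obtain j where j: "1 \<le> j" "j < s" "p (2 * j - 1) \<noteq> 0" by blast
    define E where "E = monom (\<xi> / p (2 * j - 1)) (2 * j - 1)"
    have "E * pderiv f = smult (\<xi> / p (2 * j - 1)) ([:0, 1:] ^ (2 * j - 1) * pderiv f)"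
      by (simp add: E_def monom_altdef)
    then have "inf_res (E * pderiv f) f = \<xi> / p (2 * j - 1) * p (2 * j - 1)"
      by (simp only: inf_res_smult p_def)
    then have "inf_res (E * pderiv f) f = \<xi>" using j by simp
    then show ?thesis using G_deg_add_monom[OF j(1,2)] unfolding E_def by (rule trans[rotated])
  qed
qed

text \<open>With \<open>x\<close> an inverse of \<open>f\<close>, the symbol is
  \<open>psi (inf_res (a * (pderiv f * x)) P)\<close>, an additive character of \<open>a\<close>;
  the \<open>- 1\<close> is the excluded term \<open>a = 0\<close>.\<close>

lemma sum_symb_proper:
  assumes P: "irreducible P" and f: "f \<noteq> 0" "comaximal P f"
  shows "(\<Sum>a\<in>lowdeg (degree P) - {0}. symb a P f)
    = (if P dvd pderiv f then real CARD('a) ^ degree P else 0) - 1"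
proof -
  have P0: "P \<noteq> 0" using P by auto
  obtain x where x: "P\<^sup>2 dvd f * x + 1" using f inverse_mod_square comaximal_sym by blast
  have "symb a P f = psi (inf_res (a * (pderiv f * x)) P)" if "a \<in> lowdeg (degree P) - {0}" for a
  proof -
    have "symb a P f = fin_char (a * P) P f"
      using that P f by (intro symb_proper) (auto simp: lowdeg_iff)
    also have "\<dots> = psi (inf_res (a * P * pderiv f * x) (P\<^sup>2))" by (rule fin_char_eq[OF x])
    also have "a * P * pderiv f * x = a * (pderiv f * x) * P" by (simp add: mult_ac)
    also have "inf_res \<dots> (P\<^sup>2) = inf_res (a * (pderiv f * x)) P"
      using inf_res_mult_cancel[OF P0, of "a * (pderiv f * x)" P] by (simp add: power2_eq_square)
    finally show ?thesis .
  qed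
  then have "(\<Sum>a\<in>lowdeg (degree P) - {0}. symb a P f)
    = (\<Sum>a\<in>lowdeg (degree P) - {0}. psi (inf_res (a * (pderiv f * x)) P))" by (rule sum.cong[OF refl])
  also have "\<dots> = (\<Sum>a\<in>lowdeg (degree P). psi (inf_res (a * (pderiv f * x)) P)) - 1"
    by (subst sum_diff1) auto
  also have "\<dots> = (if P dvd pderiv f * x then real CARD('a) ^ degree P else 0) - 1"
    by (simp only: sum_psi_inf_res_full[OF P0])
  also have "P dvd pderiv f * x \<longleftrightarrow> P dvd pderiv f"
  proof -
    have "P dvd f * x + 1" using x by (metis dvd_mult_left power2_eq_square)
    then have "comaximal P x" using comaximal_iff_inverse comaximal_sym by (metis mult.commute)
    then have "P dvd x * pderiv f \<Longrightarrow> P dvd pderiv f" by (rule comaximal_dvd_mult)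
    then show ?thesis by (auto simp: mult.commute)
  qed
  finally show ?thesis .
qed

text \<open>As \<open>pderiv f\<close> is a square, \<open>P\<close> would divide it twice, more
  than its degree allows.\<close>

lemma not_dvd_pderiv_small:
  assumes "irreducible P" "pderiv f \<noteq> 0" "degree f < 2 * degree P"
  shows "\<not> P dvd pderiv (f::'a poly)"
proof
  assume "P dvd pderiv f"
  moreover obtain u t where t: "f = u\<^sup>2 + [:0, 1:] * t\<^sup>2" "pderiv f = t\<^sup>2" by (rule square_decomposition)
  ultimately have "P dvd t" using assms irreducible_dvd_power_poly by metis
  moreover have "t \<noteq> 0" using assms t by auto
  ultimately have "2 * degree P \<le> degree (pderiv f)" using t(2) by (simp add: degree_power_eq dvd_imp_degree_le)
  then show False using degree_pderiv_le[of f] assms(3) by linarith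
qed

lemma abs_sum_symb_proper_le:
  assumes P: "irreducible P" and f: "pderiv f \<noteq> 0" "degree f < 2 * degree P"
  shows "\<bar>\<Sum>a\<in>lowdeg (degree P) - {0}. symb a P f\<bar> \<le> 1"
proof (cases "comaximal P f")
  case True
  have "f \<noteq> 0" using f by auto
  then show ?thesis using sum_symb_proper[OF P _ True] not_dvd_pderiv_small[OF P f] by simp
next
  case False
  have "symb a P f = 0" if "a \<in> lowdeg (degree P) - {0}" for a
  proof -
    have "\<not> P dvd a" using that by (intro not_dvd_of_degree_less) (auto simp: lowdeg_iff)
    then show ?thesis using P False by (simp add: symb_eq_0 comaximal_irreducible_iff)
  qed
  then show ?thesis by simp
qed

lemma symb_ramified:
  assumes "irreducible P" "a \<in> lowdeg (degree P) - {0}"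
  shows "symb (a + F * P) P f = symb a P f * psi (inf_res (F * pderiv f) f)"
proof -
  have "\<not> P dvd a" using assms(2) by (intro not_dvd_of_degree_less) (auto simp: lowdeg_iff)
  then show ?thesis using assms(1) by (intro symb_add_poly) (simp add: comaximal_irreducible_iff)
qed

lemma sum_symb_ramified:
  assumes P: "irreducible P"
  shows "(\<Sum>a\<in>lowdeg (degree P) - {0}. \<Sum>F\<in>G_deg \<xi> s. symb (a + F * P) P f)
    = (\<Sum>a\<in>lowdeg (degree P) - {0}. symb a P f) * (\<Sum>F\<in>G_deg \<xi> s. psi (inf_res (F * pderiv f) f))"
  by (simp add: symb_ramified[OF P] sum_product)

text \<open>The double sum is a product. If \<open>P\<close> divides \<open>f\<close>, every symbol
  is zero. Otherwise, if \<open>P\<close> does not divide \<open>pderiv f\<close>, the sum over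
  \<open>a\<close> is at most one in absolute value, and if it does, the sum over \<open>F\<close>
  vanishes by \<open>sum_G_deg_eq_0\<close>.\<close>

lemma abs_sum_symb_ramified_le:
  assumes P: "irreducible P" and f: "pderiv f \<noteq> 0" "degree f < 2 * (degree P + s)"
  shows "\<bar>\<Sum>a\<in>lowdeg (degree P) - {0}. \<Sum>F\<in>G_deg \<xi> s. symb (a + F * P) P f\<bar> \<le> real (card (G_deg \<xi> s))"
proof (cases "comaximal P f \<and> \<not> P dvd pderiv f")
  case True
  have "f \<noteq> 0" using f by auto
  then have "\<bar>\<Sum>a\<in>lowdeg (degree P) - {0}. symb a P f\<bar> \<le> 1" using sum_symb_proper[OF P] True by simp
  moreover have "\<bar>\<Sum>F\<in>G_deg \<xi> s. psi (inf_res (F * pderiv f) f)\<bar> \<le> real (card (G_deg \<xi> s))"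
    by (rule order.trans[OF sum_abs]) simp
  ultimately have "\<bar>\<Sum>a\<in>lowdeg (degree P) - {0}. symb a P f\<bar> * \<bar>\<Sum>F\<in>G_deg \<xi> s. psi (inf_res (F * pderiv f) f)\<bar>
    \<le> 1 * real (card (G_deg \<xi> s))" by (intro mult_mono) auto
  then show ?thesis unfolding sum_symb_ramified[OF P] abs_mult by simp
next
  case False
  show ?thesis
  proof (cases "comaximal P f")
    case True
    then show ?thesis using False sum_G_deg_eq_0[OF P _ f] by (simp add: sum_symb_ramified[OF P])
  next
    case False
    have "symb a P f = 0" if "a \<in> lowdeg (degree P) - {0}" for a
    proof -
      have "\<not> P dvd a" using that by (intro not_dvd_of_degree_less) (auto simp: lowdeg_iff)
      then show ?thesis using P False by (simp add: symb_eq_0 comaximal_irreducible_iff)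
    qed
    then show ?thesis by (simp add: sum_symb_ramified[OF P])
  qed
qed

lemma sum_symb_ramified_square:
  assumes P: "irreducible P" and f: "pderiv f = 0"
  shows "(\<Sum>a\<in>lowdeg (degree P) - {0}. \<Sum>F\<in>G_deg \<xi> s. symb (a + F * P) P f)
    = (if P dvd f then 0 else (real CARD('a) ^ degree P - 1) * real (card (G_deg \<xi> s)))"
proof -
  have "(\<Sum>a\<in>lowdeg (degree P) - {0}. symb a P f) = (\<Sum>a\<in>lowdeg (degree P) - {0::'a poly}. if P dvd f then 0 else 1)"
  proof (rule sum.cong[OF refl])
    fix a assume "a \<in> lowdeg (degree P) - {0::'a poly}"
    then have "\<not> P dvd a" by (intro not_dvd_of_degree_less) (auto simp: lowdeg_iff)
    then show "symb a P f = (if P dvd f then 0 else 1)"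
      using P f by (simp add: symb_square comaximal_irreducible_iff)
  qed
  moreover have "card (lowdeg (degree P) - {0::'a poly}) = CARD('a) ^ degree P - 1"
    by (simp add: card_Diff_singleton card_lowdeg)
  ultimately show ?thesis unfolding sum_symb_ramified[OF P] using f by (simp add: of_nat_diff)
qed

lemma sum_symb_proper_square:
  assumes P: "irreducible P" and f: "pderiv f = 0"
  shows "(\<Sum>a\<in>lowdeg (degree P) - {0}. symb a P f) = (if P dvd f then 0 else real CARD('a) ^ degree P - 1)"
proof -
  have "(\<Sum>a\<in>lowdeg (degree P) - {0}. symb a P f) = (\<Sum>a\<in>lowdeg (degree P) - {0::'a poly}. if P dvd f then 0 else 1)"
  proof (rule sum.cong[OF refl])
    fix a assume "a \<in> lowdeg (degree P) - {0::'a poly}"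
    then have "\<not> P dvd a" by (intro not_dvd_of_degree_less) (auto simp: lowdeg_iff)
    then show "symb a P f = (if P dvd f then 0 else 1)"
      using P f by (simp add: symb_square comaximal_irreducible_iff)
  qed
  moreover have "card (lowdeg (degree P) - {0::'a poly}) = CARD('a) ^ degree P - 1"
    by (simp add: card_Diff_singleton card_lowdeg)
  ultimately show ?thesis by (simp add: of_nat_diff)
qed

end

section \<open>Counting primes and pairs with square product\<close>

lemma monic_mult_cancel: "lead_coeff (c * e) = 1 \<Longrightarrow> lead_coeff c = 1 \<Longrightarrow> lead_coeff e = 1"
  for c e :: "'a::field poly"
  by (simp add: lead_coeff_mult)

lemma card_monics_dvd:
  fixes h :: "'a::finite_field poly"
  assumes "lead_coeff h = 1"
  shows "card {f \<in> monics n. h dvd f} = (if degree h \<le> n then CARD('a) ^ (n - degree h) else 0)"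
proof (cases "degree h \<le> n")
  case True
  have h0: "h \<noteq> 0" using assms by auto
  have "bij_betw (\<lambda>k. h * k) (monics (n - degree h)) {f \<in> monics n. h dvd f}"
  proof (rule bij_betwI')
    fix k l :: "'a poly" show "(h * k = h * l) = (k = l)" using h0 by simp
  next
    fix k :: "'a poly" assume "k \<in> monics (n - degree h)"
    then have k: "lead_coeff k = 1" "degree k = n - degree h" by (auto simp: monics_def)
    then have "k \<noteq> 0" by auto
    then have "degree (h * k) = n" using k True h0 by (simp add: degree_mult_eq)
    moreover have "lead_coeff (h * k) = 1" using lead_coeff_mult[of h k] k(1) assms by simp
    ultimately show "h * k \<in> {f \<in> monics n. h dvd f}" by (simp add: monics_def)
  next
    fix f assume "f \<in> {f \<in> monics n. h dvd f}"
    then obtain k where k: "f = h * k" "lead_coeff f = 1" "degree f = n" by (auto simp: monics_def elim: dvdE)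
    then have "k \<noteq> 0" by auto
    then have "degree k = n - degree h" using k h0 by (auto simp: degree_mult_eq)
    moreover have "lead_coeff k = 1" using k(2) assms monic_mult_cancel unfolding k(1) by blast
    ultimately have "k \<in> monics (n - degree h)" by (simp add: monics_def)
    then show "\<exists>x\<in>monics (n - degree h). f = h * x" using k(1) by blast
  qed
  then have "card (monics (n - degree h) :: 'a poly set) = card {f \<in> monics n. h dvd f}" by (rule bij_betw_same_card)
  then show ?thesis using True by (simp add: card_monics)
next
  case False
  have "{f \<in> monics n. h dvd f} = {}"
  proof (rule equals0I)
    fix f assume f: "f \<in> {f \<in> monics n. h dvd f}"
    then have "f \<noteq> 0" by (auto simp: monics_def)
    then show False using f False by (auto simp: monics_def dest: dvd_imp_degree_le)
  qed
  then show ?thesis using False by simp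
qed

lemma finite_monic_irreducibles [simp]: "finite (monic_irreducibles n :: 'a::finite_field poly set)"
  by (rule finite_subset[OF _ finite_monics[of n]]) (auto simp: monic_irreducibles_def monics_def)

lemma degree_eq_sum_multiplicity:
  fixes f :: "'a::finite_field poly"
  shows "lead_coeff f = 1 \<Longrightarrow>
    degree f = (\<Sum>P | lead_coeff P = 1 \<and> irreducible P \<and> P dvd f. poly_multiplicity P f * degree P)"
proof (induction f rule: monic_induct)
  case one
  have "{P::'a poly. lead_coeff P = 1 \<and> irreducible P \<and> P dvd 1} = {}"
    by (auto simp: irreducible_def)
  then show ?case by (simp only: sum.empty degree_1)
next
  case (mult Q f)
  have "Q \<noteq> 0" "f \<noteq> 0" using mult by auto
  then show ?case using mult.IH sum_multiplicity_mult[of f Q degree] mult.hyps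
    by (simp add: degree_mult_eq)
qed

lemma poly_multiplicity_eq_sum:
  fixes f :: "'a::finite_field poly"
  assumes "irreducible P" "f \<noteq> 0" "degree f \<le> n"
  shows "poly_multiplicity P f = (\<Sum>k=1..n. if P ^ k dvd f then 1 else 0)"
proof -
  define E where "E = {e. P ^ e dvd f}"
  have fin: "finite E" unfolding E_def by (rule finite_power_dvd[OF assms(1,2)])
  have 0: "0 \<in> E" by (simp add: E_def)
  have down: "e \<in> E" if "e' \<in> E" "e \<le> e'" for e e'
    using that le_imp_power_dvd[of e e' P] dvd_trans unfolding E_def by blast
  obtain M where M: "E = {0..M}"
  proof
    show "E = {0..Max E}"
    proof
      show "E \<subseteq> {0..Max E}" using Max_ge[OF fin] by auto
      have "Max E \<in> E" using 0 by (intro Max_in[OF fin]) auto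
      then show "{0..Max E} \<subseteq> E" using down by auto
    qed
  qed
  have "E \<subseteq> {0..n}"
  proof
    fix e assume "e \<in> E"
    then have "degree (P ^ e) \<le> degree f" using assms(2) by (simp add: E_def dvd_imp_degree_le)
    moreover have "P \<noteq> 0" "degree P > 0" using assms(1) by (auto simp: irreducible_def) (metis gr0I is_unit_iff_degree)
    ultimately have "e * degree P \<le> n" using assms(3) by (simp add: degree_power_eq)
    moreover have "e \<le> e * degree P" using \<open>degree P > 0\<close> by simp
    ultimately show "e \<in> {0..n}" by (metis atLeastAtMost_iff le0 order.trans)
  qed
  then have "M \<le> n" by (simp add: M)
  have "(\<Sum>k=1..n. if P ^ k dvd f then 1 else 0) = card {k \<in> {1..n}. P ^ k dvd f}"
    by (simp flip: sum.inter_filter)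
  also have "{k \<in> {1..n}. P ^ k dvd f} = {1..n} \<inter> E" by (auto simp: E_def)
  also have "\<dots> = {1..M}" using \<open>M \<le> n\<close> by (auto simp: M)
  finally have "(\<Sum>k=1..n. if P ^ k dvd f then 1 else 0) = M" by simp
  moreover have "Max {0..M} = M" by (rule Max_eqI) auto
  ultimately show ?thesis using fin unfolding poly_multiplicity_def E_def[symmetric] M by simp
qed

text \<open>The sum of the von Mangoldt function over the monic polynomials of degree
  \<open>m\<close>, with the degree in place of the logarithm: a prime of degree \<open>d\<close>
  dividing \<open>m\<close> has exactly one power of degree \<open>m\<close>, of weight
  \<open>d\<close>.\<close>

definition mangoldt_sum :: "'a::finite_field itself \<Rightarrow> nat \<Rightarrow> nat" where
  "mangoldt_sum _ m = (\<Sum>d | d dvd m. d * card (monic_irreducibles d :: 'a poly set))"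

text \<open>Chebyshev's identity: both sides are the total degree of the monic polynomials of degree
  \<open>n\<close>, on the right collected by the prime powers that divide them.\<close>

lemma degree_sum_identity:
  "n * CARD('a::finite_field) ^ n = (\<Sum>m=1..n. CARD('a) ^ (n - m) * mangoldt_sum TYPE('a) m)"
proof -
  let ?q = "CARD('a)"
  let ?I = "\<Union>d\<in>{1..n}. monic_irreducibles d :: 'a poly set"
  have I: "?I = {P. monic_irreducible P \<and> degree P \<in> {1..n}}" by (auto simp: monic_irreducibles_def)
  have "n * ?q ^ n = (\<Sum>f\<in>(monics n :: 'a poly set). degree f)"
  proof -
    have "(\<Sum>f\<in>(monics n :: 'a poly set). degree f) = (\<Sum>f\<in>(monics n :: 'a poly set). n)"
      by (rule sum.cong) (auto simp: monics_def)
    then show ?thesis by (simp add: card_monics)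
  qed
  also have "\<dots> = (\<Sum>f\<in>(monics n :: 'a poly set). \<Sum>P\<in>?I. \<Sum>k=1..n. if P ^ k dvd f then degree P else 0)"
  proof (rule sum.cong[OF refl])
    fix f :: "'a poly" assume "f \<in> monics n"
    then have f: "lead_coeff f = 1" "degree f = n" "f \<noteq> 0" by (auto simp: monics_def)
    have "degree f = (\<Sum>P | lead_coeff P = 1 \<and> irreducible P \<and> P dvd f. of_nat (poly_multiplicity P f) * degree P)"
      using degree_eq_sum_multiplicity[OF f(1)] by simp
    also have "\<dots> = (\<Sum>P\<in>?I. of_nat (poly_multiplicity P f) * degree P)"
    proof (rule sum_multiplicity_superset[OF f(3)])
      show "{P. lead_coeff P = 1 \<and> irreducible P \<and> P dvd f} \<subseteq> ?I"
      proof
        fix P assume "P \<in> {P. lead_coeff P = 1 \<and> irreducible P \<and> P dvd f}"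
        then have P: "monic_irreducible P" "P dvd f" by auto
        then have "degree P \<le> n" using f dvd_imp_degree_le by blast
        moreover have "degree P > 0" using P by (metis gr0I irreducible_def is_unit_iff_degree)
        ultimately show "P \<in> ?I" unfolding I using P by simp
      qed
      show "?I \<subseteq> {P. monic_irreducible P}" unfolding I by auto
    qed simp
    also have "\<dots> = (\<Sum>P\<in>?I. \<Sum>k=1..n. if P ^ k dvd f then degree P else 0)"
    proof (rule sum.cong[OF refl])
      fix P assume "P \<in> ?I"
      then have "irreducible P" unfolding I by simp
      then have "poly_multiplicity P f = (\<Sum>k=1..n. if P ^ k dvd f then 1 else 0)"
        using f by (intro poly_multiplicity_eq_sum) auto
      then show "of_nat (poly_multiplicity P f) * degree P = (\<Sum>k=1..n. if P ^ k dvd f then degree P else 0)"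
        by (simp add: sum_distrib_right if_distrib[of "\<lambda>x. x * degree P"] cong: if_cong)
    qed
    finally show "degree f = (\<Sum>P\<in>?I. \<Sum>k=1..n. if P ^ k dvd f then degree P else 0)" .
  qed
  also have "\<dots> = (\<Sum>P\<in>?I. \<Sum>k=1..n. \<Sum>f\<in>(monics n :: 'a poly set). if P ^ k dvd f then degree P else 0)"
    by (subst sum.swap) (intro sum.cong refl sum.swap)
  also have "\<dots> = (\<Sum>P\<in>?I. \<Sum>k=1..n. if degree P * k \<le> n then degree P * ?q ^ (n - degree P * k) else 0)"
  proof (intro sum.cong refl)
    fix P k assume "P \<in> ?I"
    then have P: "lead_coeff P = 1" "P \<noteq> 0" unfolding I by auto
    have "(\<Sum>f\<in>monics n. if P ^ k dvd f then degree P else 0) = degree P * card {f \<in> monics n. P ^ k dvd f}"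
      by (simp flip: sum.inter_filter)
    also have "card {f \<in> monics n. P ^ k dvd f} = (if degree P * k \<le> n then ?q ^ (n - degree P * k) else 0)"
    proof -
      have l: "lead_coeff (P ^ k) = 1" unfolding lead_coeff_power P(1) by simp
      have dg: "degree (P ^ k) = degree P * k" using P(2) by (simp add: degree_power_eq mult.commute)
      show ?thesis using card_monics_dvd[OF l, of n] by (simp only: dg)
    qed
    finally show "(\<Sum>f\<in>monics n. if P ^ k dvd f then degree P else 0)
      = (if degree P * k \<le> n then degree P * ?q ^ (n - degree P * k) else 0)" by simp
  qed
  also have "\<dots> = (\<Sum>d=1..n. \<Sum>P\<in>(monic_irreducibles d :: 'a poly set). \<Sum>k=1..n. if d * k \<le> n then d * ?q ^ (n - d * k) else 0)"
  proof (rule trans[OF sum.UNION_disjoint])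
    show "(\<Sum>d=1..n. \<Sum>P\<in>(monic_irreducibles d :: 'a poly set). \<Sum>k=1..n. if degree P * k \<le> n then degree P * ?q ^ (n - degree P * k) else 0)
      = (\<Sum>d=1..n. \<Sum>P\<in>(monic_irreducibles d :: 'a poly set). \<Sum>k=1..n. if d * k \<le> n then d * ?q ^ (n - d * k) else 0)"
      by (intro sum.cong refl) (auto simp: monic_irreducibles_def)
  qed (simp, simp, auto simp: monic_irreducibles_def)
  also have "\<dots> = (\<Sum>d=1..n. \<Sum>k=1..n. if d * k \<le> n then ?q ^ (n - d * k) * (d * card (monic_irreducibles d :: 'a poly set)) else 0)"
    by (intro sum.cong refl) (simp add: sum_distrib_left if_distrib mult_ac cong: if_cong)
  also have "\<dots> = (\<Sum>(d, k)\<in>{(d, k). d \<in> {1..n} \<and> k \<in> {1..n} \<and> d * k \<le> n}. ?q ^ (n - d * k) * (d * card (monic_irreducibles d :: 'a poly set)))"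
    unfolding sum.cartesian_product
    by (rule sum.mono_neutral_cong_right) (auto split: if_splits)
  also have "\<dots> = (\<Sum>(m, d)\<in>(SIGMA m:{1..n}. {d. d dvd m}). ?q ^ (n - m) * (d * card (monic_irreducibles d :: 'a poly set)))"
  proof (rule sum.reindex_bij_witness[where j = "\<lambda>(d, k). (d * k, d)" and i = "\<lambda>(m, d). (d, m div d)"])
    fix md assume "md \<in> (SIGMA m:{1..n}. {d. d dvd m})"
    then obtain m d where md: "md = (m, d)" "1 \<le> m" "m \<le> n" "d dvd m" by auto
    then obtain k where k: "m = d * k" by (auto elim: dvdE)
    then have "d > 0" "k > 0" using md by (auto intro: Nat.gr0I)
    then have "d > 0" "m div d > 0" "d * (m div d) = m" by (auto simp: k)
    moreover have "d \<le> m" using \<open>k > 0\<close> by (simp add: k)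
    moreover have "m div d \<le> n" using md le_trans[OF div_le_dividend] by blast
    ultimately show "(case md of (m, d) \<Rightarrow> (d, m div d)) \<in> {(d, k). d \<in> {1..n} \<and> k \<in> {1..n} \<and> d * k \<le> n}"
      using md by auto
  qed (auto simp: Suc_le_eq)
  also have "\<dots> = (\<Sum>m=1..n. \<Sum>d | d dvd m. ?q ^ (n - m) * (d * card (monic_irreducibles d :: 'a poly set)))"
    by (rule sum.Sigma[symmetric]) (auto intro: finite_divisors_nat)
  finally show ?thesis by (simp add: mangoldt_sum_def sum_distrib_left)
qed

text \<open>By induction each earlier term of \<open>degree_sum_identity\<close> is
  \<open>CARD('a) ^ n\<close>; there are \<open>n - 1\<close> of them, which leaves one for the
  last.\<close>

lemma mangoldt_sum_eq: "n \<ge> 1 \<Longrightarrow> mangoldt_sum TYPE('a::finite_field) n = CARD('a) ^ n"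
proof (induction n rule: less_induct)
  case (less n)
  obtain k where k: "n = Suc k" using less.prems by (cases n) auto
  have "n * CARD('a) ^ n = (\<Sum>m=1..k. CARD('a) ^ (n - m) * mangoldt_sum TYPE('a) m) + mangoldt_sum TYPE('a) n"
    using degree_sum_identity[of n, where 'a = 'a] by (simp add: k)
  also have "(\<Sum>m=1..k. CARD('a) ^ (n - m) * mangoldt_sum TYPE('a) m) = (\<Sum>m=1..k. CARD('a) ^ n)"
    using less.IH k by (intro sum.cong) (auto simp: power_add[symmetric])
  finally show ?case by (simp add: k)
qed

lemma mult_card_monic_irreducibles_le:
  "n \<ge> 1 \<Longrightarrow> n * card (monic_irreducibles n :: 'a::finite_field poly set) \<le> CARD('a) ^ n"
proof -
  assume n: "n \<ge> 1"
  have "n * card (monic_irreducibles n :: 'a poly set) \<le> mangoldt_sum TYPE('a) n"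
    unfolding mangoldt_sum_def using n by (intro member_le_sum[of n "{d. d dvd n}"]) (auto intro: finite_divisors_nat)
  then show ?thesis by (simp add: mangoldt_sum_eq[OF n])
qed

lemma sum_power_le: "(\<Sum>d=1..m. q ^ d) \<le> 2 * q ^ m" if "q \<ge> 2" for q :: nat
proof (induction m)
  case (Suc m)
  have "(\<Sum>d=1..Suc m. q ^ d) \<le> 2 * q ^ m + q ^ Suc m" using Suc by simp
  also have "2 * q ^ m \<le> q ^ Suc m" using that by simp
  finally show ?case by simp
qed simp

text \<open>Proper divisors of \<open>n\<close> are at most \<open>n div 2\<close>, so the remaining
  part of \<open>mangoldt_sum\<close> is bounded by a geometric sum of that length.\<close>

lemma mult_card_monic_irreducibles_ge:
  assumes "n \<ge> 1"
  shows "CARD('a) ^ n \<le> n * card (monic_irreducibles n :: 'a::finite_field poly set) + 2 * CARD('a) ^ (n div 2)"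
proof -
  let ?w = "\<lambda>d. d * card (monic_irreducibles d :: 'a poly set)"
  have fin: "finite {d. d dvd n}" using assms by (auto intro: finite_divisors_nat)
  have "CARD('a) ^ n = (\<Sum>d | d dvd n. ?w d)"
    using mangoldt_sum_eq[OF assms, where 'a = 'a] by (simp add: mangoldt_sum_def)
  also have "\<dots> = ?w n + (\<Sum>d\<in>{d. d dvd n} - {n}. ?w d)" by (rule sum.remove[OF fin]) simp
  also have "(\<Sum>d\<in>{d. d dvd n} - {n}. ?w d) \<le> (\<Sum>d=1..n div 2. CARD('a) ^ d)"
  proof -
    have "{d. d dvd n} - {n} \<subseteq> {1..n div 2}"
    proof
      fix d assume d: "d \<in> {d. d dvd n} - {n}"
      then obtain k where k: "n = d * k" by (auto elim: dvdE)
      then have "k \<ge> 2" "d \<ge> 1" using d assms by (cases k; cases "k - 1"; auto)+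
      then have "d * 2 \<le> n" using k by simp
      then show "d \<in> {1..n div 2}" using \<open>d \<ge> 1\<close> by auto
    qed
    then have "(\<Sum>d\<in>{d. d dvd n} - {n}. ?w d) \<le> (\<Sum>d=1..n div 2. ?w d)" by (intro sum_mono2) auto
    also have "\<dots> \<le> (\<Sum>d=1..n div 2. CARD('a) ^ d)"
      by (intro sum_mono mult_card_monic_irreducibles_le) auto
    finally show ?thesis .
  qed
  also have "(\<Sum>d=1..n div 2. CARD('a) ^ d) \<le> 2 * CARD('a) ^ (n div 2)"
    using card_field_gt_1[where 'a = 'a] by (intro sum_power_le) simp
  finally show ?thesis by simp
qed

section \<open>Triples with two coprime components\<close>

lemma ex_monic_gcd:
  fixes y z :: "'a::field poly"
  assumes "y \<noteq> 0"
  obtains c y' z' where "lead_coeff c = 1" "y = c * y'" "z = c * z'" "comaximal y' z'"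
proof -
  obtain u w d where d: "u * y + w * z = d" "d dvd y" "d dvd z" by (rule bezout_poly)
  then obtain y1 z1 where yz: "y = d * y1" "z = d * z1" by (auto elim!: dvdE)
  have d0: "d \<noteq> 0" using assms yz by auto
  define l where "l = lead_coeff d"
  have l0: "l \<noteq> 0" using d0 by (simp add: l_def)
  have "d * (u * y1 + w * z1) = d * 1" using d(1) yz by (simp add: algebra_simps)
  then have 1: "u * y1 + w * z1 = 1" using d0 mult_left_cancel by blast
  have "smult (inverse l) u * smult l y1 + smult (inverse l) w * smult l z1 = 1" using l0 1 by simp
  then have "comaximal (smult l y1) (smult l z1)" unfolding comaximal_def by blast
  moreover have "lead_coeff (smult (inverse l) d) = 1" using l0 by (simp add: l_def)
  moreover have "y = smult (inverse l) d * smult l y1" "z = smult (inverse l) d * smult l z1"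
    using yz l0 by simp_all
  ultimately show ?thesis using that by blast
qed

lemma monic_dvd_antisym:
  fixes c d :: "'a::field poly"
  assumes "lead_coeff c = 1" "lead_coeff d = 1" "c dvd d" "d dvd c"
  shows "c = d"
proof -
  obtain e where e: "d = c * e" using assms(3) by (rule dvdE)
  have "c \<noteq> 0" "d \<noteq> 0" using assms by auto
  then have "degree d \<le> degree c" using assms(4) by (simp add: dvd_imp_degree_le)
  moreover have "e \<noteq> 0" using e \<open>d \<noteq> 0\<close> by auto
  ultimately have "degree e = 0" using e \<open>c \<noteq> 0\<close> by (simp add: degree_mult_eq)
  then obtain k where k: "e = [:k:]" by (rule degree_eq_zeroE)
  have "lead_coeff e = 1" using assms e by (metis lead_coeff_mult mult_1)
  then show ?thesis using e k by simp
qed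

lemma in_monic_pairs_iff:
  "(e, f) \<in> monic_pairs n \<longleftrightarrow> lead_coeff e = 1 \<and> lead_coeff f = 1 \<and> degree e + degree f = n"
  by (auto simp: monic_pairs_def monics_def)

text \<open>\<open>(d, y, z)\<close> will stand for the pair
  \<open>(d * y\<^sup>2, d * z\<^sup>2)\<close>, of total degree \<open>2 * m\<close>. Without
  coprimality the triples can be counted directly.\<close>

definition monic_triples :: "nat \<Rightarrow> ('a::field poly \<times> 'a poly \<times> 'a poly) set" where
  "monic_triples m = {(d, y, z). lead_coeff d = 1 \<and> lead_coeff y = 1 \<and> lead_coeff z = 1
     \<and> degree d + degree y + degree z = m}"

definition comaximal_triples :: "nat \<Rightarrow> ('a::field poly \<times> 'a poly \<times> 'a poly) set" where
  "comaximal_triples m = {(d, y, z) \<in> monic_triples m. comaximal y z}"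

lemma monic_triples_eq: "monic_triples m = (\<Union>i\<le>m. monics i \<times> monic_pairs (m - i))"
  by (auto simp: monic_triples_def in_monic_pairs_iff monics_def)

lemma finite_monic_triples [simp]: "finite (monic_triples m :: ('a::finite_field poly \<times> 'a poly \<times> 'a poly) set)"
  unfolding monic_triples_eq by simp

lemma finite_comaximal_triples [simp]:
  "finite (comaximal_triples m :: ('a::finite_field poly \<times> 'a poly \<times> 'a poly) set)"
  by (rule finite_subset[OF _ finite_monic_triples[of m]]) (auto simp: comaximal_triples_def)

lemma card_monic_triples:
  "real (card (monic_triples m :: ('a::finite_field poly \<times> 'a poly \<times> 'a poly) set))
    = real ((m + 1) * (m + 2)) / 2 * real CARD('a) ^ m"
proof -
  have "card (monic_triples m :: ('a poly \<times> 'a poly \<times> 'a poly) set)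
    = (\<Sum>i\<le>m. card (monics i \<times> monic_pairs (m - i) :: ('a poly \<times> 'a poly \<times> 'a poly) set))"
    unfolding monic_triples_eq by (rule card_UN_disjoint) (simp, simp, auto simp: monics_def)
  also have "\<dots> = (\<Sum>i\<le>m. (m - i + 1) * CARD('a) ^ m)"
  proof (rule sum.cong[OF refl])
    fix i assume "i \<in> {..m}"
    then have "CARD('a) ^ i * CARD('a) ^ (m - i) = CARD('a) ^ m" by (simp add: power_add[symmetric])
    then show "card (monics i \<times> monic_pairs (m - i) :: ('a poly \<times> 'a poly \<times> 'a poly) set) = (m - i + 1) * CARD('a) ^ m"
      unfolding card_cartesian_product card_monics card_monic_pairs by (metis mult.left_commute)
  qed
  finally have "card (monic_triples m :: ('a poly \<times> 'a poly \<times> 'a poly) set) = (\<Sum>i\<le>m. m - i + 1) * CARD('a) ^ m"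
    by (simp only: sum_distrib_right)
  moreover have "(\<Sum>i\<le>m. m - i + 1) = (\<Sum>i\<le>m. i + 1)"
    by (rule sum.reindex_bij_witness[where i = "\<lambda>i. m - i" and j = "\<lambda>i. m - i"]) auto
  moreover have "real (\<Sum>i\<le>m. i + 1) = real ((m + 1) * (m + 2)) / 2"
    by (induction m) (simp_all add: field_simps)
  ultimately show ?thesis by (simp only: of_nat_mult of_nat_power)
qed

text \<open>Splitting off the greatest common divisor of the last two components.\<close>

lemma card_monic_triples_eq_sum:
  "card (monic_triples m :: ('a::finite_field poly \<times> 'a poly \<times> 'a poly) set)
    = (\<Sum>k\<le>m div 2. CARD('a) ^ k * card (comaximal_triples (m - 2 * k) :: ('a poly \<times> 'a poly \<times> 'a poly) set))"
proof -
  let ?S = "\<Union>k\<le>m div 2. (monics k :: 'a poly set) \<times> (comaximal_triples (m - 2 * k) :: ('a poly \<times> 'a poly \<times> 'a poly) set)"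
  have "bij_betw (\<lambda>(c, d, y, z). (d, c * y, c * z)) ?S (monic_triples m)"
  proof (rule bij_betw_imageI)
    show "inj_on (\<lambda>(c, d, y, z). (d, c * y, c * z)) ?S"
    proof (rule inj_onI)
      fix t t' assume "t \<in> ?S" "t' \<in> ?S" and tt: "(case t of (c, d, y, z) \<Rightarrow> (d, c * y, c * z)) = (case t' of (c, d, y, z) \<Rightarrow> (d, c * y, c * z))"
      then obtain k c d y z k' c' d' y' z' where t: "t = (c, d, y, z)" "t' = (c', d', y', z')"
        and c: "c \<in> monics k" "(d, y, z) \<in> comaximal_triples (m - 2 * k)"
        and c': "c' \<in> monics k'" "(d', y', z') \<in> comaximal_triples (m - 2 * k')" by auto
      have eqs: "d = d'" "c * y = c' * y'" "c * z = c' * z'" using tt t by auto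
      \<comment> \<open>The common factor is recovered from its multiples: coprime \<open>y2\<close>
        and \<open>z2\<close> generate the unit ideal, so \<open>c2\<close> is a combination of
        \<open>c2 * y2\<close> and \<open>c2 * z2\<close>.\<close>
      have dvd: "c1 dvd c2" if cm: "comaximal y2 z2" and e1: "c1 * y1 = c2 * y2" and e2: "c1 * z1 = c2 * z2" for c1 c2 y1 y2 z1 z2 :: "'a poly"
      proof -
        obtain u w where "u * y2 + w * z2 = 1" using cm unfolding comaximal_def by blast
        then have "c2 = u * (c2 * y2) + w * (c2 * z2)" by (metis distrib_left mult.left_commute mult.right_neutral)
        then have "c2 = u * (c1 * y1) + w * (c1 * z1)" using e1 e2 by simp
        also have "c1 dvd \<dots>" by (intro dvd_add dvd_mult dvd_triv_left)
        finally show ?thesis .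
      qed
      have "c dvd c'" using c c' eqs by (intro dvd[of y' z' c y c' z]) (auto simp: comaximal_triples_def)
      moreover have "c' dvd c" using c c' eqs by (intro dvd[of y z c' y' c z']) (auto simp: comaximal_triples_def)
      ultimately have cc: "c = c'" using c c' by (intro monic_dvd_antisym) (auto simp: monics_def)
      moreover have "c \<noteq> 0" using c by (auto simp: monics_def)
      ultimately show "t = t'" using t eqs by simp
    qed
    show "(\<lambda>(c, d, y, z). (d, c * y, c * z)) ` ?S = monic_triples m"
    proof (intro set_eqI iffI)
      fix t assume "t \<in> (\<lambda>(c, d, y, z). (d, c * y, c * z)) ` ?S"
      then obtain k c d y z where t: "t = (d, c * y, c * z)" "k \<le> m div 2" "c \<in> monics k"
        "(d, y, z) \<in> comaximal_triples (m - 2 * k)" by auto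
      then have "c \<noteq> 0" "y \<noteq> 0" "z \<noteq> 0" by (auto simp: monics_def comaximal_triples_def monic_triples_def)
      then show "t \<in> monic_triples m" using t
        by (auto simp: monics_def comaximal_triples_def monic_triples_def degree_mult_eq lead_coeff_mult[of c, unfolded degree_mult_eq])
          (metis lead_coeff_mult degree_mult_eq mult_1)+
    next
      fix t :: "'a poly \<times> 'a poly \<times> 'a poly" assume "t \<in> monic_triples m"
      then obtain d y z where t: "t = (d, y, z)" "lead_coeff d = 1" "lead_coeff y = 1" "lead_coeff z = 1"
        "degree d + degree y + degree z = m" by (auto simp: monic_triples_def)
      have "y \<noteq> 0" "z \<noteq> 0" using t by auto
      then obtain c y' z' where c: "lead_coeff c = 1" "y = c * y'" "z = c * z'" "comaximal y' z'"
        using ex_monic_gcd by blast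
      then have l: "lead_coeff y' = 1" "lead_coeff z' = 1" using t monic_mult_cancel by metis+
      have "c \<noteq> 0" "y' \<noteq> 0" "z' \<noteq> 0" using c l by auto
      then have dg: "degree y = degree c + degree y'" "degree z = degree c + degree z'" using c by (auto simp: degree_mult_eq)
      then have "(d, y', z') \<in> comaximal_triples (m - 2 * degree c)" "degree c \<le> m div 2"
        using t l c by (auto simp: comaximal_triples_def monic_triples_def)
      then have "(c, d, y', z') \<in> ?S" using c by (auto simp: monics_def)
      then show "t \<in> (\<lambda>(c, d, y, z). (d, c * y, c * z)) ` ?S"
        using t c by (intro image_eqI[of _ _ "(c, d, y', z')"]) auto
    qed
  qed
  then have "card (monic_triples m :: ('a poly \<times> 'a poly \<times> 'a poly) set) = card ?S"
    by (rule bij_betw_same_card[symmetric])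
  also have "\<dots> = (\<Sum>k\<le>m div 2. card ((monics k :: 'a poly set) \<times> (comaximal_triples (m - 2 * k) :: ('a poly \<times> 'a poly \<times> 'a poly) set)))"
    by (rule card_UN_disjoint) (simp, simp, auto simp: monics_def)
  finally show ?thesis by (simp add: card_cartesian_product card_monics)
qed

text \<open>In generating series the preceding relation divides \<open>1 / (1 - q * X) ^ 3\<close>
  by \<open>1 / (1 - q * X\<^sup>2)\<close>, which amounts to the recursion
  \<open>?T m = ?C m + q * ?T (m - 2)\<close>. The leading coefficient
  \<open>(1 - 1 / q) / 2\<close> of \<open>m\<^sup>2\<close> is the origin of
  \<open>1 / \<zeta>(2)\<close> in the result.\<close>

lemma card_comaximal_triples:
  "real (card (comaximal_triples m :: ('a::finite_field poly \<times> 'a poly \<times> 'a poly) set))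
    = real CARD('a) ^ m * (real ((m + 1) * (m + 2)) / 2 - real (m * (m - 1)) / (2 * real CARD('a)))"
proof -
  let ?T = "\<lambda>m. real (card (monic_triples m :: ('a poly \<times> 'a poly \<times> 'a poly) set))"
  let ?C = "\<lambda>m. real (card (comaximal_triples m :: ('a poly \<times> 'a poly \<times> 'a poly) set))"
  let ?q = "real CARD('a)"
  have eq: "?T m = (\<Sum>k\<le>m div 2. ?q ^ k * ?C (m - 2 * k))" for m
    unfolding card_monic_triples_eq_sum by simp
  show ?thesis
  proof (cases "m < 2")
    case True
    then have "?C m = ?T m" using eq[of m] by simp
    moreover have "m = 0 \<or> m = 1" using True by auto
    ultimately show ?thesis by (auto simp: card_monic_triples)
  next
    case False
    then obtain n where n: "m = n + 2" by (metis add.commute le_Suc_ex not_less)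
    have "?T m = ?C m + ?q * ?T n"
      unfolding eq[of m] eq[of n] by (simp add: n sum.atMost_Suc_shift sum_distrib_left mult.assoc del: sum.atMost_Suc)
    then show ?thesis
      unfolding card_monic_triples using card_field_gt_1[where 'a = 'a] by (simp add: n field_simps)
  qed
qed

section \<open>Pairs with square product\<close>

context even_const_field
begin

lemma pderiv_eq_0_imp_square: "pderiv f = 0 \<Longrightarrow> \<exists>s::'a poly. f = s\<^sup>2"
  by (rule square_decomposition[of f]) auto

lemma lead_coeff_square_eq_1: "lead_coeff ((y::'a poly)\<^sup>2) = 1 \<Longrightarrow> lead_coeff y = 1"
proof -
  assume "lead_coeff (y\<^sup>2) = 1"
  then have "(lead_coeff y + 1)\<^sup>2 = 0" by (simp add: square_add lead_coeff_power)
  then show ?thesis by (metis add_self_left add.commute add.right_neutral power_eq_0_iff zero_neq_numeral)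
qed

lemma poly_square_inject: "(x::'a poly)\<^sup>2 = y\<^sup>2 \<Longrightarrow> x = y"
proof -
  assume "x\<^sup>2 = y\<^sup>2"
  then have "(x + y)\<^sup>2 = 0" by (simp add: poly_square_add)
  then show ?thesis by (simp add: poly_add_eq_0_iff)
qed

definition square_pairs :: "nat \<Rightarrow> ('a poly \<times> 'a poly) set" where
  "square_pairs n = {(e, f) \<in> monic_pairs n. pderiv (e * f) = 0}"

lemma finite_square_pairs [simp]: "finite (square_pairs n)"
  by (rule finite_subset[OF _ finite_monic_pairs[of n]]) (auto simp: square_pairs_def)

lemma square_pairs_odd: "odd n \<Longrightarrow> square_pairs n = {}"
proof (rule equals0I)
  fix t assume "odd n" "t \<in> square_pairs n"
  then obtain e f where ef: "(e, f) \<in> square_pairs n" by (cases t) auto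
  then obtain s where s: "e * f = s\<^sup>2" using pderiv_eq_0_imp_square by (auto simp: square_pairs_def)
  have "e \<noteq> 0" "f \<noteq> 0" using ef by (auto simp: square_pairs_def in_monic_pairs_iff)
  moreover from this s have "s \<noteq> 0" by auto
  ultimately have "n = 2 * degree s"
    using ef s by (metis (no_types, lifting) square_pairs_def in_monic_pairs_iff case_prod_conv mem_Collect_eq degree_mult_eq degree_power_eq)
  then show False using \<open>odd n\<close> by simp
qed

lemma pderiv_dvd_self: "f dvd pderiv f \<Longrightarrow> pderiv (f::'a poly) = 0"
proof (rule ccontr)
  assume "f dvd pderiv f" "pderiv f \<noteq> 0"
  then have "degree f \<le> degree (pderiv f)" by (simp add: dvd_imp_degree_le)
  then have "degree f = 0" using degree_pderiv_le[of f] by linarith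
  then show False using \<open>pderiv f \<noteq> 0\<close> by (metis degree_eq_zeroE pderiv_pCons pderiv_0 add_0 pCons_0_0)
qed

text \<open>For surjectivity the gcd is split off; then \<open>pderiv (a * b) = 0\<close> gives
  \<open>a * pderiv b = b * pderiv a\<close>, so each of the coprime \<open>a\<close> and
  \<open>b\<close> divides its own derivative. By degree the derivatives vanish, and both are
  squares.\<close>

lemma bij_betw_square_pairs:
  "bij_betw (\<lambda>(d, y, z). (d * y\<^sup>2, d * z\<^sup>2)) (comaximal_triples m) (square_pairs (2 * m))"
proof (rule bij_betw_imageI)
  show "inj_on (\<lambda>(d, y, z). (d * y\<^sup>2, d * z\<^sup>2)) (comaximal_triples m :: ('a poly \<times> 'a poly \<times> 'a poly) set)"
  proof (rule inj_onI)
    fix t t' :: "'a poly \<times> 'a poly \<times> 'a poly"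
    assume tt: "t \<in> comaximal_triples m" "t' \<in> comaximal_triples m"
      "(case t of (d, y, z) \<Rightarrow> (d * y\<^sup>2, d * z\<^sup>2)) = (case t' of (d, y, z) \<Rightarrow> (d * y\<^sup>2, d * z\<^sup>2))"
    obtain d y z d' y' z' where t: "t = (d, y, z)" "t' = (d', y', z')" by (cases t; cases t') auto
    have d: "(d, y, z) \<in> comaximal_triples m" "(d', y', z') \<in> comaximal_triples m"
      and e: "d * y\<^sup>2 = d' * y'\<^sup>2" "d * z\<^sup>2 = d' * z'\<^sup>2" using tt unfolding t by auto
    have dvd: "c1 dvd c2" if cm: "comaximal y2 z2" and e1: "c1 * y1\<^sup>2 = c2 * y2\<^sup>2" and e2: "c1 * z1\<^sup>2 = c2 * z2\<^sup>2" for c1 c2 y1 y2 z1 z2 :: "'a poly"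
    proof -
      have "comaximal (y2\<^sup>2) (z2\<^sup>2)" using cm comaximal_power comaximal_sym by metis
      then obtain u w where "u * y2\<^sup>2 + w * z2\<^sup>2 = 1" unfolding comaximal_def by blast
      then have "c2 = u * (c2 * y2\<^sup>2) + w * (c2 * z2\<^sup>2)" by (metis distrib_left mult.left_commute mult.right_neutral)
      then have "c2 = u * (c1 * y1\<^sup>2) + w * (c1 * z1\<^sup>2)" using e1 e2 by simp
      also have "c1 dvd \<dots>" by (intro dvd_add dvd_mult dvd_triv_left)
      finally show ?thesis .
    qed
    have "d dvd d'" using d e by (intro dvd[of y' z' d y d' z]) (auto simp: comaximal_triples_def)
    moreover have "d' dvd d" using d e by (intro dvd[of y z d' y' d z']) (auto simp: comaximal_triples_def)
    ultimately have dd: "d = d'" using d by (intro monic_dvd_antisym) (auto simp: comaximal_triples_def monic_triples_def)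
    moreover have "d \<noteq> 0" using d by (auto simp: comaximal_triples_def monic_triples_def)
    ultimately show "t = t'" using e poly_square_inject t by simp
  qed
  show "(\<lambda>(d, y, z). (d * y\<^sup>2, d * z\<^sup>2)) ` comaximal_triples m = square_pairs (2 * m)"
  proof (intro set_eqI iffI)
    fix t :: "'a poly \<times> 'a poly" assume "t \<in> (\<lambda>(d, y, z). (d * y\<^sup>2, d * z\<^sup>2)) ` comaximal_triples m"
    then obtain d y z where t: "t = (d * y\<^sup>2, d * z\<^sup>2)" "(d, y, z) \<in> comaximal_triples m" by auto
    then have l: "lead_coeff d = 1" "lead_coeff y = 1" "lead_coeff z = 1" and dg: "degree d + degree y + degree z = m"
      by (auto simp: comaximal_triples_def monic_triples_def)
    then have 0: "d \<noteq> 0" "y \<noteq> 0" "z \<noteq> 0" by auto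
    have "lead_coeff (d * y\<^sup>2) = 1" "lead_coeff (d * z\<^sup>2) = 1" unfolding lead_coeff_mult lead_coeff_power l by simp_all
    moreover have "degree (d * y\<^sup>2) + degree (d * z\<^sup>2) = 2 * m" using dg 0 by (simp add: degree_mult_eq degree_power_eq)
    moreover have "d * y\<^sup>2 * (d * z\<^sup>2) = (d * y * z)\<^sup>2" by (simp add: power2_eq_square mult_ac)
    ultimately show "t \<in> square_pairs (2 * m)" using t by (simp add: square_pairs_def in_monic_pairs_iff)
  next
    fix t assume "t \<in> square_pairs (2 * m)"
    then obtain e f where t: "t = (e, f)" "lead_coeff e = 1" "lead_coeff f = 1" "degree e + degree f = 2 * m" "pderiv (e * f) = 0"
      by (auto simp: square_pairs_def in_monic_pairs_iff)
    then have "e \<noteq> 0" by auto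
    then obtain d a b where d: "lead_coeff d = 1" "e = d * a" "f = d * b" "comaximal a b" using ex_monic_gcd by blast
    have d0: "d \<noteq> 0" using d by auto
    have "pderiv (e * f) = pderiv (a * b) * d\<^sup>2"
      using pderiv_mult_square[of "a * b" d] by (simp add: d power2_eq_square mult_ac)
    then have ab: "pderiv (a * b) = 0" using t d0 by simp
    then have e1: "a * pderiv b = b * pderiv a" by (simp add: pderiv_mult poly_add_eq_0_iff)
    have "a dvd b * pderiv a" by (simp flip: e1)
    then have "pderiv a = 0" using comaximal_dvd_mult[OF d(4)] pderiv_dvd_self by blast
    moreover have "b dvd a * pderiv b" by (simp add: e1)
    then have "pderiv b = 0" using comaximal_dvd_mult[OF comaximal_sym[OF d(4)]] pderiv_dvd_self by blast
    ultimately obtain y z where yz: "a = y\<^sup>2" "b = z\<^sup>2" using pderiv_eq_0_imp_square by blast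
    have "lead_coeff a = 1" "lead_coeff b = 1" using t d monic_mult_cancel by metis+
    then have l: "lead_coeff y = 1" "lead_coeff z = 1" using yz lead_coeff_square_eq_1 by auto
    then have 0: "y \<noteq> 0" "z \<noteq> 0" by auto
    have "degree d + degree y + degree z = m" using t(4) d0 0 by (simp add: d yz degree_mult_eq degree_power_eq)
    moreover have "comaximal y z"
      using d(4) unfolding yz comaximal_square_iff by (metis comaximal_sym comaximal_square_iff)
    ultimately have "(d, y, z) \<in> comaximal_triples m" using d l by (simp add: comaximal_triples_def monic_triples_def)
    then show "t \<in> (\<lambda>(d, y, z). (d * y\<^sup>2, d * z\<^sup>2)) ` comaximal_triples m"
      using t d yz by (intro image_eqI[of _ _ "(d, y, z)"]) auto
  qed
qed

lemma card_square_pairs: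
  "real (card (square_pairs (2 * m)))
    = real CARD('a) ^ m * (real ((m + 1) * (m + 2)) / 2 - real (m * (m - 1)) / (2 * real CARD('a)))"
  using bij_betw_same_card[OF bij_betw_square_pairs[of m]] card_comaximal_triples[of m, where 'a = 'a] by simp

text \<open>Dividing the first component by \<open>P\<close> lands in total degree
  \<open>m - degree P\<close>. The saving of \<open>|P|\<close> is what counts, so the quadratic
  factor is kept at its value for \<open>m\<close>.\<close>

lemma card_monic_triples_dvd:
  assumes P: "lead_coeff (P::'a poly) = 1"
  shows "real (card {t \<in> monic_triples m. P dvd (fst t::'a poly)}) \<le> real ((m + 1) * (m + 2)) / 2 * real CARD('a) ^ m / real CARD('a) ^ degree P"
proof (cases "degree P \<le> m")
  case True
  have P0: "P \<noteq> 0" using P by auto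
  have "{t \<in> monic_triples m. P dvd fst t} \<subseteq> (\<lambda>(d, y, z). (P * d, y, z)) ` monic_triples (m - degree P)"
  proof
    fix t assume "t \<in> {t \<in> monic_triples m. P dvd fst t}"
    then obtain d y z where t': "t = (d, y, z)" and t: "(d, y, z) \<in> monic_triples m" "P dvd d" by (cases t) auto
    then obtain d' where d': "d = P * d'" by (auto elim: dvdE)
    have d0: "d \<noteq> 0" and ld: "lead_coeff d = 1" using t by (auto simp: monic_triples_def)
    then have "d' \<noteq> 0" "lead_coeff d' = 1" using d' P monic_mult_cancel by auto
    then have "(d', y, z) \<in> monic_triples (m - degree P)" using t P0 by (auto simp: monic_triples_def d' degree_mult_eq)
    then show "t \<in> (\<lambda>(d, y, z). (P * d, y, z)) ` monic_triples (m - degree P)"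
      using d' t' by (intro image_eqI[of _ _ "(d', y, z)"]) auto
  qed
  then have "card {t \<in> monic_triples m. P dvd fst t} \<le> card (monic_triples (m - degree P) :: ('a poly \<times> 'a poly \<times> 'a poly) set)"
    by (rule surj_card_le[rotated]) simp
  then have "real (card {t \<in> monic_triples m. P dvd fst t}) \<le> real ((m - degree P + 1) * (m - degree P + 2)) / 2 * real CARD('a) ^ (m - degree P)"
    unfolding card_monic_triples[symmetric] by simp
  also have "\<dots> \<le> real ((m + 1) * (m + 2)) / 2 * real CARD('a) ^ (m - degree P)"
    by (intro mult_right_mono divide_right_mono of_nat_mono mult_le_mono) auto
  also have "real CARD('a) ^ (m - degree P) = real CARD('a) ^ m / real CARD('a) ^ degree P"
    using True by (simp add: power_diff)
  finally show ?thesis by simp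
next
  case False
  have "{t \<in> monic_triples m. P dvd fst t} = {}"
  proof (rule equals0I)
    fix t assume "t \<in> {t \<in> monic_triples m. P dvd fst t}"
    then obtain d y z where t: "(d, y, z) \<in> monic_triples m" "P dvd d" by (cases t) auto
    then have "d \<noteq> 0" by (auto simp: monic_triples_def)
    then have "degree P \<le> degree d" using t by (simp add: dvd_imp_degree_le)
    then show False using t False by (auto simp: monic_triples_def)
  qed
  then show ?thesis by (simp only: card.empty) simp
qed

text \<open>The factor 3: \<open>P\<close> divides one of \<open>d\<close>, \<open>y\<close> and
  \<open>z\<close>, and dropping the coprimality of \<open>y\<close> and \<open>z\<close> makes the
  three cases symmetric.\<close>

lemma card_square_pairs_dvd:
  assumes P: "monic_irreducible (P::'a poly)"
  shows "real (card {(e, f) \<in> square_pairs (2 * m). P dvd e * f})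
    \<le> 3 * (real ((m + 1) * (m + 2)) / 2 * real CARD('a) ^ m / real CARD('a) ^ degree P)"
proof -
  let ?A = "{t \<in> monic_triples m. P dvd (fst t::'a poly)}"
  let ?\<phi> = "\<lambda>(d, y, z). (d * y\<^sup>2, d * z\<^sup>2) :: 'a poly \<times> 'a poly"
  have finA: "finite ?A" by (rule finite_subset[OF _ finite_monic_triples[of m]]) auto
  have "{(e, f) \<in> square_pairs (2 * m). P dvd e * f}
    \<subseteq> ?\<phi> ` (?A \<union> (\<lambda>(d, y, z). (y, d, z)) ` ?A \<union> (\<lambda>(d, y, z). (z, y, d)) ` ?A)"
  proof
    fix u assume u: "u \<in> {(e, f) \<in> square_pairs (2 * m). P dvd e * f}"
    then obtain e f where u': "u = (e, f)" and ef: "(e, f) \<in> square_pairs (2 * m)" "P dvd e * f" by auto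
    have "(e, f) \<in> ?\<phi> ` comaximal_triples m"
      using ef(1) bij_betw_square_pairs[of m] by (simp add: bij_betw_def)
    then obtain d y z where t: "e = d * y\<^sup>2" "f = d * z\<^sup>2" "(d, y, z) \<in> monic_triples m"
      by (auto simp: comaximal_triples_def)
    then have "P dvd (d * y * z)\<^sup>2" using ef(2) by (simp add: power2_eq_square mult_ac)
    then have "P dvd d * y * z" using P irreducible_dvd_power_poly by blast
    then have "P dvd d \<or> P dvd y \<or> P dvd z" using P irreducible_dvd_mult_poly by metis
    moreover have "(y, d, z) \<in> monic_triples m" "(z, y, d) \<in> monic_triples m" using t by (auto simp: monic_triples_def)
    ultimately have "(d, y, z) \<in> ?A \<union> (\<lambda>(d, y, z). (y, d, z)) ` ?A \<union> (\<lambda>(d, y, z). (z, y, d)) ` ?A"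
      using t by (auto simp: image_iff)
    then show "u \<in> ?\<phi> ` (?A \<union> (\<lambda>(d, y, z). (y, d, z)) ` ?A \<union> (\<lambda>(d, y, z). (z, y, d)) ` ?A)"
      using t u' by (intro image_eqI[of _ _ "(d, y, z)"]) auto
  qed
  then have "card {(e, f) \<in> square_pairs (2 * m). P dvd e * f}
    \<le> card (?A \<union> (\<lambda>(d, y, z). (y, d, z)) ` ?A \<union> (\<lambda>(d, y, z). (z, y, d)) ` ?A)"
    using finA by (intro surj_card_le) auto
  also have "\<dots> \<le> card ?A + card ?A + card ?A"
    by (intro order.trans[OF card_Un_le] add_mono card_image_le finA order_refl)
  finally have "real (card {(e, f) \<in> square_pairs (2 * m). P dvd e * f}) \<le> 3 * real (card ?A)" by simp
  then show ?thesis using card_monic_triples_dvd[of P m] P by linarith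
qed

end

section \<open>The central value squared as a finite sum\<close>

text \<open>Applied where the full sum of the coefficients vanishes, it exhibits the factor
  \<open>1 - Y\<close> of the L-polynomial, the trivial zero from a split infinite place.\<close>

lemma abel_sum:
  fixes A :: "nat \<Rightarrow> real"
  shows "(\<Sum>n\<le>Suc N. A n * Y ^ n) = (1 - Y) * (\<Sum>n\<le>N. (\<Sum>i\<le>n. A i) * Y ^ n) + (\<Sum>i\<le>Suc N. A i) * Y ^ Suc N"
  by (induction N) (simp_all add: algebra_simps)

text \<open>Meant for \<open>x = sqrt q\<close>. The induction needs \<open>4 \<le> 3 * x\<close>,
  which holds already for \<open>sqrt 2\<close>.\<close>

lemma sum_powers_le:
  fixes x :: real
  assumes "x * x \<ge> 2" "x > 0"
  shows "(\<Sum>n\<le>N. x ^ n) \<le> 4 * x ^ N"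
proof (induction N)
  case (Suc N)
  have "x \<ge> 4 / 3"
  proof (rule ccontr)
    assume "\<not> x \<ge> 4 / 3"
    then have "x * x < (4 / 3) * (4 / 3)" using assms(2) by (intro mult_strict_mono) auto
    then show False using assms(1) by simp
  qed
  then have "4 * x ^ N \<le> 3 * x * x ^ N" using assms(2) by (intro mult_right_mono) auto
  then show ?case using Suc by simp
qed simp

lemma sum_linear_powers_le:
  fixes q :: real
  assumes "q \<ge> 2"
  shows "(\<Sum>k\<le>n. real (n - k + 1) * q ^ k) \<le> 4 * q ^ n"
proof (induction n)
  case (Suc n)
  have p: "(\<Sum>k\<le>n. q ^ k) \<le> 2 * q ^ n" for n
  proof (induction n)
    case (Suc n)
    have "2 * q ^ n \<le> q * q ^ n" using assms by (intro mult_right_mono) auto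
    then show ?case using Suc by simp
  qed simp
  have "(\<Sum>k\<le>Suc n. real (Suc n - k + 1) * q ^ k) = (\<Sum>k\<le>n. real (n - k + 1) * q ^ k) + (\<Sum>k\<le>Suc n. q ^ k)"
    by (simp add: sum.distrib[symmetric] Suc_diff_le algebra_simps)
  also have "\<dots> \<le> 4 * q ^ n + 2 * q ^ Suc n" using Suc p[of "Suc n"] by linarith
  also have "4 * q ^ n \<le> 2 * q ^ Suc n" using assms by simp
  finally show ?case by simp
qed simp

section \<open>Coordinates for the families\<close>

lemma Fract_add_to_fract: "P \<noteq> 0 \<Longrightarrow> Fract a P + to_fract F = Fract (a + F * P) P"
  by (simp add: to_fract_def)

lemma F_prime_eq: "P \<noteq> 0 \<Longrightarrow> F_prime P = (\<lambda>a. Fract a P) ` (lowdeg (degree P) - {0})"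
  unfolding F_prime_def by (auto simp: lowdeg_iff)

lemma sum_F_prime:
  fixes \<phi> :: "'a::finite_field poly fract \<Rightarrow> 'b::comm_monoid_add"
  assumes "P \<noteq> 0"
  shows "(\<Sum>u\<in>F_prime P. \<phi> u) = (\<Sum>a\<in>lowdeg (degree P) - {0}. \<phi> (Fract a P))"
proof -
  have "inj_on (\<lambda>a. Fract a P) (lowdeg (degree P) - {0})"
    using assms by (auto simp: inj_on_def eq_fract)
  then show ?thesis by (simp add: F_prime_eq[OF assms] sum.reindex)
qed

lemma sum_F_prime':
  fixes \<phi> :: "'a::finite_field poly fract \<Rightarrow> 'b::comm_monoid_add"
  assumes "P \<noteq> 0"
  shows "(\<Sum>u\<in>F_prime' \<xi> P. \<phi> u) = (\<Sum>a\<in>lowdeg (degree P) - {0}. \<phi> (Fract (a + [:\<xi>:] * P) P))"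
proof -
  have "F_prime' \<xi> P = (\<lambda>u. u + to_fract [:\<xi>:]) ` F_prime P" unfolding F_prime'_def by auto
  then have "(\<Sum>u\<in>F_prime' \<xi> P. \<phi> u) = (\<Sum>u\<in>F_prime P. \<phi> (u + to_fract [:\<xi>:]))"
    by (simp add: sum.reindex inj_on_def)
  then show ?thesis by (simp only: sum_F_prime[OF assms] Fract_add_to_fract[OF assms])
qed

text \<open>\<open>P\<close> is read off from the denominator, then \<open>a\<close> and
  \<open>F\<close> are remainder and quotient of the numerator. Hence the unions behind
  \<open>H_deg\<close> are disjoint and a sum over it becomes an iterated sum.\<close>

lemma Fract_partial_fraction_inject:
  fixes P P' :: "'a::finite_field poly"
  assumes P: "monic_irreducible P" "monic_irreducible P'"
    and a: "a \<in> lowdeg (degree P) - {0}" "a' \<in> lowdeg (degree P') - {0}"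
    and eq: "Fract (a + F * P) P = Fract (a' + F' * P') P'"
  shows "P = P' \<and> a = a' \<and> F = F'"
proof -
  have nz: "P \<noteq> 0" "P' \<noteq> 0" using P by auto
  have e: "(a + F * P) * P' = (a' + F' * P') * P" using eq nz by (simp add: eq_fract)
  have "\<not> P dvd a" using a(1) dvd_imp_degree_le[of P a] by (auto simp: lowdeg_iff)
  then have "\<not> P dvd a + F * P" by (simp add: dvd_add_left_iff)
  moreover have "P dvd (a + F * P) * P'" by (simp add: e)
  ultimately have "P dvd P'" using P irreducible_dvd_mult_poly by blast
  then have PP: "P = P'" using P monic_dvd_monic_irreducible by blast
  have "(a + F * P) * P = (a' + F' * P) * P" using e unfolding PP .
  then have "a + F * P = a' + F' * P" using nz(1) by simp
  moreover from this have "(a + F * P) mod P = (a' + F' * P) mod P" by simp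
  then have "a = a'" using a PP by (simp add: mod_lowdeg)
  ultimately show ?thesis using PP nz by simp
qed

lemma sum_H_deg:
  fixes \<phi> :: "'a::finite_field poly fract \<Rightarrow> 'b::comm_monoid_add"
  shows "(\<Sum>u\<in>H_deg \<xi> (g + 1). \<phi> u) = (\<Sum>r=1..g. \<Sum>P\<in>monic_irreducibles r.
    \<Sum>a\<in>lowdeg r - {0}. \<Sum>F\<in>G_deg \<xi> (g + 1 - r). \<phi> (Fract (a + F * P) P))"
proof -
  let ?A = "\<lambda>r. SIGMA P:(monic_irreducibles r :: 'a poly set). (lowdeg r - {0} :: 'a poly set) \<times> G_deg \<xi> (g + 1 - r)"
  let ?f = "\<lambda>(P, a, F). Fract (a + F * P) P"
  have fin: "finite (?A r)" if "r \<in> {1..g}" for r using that by (intro finite_SigmaI) (auto simp: finite_G_deg)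
  have mem: "(P, a, F) \<in> ?A r \<longleftrightarrow> monic_irreducible P \<and> degree P = r \<and> a \<in> lowdeg r - {0} \<and> F \<in> G_deg \<xi> (g + 1 - r)" for P a F r
    by (auto simp: monic_irreducibles_def)
  have H: "H_deg \<xi> (g + 1) = ?f ` (\<Union>r\<in>{1..g}. ?A r)"
  proof (intro set_eqI iffI)
    fix u assume "u \<in> H_deg \<xi> (g + 1)"
    then obtain r P u' F where u: "r \<in> {1..g}" "P \<in> monic_irreducibles r" "u' \<in> F_prime P" "F \<in> G_deg \<xi> (g + 1 - r)"
      "u = u' + to_fract F" by (auto simp: H_deg_def H_pair_def F_deg_def)
    have P: "monic_irreducible P" "degree P = r" using u(2) by (auto simp: monic_irreducibles_def)
    then have P0: "P \<noteq> 0" by auto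
    then obtain a where a: "u' = Fract a P" "a \<in> lowdeg r - {0}" using u(3) P by (auto simp: F_prime_eq)
    have "u = ?f (P, a, F)" using u(5) a P0 by (simp add: Fract_add_to_fract)
    moreover have "(P, a, F) \<in> (\<Union>r\<in>{1..g}. ?A r)" using mem[of P a F r] P a u by blast
    ultimately show "u \<in> ?f ` (\<Union>r\<in>{1..g}. ?A r)" by (rule image_eqI)
  next
    fix u assume "u \<in> ?f ` (\<Union>r\<in>{1..g}. ?A r)"
    then obtain x r where x: "r \<in> {1..g}" "x \<in> ?A r" "u = ?f x" by blast
    obtain P a F where "x = (P, a, F)" by (cases x)
    with x have u: "r \<in> {1..g}" "(P, a, F) \<in> ?A r" "u = Fract (a + F * P) P" by simp_all
    then have P: "monic_irreducible P" "degree P = r" and a: "a \<in> lowdeg r - {0}" and F: "F \<in> G_deg \<xi> (g + 1 - r)"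
      using mem by blast+
    have P0: "P \<noteq> 0" using P by auto
    have "Fract a P \<in> F_deg r" using P a P0 by (auto simp: F_deg_def monic_irreducibles_def F_prime_eq)
    moreover have "u = Fract a P + to_fract F" using u(3) Fract_add_to_fract[OF P0, of a F] by simp
    ultimately have "u \<in> H_pair \<xi> r (g + 1 - r)"
      unfolding H_pair_def using F by blast
    then show "u \<in> H_deg \<xi> (g + 1)" unfolding H_deg_def using u(1) by auto
  qed
  have inj: "inj_on ?f (\<Union>r\<in>{1..g}. ?A r)"
  proof (rule inj_onI)
    fix x y assume x: "x \<in> (\<Union>r\<in>{1..g}. ?A r)" and y: "y \<in> (\<Union>r\<in>{1..g}. ?A r)" and xy: "?f x = ?f y"
    obtain P a F P' a' F' where e: "x = (P, a, F)" "y = (P', a', F')" by (cases x; cases y) auto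
    have "P = P' \<and> a = a' \<and> F = F'"
      using x y xy unfolding e by (intro Fract_partial_fraction_inject) (auto simp: monic_irreducibles_def)
    then show "x = y" using e by simp
  qed
  have "(\<Sum>u\<in>H_deg \<xi> (g + 1). \<phi> u) = (\<Sum>x\<in>(\<Union>r\<in>{1..g}. ?A r). \<phi> (?f x))"
    unfolding H by (rule sum.reindex[OF inj, unfolded comp_def])
  also have "\<dots> = (\<Sum>r=1..g. \<Sum>x\<in>?A r. \<phi> (?f x))"
    using fin by (intro sum.UNION_disjoint) (auto simp: monic_irreducibles_def)
  also have "\<dots> = (\<Sum>r=1..g. \<Sum>P\<in>monic_irreducibles r. \<Sum>a\<in>lowdeg r - {0}. \<Sum>F\<in>G_deg \<xi> (g + 1 - r). \<phi> (Fract (a + F * P) P))"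
  proof (rule sum.cong[OF refl])
    fix r assume r: "r \<in> {1..g}"
    have "(\<Sum>x\<in>?A r. \<phi> (?f x)) = (\<Sum>P\<in>monic_irreducibles r. \<Sum>(a, F)\<in>(lowdeg r - {0}) \<times> G_deg \<xi> (g + 1 - r). \<phi> (Fract (a + F * P) P))"
      using r by (subst sum.Sigma) (auto simp: finite_G_deg case_prod_unfold)
    then show "(\<Sum>x\<in>?A r. \<phi> (?f x)) = (\<Sum>P\<in>monic_irreducibles r. \<Sum>a\<in>lowdeg r - {0}. \<Sum>F\<in>G_deg \<xi> (g + 1 - r). \<phi> (Fract (a + F * P) P))"
      by (simp only: sum.cartesian_product)
  qed
  finally show ?thesis .
qed

section \<open>Central values and their squares\<close>

context even_const_field
begin

lemma q_ge_2: "real CARD('a) \<ge> 2"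
  using card_field_gt_1[where 'a = 'a] by simp

definition L_poly :: "'a poly \<Rightarrow> 'a poly \<Rightarrow> nat \<Rightarrow> real \<Rightarrow> real" where
  "L_poly C D N Y = (\<Sum>n\<le>N. dcoeff C D n * Y ^ n)"

text \<open>The value of \<open>q powr (- s)\<close> at the central point.\<close>

definition half :: real where "half = 1 / sqrt (real CARD('a))"

lemma half_square: "half * half = 1 / real CARD('a)"
  by (simp add: half_def)

lemma hasse_L_eq:
  assumes P: "irreducible P" "\<not> P dvd b" and N: "\<And>n. n > N \<Longrightarrow> dcoeff b P n = 0"
  shows "hasse_L (1 / 2) (Fract b P) = complex_of_real (L_poly b P N half)"
proof -
  let ?t = "\<lambda>n. \<Sum>f | lead_coeff f = 1 \<and> degree f = n.
     of_int (hasse_char (Fract b P) f) * of_nat (poly_abs f) powr (- (1 / 2)) :: complex"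
  have t: "?t n = complex_of_real (dcoeff b P n * half ^ n)" for n
  proof -
    have "?t n = (\<Sum>f\<in>monics n. complex_of_real (symb b P f * half ^ n))"
    proof (rule sum.cong)
      fix f :: "'a poly" assume "f \<in> monics n"
      then have f: "lead_coeff f = 1" "degree f = n" by (auto simp: monics_def)
      have "f \<noteq> 0" using f by auto
      then have "poly_abs f = CARD('a) ^ n" using f by (simp add: poly_abs_def)
      then have "(of_nat (poly_abs f) :: complex) powr (- (1 / 2)) = complex_of_real (real (CARD('a) ^ n)) powr complex_of_real (- (1 / 2))"
        by simp
      also have "\<dots> = complex_of_real (real (CARD('a) ^ n) powr (- (1 / 2)))"
        by (rule powr_of_real) simp
      also have "real (CARD('a) ^ n) powr (- (1 / 2)) = half ^ n"
      proof -
        have "real (CARD('a) ^ n) powr (- (1 / 2)) = inverse (sqrt (real CARD('a) ^ n))"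
          by (simp add: powr_minus powr_half_sqrt)
        then show ?thesis by (simp add: half_def real_sqrt_power power_divide inverse_eq_divide)
      qed
      moreover have "(of_int (hasse_char (Fract b P) f) :: complex) = complex_of_real (symb b P f)"
        using hasse_char_eq_symb[OF P f(1)] by (metis of_real_of_int_eq)
      ultimately show "of_int (hasse_char (Fract b P) f) * of_nat (poly_abs f) powr (- (1 / 2)) = complex_of_real (symb b P f * half ^ n)"
        by simp
    qed (simp add: monics_def)
    then show ?thesis by (simp add: dcoeff_def sum_distrib_right)
  qed
  have "hasse_L (1 / 2) (Fract b P) = (\<Sum>n. complex_of_real (dcoeff b P n * half ^ n))"
    unfolding hasse_L_def t ..
  also have "\<dots> = (\<Sum>n\<le>N. complex_of_real (dcoeff b P n * half ^ n))"
    using N by (intro suminf_finite) auto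
  finally show ?thesis by (simp add: L_poly_def)
qed

definition bcoeff :: "'a poly \<Rightarrow> 'a poly \<Rightarrow> nat \<Rightarrow> real" where
  "bcoeff C D n = (\<Sum>(e, f)\<in>monic_pairs n. symb C D (e * f))"

lemma dcoeff_convolution:
  assumes "comaximal D C"
  shows "(\<Sum>i\<le>n. dcoeff C D i * dcoeff C D (n - i)) = bcoeff C D n"
proof -
  have "bcoeff C D n = (\<Sum>i\<le>n. \<Sum>e\<in>monics i. \<Sum>f\<in>monics (n - i). symb C D (e * f))"
    unfolding bcoeff_def by (rule sum_monic_pairs)
  also have "\<dots> = (\<Sum>i\<le>n. \<Sum>e\<in>monics i. \<Sum>f\<in>monics (n - i). symb C D e * symb C D f)"
    by (intro sum.cong refl symb_mult assms) (auto simp: monics_def)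
  finally show ?thesis by (simp add: dcoeff_def sum_product)
qed

text \<open>At \<open>Y\<^sup>2 = 1 / q\<close> the functional equation makes
  \<open>S n * Y ^ n\<close> symmetric about \<open>g\<close>, so
  \<open>square_sum_symmetric\<close> applies and the identity is exact, without a tail. The sign of
  \<open>Y\<close> is left open: the negative root serves the family twisted by \<xi>.\<close>

lemma approximate_functional_equation:
  assumes S: "functional_eq g S" and Y: "Y * Y = 1 / real CARD('a)"
  shows "(\<Sum>n\<le>2 * g. S n * Y ^ n)\<^sup>2 = (\<Sum>n\<le>2 * g. afe_weight g n * Y ^ n * (\<Sum>i\<le>n. S i * S (n - i)))"
proof -
  have Y0: "Y \<noteq> 0" using Y by auto
  have q: "real CARD('a) = 1 / Y\<^sup>2" using Y by (simp add: power2_eq_square)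
  have sym: "S (2 * g - i) * Y ^ (2 * g - i) = S i * Y ^ i" if i: "i \<le> 2 * g" for i
  proof -
    obtain k where k: "2 * g = i + k" using i le_Suc_ex by blast
    have e: "real CARD('a) ^ g * S k = real CARD('a) ^ k * S i"
      using S i unfolding functional_eq_def k by (metis add_diff_cancel_left')
    have "(1 / Y\<^sup>2) ^ g = 1 / (Y ^ i * Y ^ k)"
      by (simp add: power_divide power_mult[symmetric] k power_add)
    moreover have "(1 / Y\<^sup>2) ^ k = 1 / (Y ^ k * Y ^ k)"
      by (simp add: power_divide power_mult[symmetric] mult_2 power_add)
    ultimately have "S k / (Y ^ i * Y ^ k) = S i / (Y ^ k * Y ^ k)" using e unfolding q by simp
    then have "S k * Y ^ k = S i * Y ^ i" using Y0 by (simp add: field_simps)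
    then show ?thesis by (simp add: k)
  qed
  have "(\<Sum>n\<le>2 * g. S n * Y ^ n)\<^sup>2
    = (\<Sum>n\<le>2 * g. (if n < 2 * g then 2 else 1) * (\<Sum>i\<le>n. S i * Y ^ i * (S (n - i) * Y ^ (n - i))))"
    using sym by (rule square_sum_symmetric)
  also have "\<dots> = (\<Sum>n\<le>2 * g. afe_weight g n * Y ^ n * (\<Sum>i\<le>n. S i * S (n - i)))"
  proof (rule sum.cong[OF refl])
    fix n
    have "(\<Sum>i\<le>n. S i * Y ^ i * (S (n - i) * Y ^ (n - i))) = (\<Sum>i\<le>n. Y ^ n * (S i * S (n - i)))"
    proof (rule sum.cong[OF refl])
      fix i assume "i \<in> {..n}"
      then have "Y ^ n = Y ^ i * Y ^ (n - i)" by (simp add: power_add[symmetric])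
      then show "S i * Y ^ i * (S (n - i) * Y ^ (n - i)) = Y ^ n * (S i * S (n - i))" by simp
    qed
    then show "(if n < 2 * g then 2 else 1) * (\<Sum>i\<le>n. S i * Y ^ i * (S (n - i) * Y ^ (n - i)))
      = afe_weight g n * Y ^ n * (\<Sum>i\<le>n. S i * S (n - i))"
      by (simp only: afe_weight_def sum_distrib_left[symmetric] mult.assoc)
  qed
  finally show ?thesis .
qed

lemma comaximal_proper: "irreducible (P::'a poly) \<Longrightarrow> a \<in> lowdeg (degree P) - {0} \<Longrightarrow> comaximal P a"
  using not_dvd_of_degree_less[of a P] by (auto simp: comaximal_irreducible_iff lowdeg_iff)

lemma comaximal_ramified: "irreducible (P::'a poly) \<Longrightarrow> a \<in> lowdeg (degree P) - {0} \<Longrightarrow> comaximal P (a + F * P)"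
  by (rule comaximal_add_mult[OF comaximal_proper])

lemma L_poly_ramified_square:
  assumes P: "monic_irreducible P" "degree P = r" and a: "a \<in> lowdeg r - {0}" and F: "F \<in> G_deg \<xi> s"
    and s: "s \<ge> 1" "r + s = Suc g"
  shows "hasse_L (1 / 2) (Fract (a + F * P) P) = complex_of_real (L_poly (a + F * P) P (2 * g) half)"
    and "(L_poly (a + F * P) P (2 * g) half)\<^sup>2 = (\<Sum>n\<le>2 * g. afe_weight g n * half ^ n * bcoeff (a + F * P) P n)"
proof -
  have cm: "comaximal P (a + F * P)" using P a by (intro comaximal_ramified) auto
  then have nd: "\<not> P dvd a + F * P" using P by (simp add: comaximal_irreducible_iff)
  have r: "r > 0" using P irreducible_degree_pos by blast
  have F0: "F \<noteq> 0" "degree F = 2 * s - 1" using degree_G_deg[OF s(1) F] by auto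
  have P0: "P \<noteq> 0" using P by auto
  have "degree (F * P) = 2 * s - 1 + r" using F0 P P0 by (simp add: degree_mult_eq)
  moreover have "degree a < 2 * s - 1 + r" using a r s by (auto simp: lowdeg_iff)
  ultimately have "degree (a + F * P) = 2 * s - 1 + r" by (metis degree_add_eq_right)
  then have fe: "functional_eq g (dcoeff (a + F * P) P)"
    using P nd s by (intro dcoeff_ramified_functional_eq[of P r _ s]) auto
  then show "hasse_L (1 / 2) (Fract (a + F * P) P) = complex_of_real (L_poly (a + F * P) P (2 * g) half)"
    using P nd by (intro hasse_L_eq) (auto simp: functional_eq_def)
  show "(L_poly (a + F * P) P (2 * g) half)\<^sup>2 = (\<Sum>n\<le>2 * g. afe_weight g n * half ^ n * bcoeff (a + F * P) P n)"
    unfolding L_poly_def approximate_functional_equation[OF fe half_square] dcoeff_convolution[OF cm] ..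
qed

text \<open>Infinity splits for \<open>a / P\<close>, so the functional equation belongs to the
  cofactor of \<open>1 - Y\<close>, whose coefficients are partial sums; squaring gives
  \<open>(1 - Y)\<^sup>2\<close> and, by \<open>convolution_square\<close>, the factors
  \<open>n - k + 1\<close>. Adding \<xi> makes infinity inert, which amounts to replacing
  \<open>Y\<close> by \<open>- Y\<close>.\<close>

lemma L_poly_split_square:
  assumes P: "monic_irreducible P" "degree P = Suc g" and a: "a \<in> lowdeg (Suc g) - {0}" and Y: "Y * Y = 1 / real CARD('a)"
  shows "hasse_L (1 / 2) (Fract a P) = complex_of_real (L_poly a P (Suc (2 * g)) half)"
    and "hasse_L (1 / 2) (Fract (a + [:\<xi>:] * P) P) = complex_of_real (L_poly a P (Suc (2 * g)) (- half))"
    and "(L_poly a P (Suc (2 * g)) Y)\<^sup>2 = (1 - Y)\<^sup>2 * (\<Sum>n\<le>2 * g. afe_weight g n * Y ^ n * (\<Sum>k\<le>n. real (n - k + 1) * bcoeff a P k))"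
proof -
  have cm: "comaximal P a" using P a by (intro comaximal_proper) auto
  then have nd: "\<not> P dvd a" using P by (simp add: comaximal_irreducible_iff)
  define S where "S n = (\<Sum>i\<le>n. dcoeff a P i)" for n
  have fe: "functional_eq g S"
    unfolding S_def using P a by (intro dcoeff_proper_functional_eq) (auto simp: lowdeg_iff)
  have S0: "S n = 0" if "n > 2 * g" for n using fe that by (simp add: functional_eq_def)
  have d0: "dcoeff a P n = 0" if "n > Suc (2 * g)" for n
  proof -
    obtain m where m: "n = Suc m" using \<open>n > Suc (2 * g)\<close> by (cases n) auto
    then have "dcoeff a P n = S n - S m" by (simp add: S_def)
    then show ?thesis using S0 that m by simp
  qed
  then show "hasse_L (1 / 2) (Fract a P) = complex_of_real (L_poly a P (Suc (2 * g)) half)"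
    using P nd by (intro hasse_L_eq) auto
  \<comment> \<open>The residue of \<xi> times the logarithmic derivative is
    \<open>degree f * \<xi>\<close>, and \<open>psi \<xi> = - 1\<close>.\<close>
  have tw: "dcoeff (a + [:\<xi>:] * P) P n = (- 1) ^ n * dcoeff a P n" for n
  proof -
    have "psi (inf_res ([:\<xi>:] * pderiv f) f) = (- 1) ^ degree f" for f
      by (simp add: inf_res_smult inf_res_pderiv_self mult.commute[of \<xi>] psi_of_nat_mult)
    then have "symb (a + [:\<xi>:] * P) P f = (- 1) ^ n * symb a P f" if "f \<in> monics n" for f
      using that symb_add_poly[OF cm, of "[:\<xi>:]" f] by (simp add: monics_def)
    then show ?thesis by (simp add: dcoeff_def sum_distrib_left)
  qed
  have "\<not> P dvd a + [:\<xi>:] * P" using comaximal_ramified[of P a "[:\<xi>:]"] P a by (simp add: comaximal_irreducible_iff)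
  then have "hasse_L (1 / 2) (Fract (a + [:\<xi>:] * P) P) = complex_of_real (L_poly (a + [:\<xi>:] * P) P (Suc (2 * g)) half)"
    using P d0 tw by (intro hasse_L_eq) auto
  also have "L_poly (a + [:\<xi>:] * P) P (Suc (2 * g)) half = L_poly a P (Suc (2 * g)) (- half)"
    unfolding L_poly_def tw by (intro sum.cong refl) (simp add: power_minus[of half])
  finally show "hasse_L (1 / 2) (Fract (a + [:\<xi>:] * P) P) = complex_of_real (L_poly a P (Suc (2 * g)) (- half))" .
  have conv: "(\<Sum>i\<le>n. S i * S (n - i)) = (\<Sum>k\<le>n. real (n - k + 1) * bcoeff a P k)" for n
    unfolding S_def convolution_square dcoeff_convolution[OF cm] by simp
  have "L_poly a P (Suc (2 * g)) Y = (1 - Y) * (\<Sum>n\<le>2 * g. S n * Y ^ n)"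
    unfolding L_poly_def abel_sum S_def[symmetric] using S0[of "Suc (2 * g)"] by simp
  then have "(L_poly a P (Suc (2 * g)) Y)\<^sup>2 = (1 - Y)\<^sup>2 * (\<Sum>n\<le>2 * g. S n * Y ^ n)\<^sup>2"
    by (simp add: power_mult_distrib)
  also have "\<dots> = (1 - Y)\<^sup>2 * (\<Sum>n\<le>2 * g. afe_weight g n * Y ^ n * (\<Sum>i\<le>n. S i * S (n - i)))"
    by (simp only: approximate_functional_equation[OF fe Y])
  also have "\<dots> = (1 - Y)\<^sup>2 * (\<Sum>n\<le>2 * g. afe_weight g n * Y ^ n * (\<Sum>k\<le>n. real (n - k + 1) * bcoeff a P k))"
    unfolding conv ..
  finally show "(L_poly a P (Suc (2 * g)) Y)\<^sup>2 = (1 - Y)\<^sup>2 * (\<Sum>n\<le>2 * g. afe_weight g n * Y ^ n * (\<Sum>k\<le>n. real (n - k + 1) * bcoeff a P k))" .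
qed

text \<open>Separates the pairs with square product, whose averages are known exactly, from the
  others, for which a uniform bound is multiplied by the number of all pairs.\<close>

lemma abs_sum_monic_pairs_le:
  assumes "\<And>e f. (e, f) \<in> square_pairs n \<Longrightarrow> \<psi> (e * f) = (if P dvd e * f then 0 else c)"
    and "\<And>e f. (e, f) \<in> monic_pairs n \<Longrightarrow> pderiv (e * f) \<noteq> 0 \<Longrightarrow> \<bar>\<psi> (e * f)\<bar> \<le> B" and "B \<ge> 0"
  shows "\<bar>(\<Sum>(e, f)\<in>monic_pairs n. \<psi> (e * f))
      - c * (real (card (square_pairs n)) - real (card {(e, f) \<in> square_pairs n. P dvd e * f}))\<bar>
    \<le> B * (real (n + 1) * real CARD('a) ^ n)" (is "\<bar>?L - c * ?N\<bar> \<le> _")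
proof -
  let ?D = "{(e, f) \<in> square_pairs n. P dvd e * f}"
  have sub: "square_pairs n \<subseteq> monic_pairs n" by (auto simp: square_pairs_def)
  have D: "?D \<subseteq> square_pairs n" by auto
  have "?L = (\<Sum>(e, f)\<in>square_pairs n. \<psi> (e * f)) + (\<Sum>(e, f)\<in>monic_pairs n - square_pairs n. \<psi> (e * f))"
    using sum.subset_diff[OF sub finite_monic_pairs] by (simp add: add.commute)
  also have "(\<Sum>(e, f)\<in>square_pairs n. \<psi> (e * f)) = (\<Sum>x\<in>square_pairs n. if x \<in> ?D then 0 else c)"
  proof (rule sum.cong[OF refl])
    fix x assume "x \<in> square_pairs n"
    then show "(case x of (e, f) \<Rightarrow> \<psi> (e * f)) = (if x \<in> ?D then 0 else c)"
      using assms(1)[of "fst x" "snd x"] by (cases x) simp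
  qed
  also have "\<dots> = (\<Sum>x\<in>square_pairs n - ?D. c)"
    by (rule sum.mono_neutral_cong_right) (auto split: if_splits)
  also have "\<dots> = c * ?N"
  proof -
    have "real (card (square_pairs n - ?D)) = ?N"
      using D by (subst card_Diff_subset) (auto simp: of_nat_diff card_mono intro: finite_subset)
    then show ?thesis by simp
  qed
  finally have "\<bar>?L - c * ?N\<bar> = \<bar>\<Sum>(e, f)\<in>monic_pairs n - square_pairs n. \<psi> (e * f)\<bar>" by simp
  also have "\<dots> \<le> (\<Sum>x\<in>monic_pairs n - square_pairs n. B)"
    by (rule order.trans[OF sum_abs], rule sum_mono) (use assms(2) in \<open>auto simp: square_pairs_def\<close>)
  also have "\<dots> \<le> (\<Sum>x\<in>(monic_pairs n :: ('a poly \<times> 'a poly) set). B)"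
    using assms(3) by (intro sum_mono2) auto
  also have "\<dots> = B * (real (n + 1) * real CARD('a) ^ n)"
    by (simp add: card_monic_pairs algebra_simps)
  finally show ?thesis .
qed

lemma sum_bcoeff_ramified:
  assumes P: "monic_irreducible P" "degree P = r" and n: "n < 2 * (r + s)"
  shows "\<bar>(\<Sum>a\<in>lowdeg r - {0}. \<Sum>F\<in>G_deg \<xi> s. bcoeff (a + F * P) P n)
      - (real CARD('a) ^ r - 1) * real (card (G_deg \<xi> s)) *
        (real (card (square_pairs n)) - real (card {(e, f) \<in> square_pairs n. P dvd e * f}))\<bar>
    \<le> real (card (G_deg \<xi> s)) * (real (n + 1) * real CARD('a) ^ n)"
proof -
  let ?\<psi> = "\<lambda>f. \<Sum>a\<in>lowdeg (degree P) - {0}. \<Sum>F\<in>G_deg \<xi> s. symb (a + F * P) P f"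
  have "(\<Sum>a\<in>lowdeg r - {0}. \<Sum>F\<in>G_deg \<xi> s. bcoeff (a + F * P) P n)
    = (\<Sum>a\<in>lowdeg r - {0}. \<Sum>x\<in>monic_pairs n. \<Sum>F\<in>G_deg \<xi> s. symb (a + F * P) P (fst x * snd x))"
    unfolding bcoeff_def case_prod_unfold by (intro sum.cong refl sum.swap)
  also have "\<dots> = (\<Sum>x\<in>monic_pairs n. ?\<psi> (fst x * snd x))"
    unfolding P(2) by (rule sum.swap)
  finally have "(\<Sum>a\<in>lowdeg r - {0}. \<Sum>F\<in>G_deg \<xi> s. bcoeff (a + F * P) P n) = (\<Sum>(e, f)\<in>monic_pairs n. ?\<psi> (e * f))"
    by (simp add: case_prod_unfold)
  then show ?thesis
  proof (simp only:, intro abs_sum_monic_pairs_le)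
    fix e f assume "(e, f) \<in> square_pairs n"
    then have "pderiv (e * f) = 0" by (simp add: square_pairs_def)
    then show "?\<psi> (e * f) = (if P dvd e * f then 0 else (real CARD('a) ^ r - 1) * real (card (G_deg \<xi> s)))"
      using sum_symb_ramified_square[of P "e * f" s] P by simp
  next
    fix e f :: "'a poly" assume ef: "(e, f) \<in> monic_pairs n" "pderiv (e * f) \<noteq> 0"
    then have "degree (e * f) = n" using monic_pairs_monic by (auto simp: monics_def)
    then show "\<bar>?\<psi> (e * f)\<bar> \<le> real (card (G_deg \<xi> s))"
      using P n ef(2) by (intro abs_sum_symb_ramified_le) auto
  qed simp
qed

lemma sum_bcoeff_split:
  assumes P: "monic_irreducible P" "degree P = Suc g" and n: "n \<le> 2 * g"
  shows "\<bar>(\<Sum>a\<in>lowdeg (Suc g) - {0}. bcoeff a P n) - (real CARD('a) ^ Suc g - 1) * real (card (square_pairs n))\<bar>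
    \<le> real (n + 1) * real CARD('a) ^ n"
proof -
  let ?\<psi> = "\<lambda>f. \<Sum>a\<in>lowdeg (degree P) - {0}. symb a P f"
  \<comment> \<open>The product is the square of a polynomial of degree at most \<open>g\<close>,
    below the degree of \<open>P\<close>; so there are no exceptional pairs in this family.\<close>
  have "{(e, f) \<in> square_pairs n. P dvd e * f} = {}"
  proof (rule equals0I)
    fix x assume "x \<in> {(e, f) \<in> square_pairs n. P dvd e * f}"
    then obtain e f where ef: "(e, f) \<in> monic_pairs n" "pderiv (e * f) = 0" "P dvd e * f" by (auto simp: square_pairs_def)
    then obtain l where l: "e * f = l\<^sup>2" using pderiv_eq_0_imp_square by blast
    have "lead_coeff (e * f) = 1" "degree (e * f) = n" using monic_pairs_monic[OF ef(1)] by (auto simp: monics_def)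
    then have "l \<noteq> 0" using l by auto
    then have "2 * degree l = n" using l \<open>degree (e * f) = n\<close> by (metis degree_power_eq)
    moreover have "P dvd l" using ef(3) l P irreducible_dvd_power_poly by metis
    ultimately show False using P n dvd_imp_degree_le[of P l] \<open>l \<noteq> 0\<close> by simp
  qed
  then have 0: "card {(e, f) \<in> square_pairs n. P dvd e * f} = 0" by (simp only: card.empty)
  have "(\<Sum>a\<in>lowdeg (Suc g) - {0}. bcoeff a P n) = (\<Sum>(e, f)\<in>monic_pairs n. ?\<psi> (e * f))"
    unfolding bcoeff_def case_prod_unfold P(2) by (rule sum.swap)
  moreover have "\<bar>(\<Sum>(e, f)\<in>monic_pairs n. ?\<psi> (e * f))
      - (real CARD('a) ^ Suc g - 1) * (real (card (square_pairs n)) - real (card {(e, f) \<in> square_pairs n. P dvd e * f}))\<bar>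
    \<le> 1 * (real (n + 1) * real CARD('a) ^ n)"
  proof (rule abs_sum_monic_pairs_le)
    fix e f assume "(e, f) \<in> square_pairs n"
    then have "pderiv (e * f) = 0" by (simp add: square_pairs_def)
    then show "?\<psi> (e * f) = (if P dvd e * f then 0 else real CARD('a) ^ Suc g - 1)"
      using sum_symb_proper_square[of P "e * f"] P by simp
  next
    fix e f :: "'a poly" assume ef: "(e, f) \<in> monic_pairs n" "pderiv (e * f) \<noteq> 0"
    then have "degree (e * f) = n" using monic_pairs_monic by (auto simp: monics_def)
    then show "\<bar>?\<psi> (e * f)\<bar> \<le> 1"
      using P n ef(2) by (intro abs_sum_symb_proper_le) auto
  qed simp
  ultimately show ?thesis unfolding 0 by simp
qed

end

section \<open>The second moments\<close>

lemma sum_even_terms: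
  fixes \<phi> :: "nat \<Rightarrow> real"
  assumes "\<And>n. odd n \<Longrightarrow> \<phi> n = 0"
  shows "(\<Sum>n\<le>2 * g. \<phi> n) = (\<Sum>m\<le>g. \<phi> (2 * m))"
  by (induction g) (simp_all add: assms)

lemma sum_triangle_swap:
  fixes a :: "nat \<Rightarrow> nat \<Rightarrow> real"
  shows "(\<Sum>n\<le>N. \<Sum>k\<le>n. a k (n - k)) = (\<Sum>k\<le>N. \<Sum>j\<le>N - k. a k j)"
proof -
  have "(\<Sum>n\<le>N. \<Sum>k\<le>n. a k (n - k)) = (\<Sum>(k, j)\<in>{(k, j). k + j \<le> N}. a k j)"
    by (rule sum.triangle_reindex_eq[symmetric])
  also have "{(k, j). k + j \<le> N} = (SIGMA k:{..N}. {..N - k})" by auto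
  also have "(\<Sum>(k, j)\<in>(SIGMA k:{..N}. {..N - k}). a k j) = (\<Sum>k\<le>N. \<Sum>j\<le>N - k. a k j)"
    by (rule sum.Sigma[symmetric]) auto
  finally show ?thesis .
qed

text \<open>Truncation of \<open>(\<Sum>j. (j + 1) * Y ^ j) = 1 / (1 - Y)\<^sup>2\<close>, with its
  boundary terms.\<close>

lemma sum_linear_geometric:
  fixes Y :: real
  shows "(1 - Y)\<^sup>2 * (\<Sum>j\<le>J. real (j + 1) * Y ^ j) = 1 - real (J + 2) * Y ^ (J + 1) + real (J + 1) * Y ^ (J + 2)"
  by (induction J) (simp_all add: algebra_simps power2_eq_square)

lemma harmonic_le: "g \<ge> 1 \<Longrightarrow> (\<Sum>r=1..g. 1 / real r) \<le> 1 + ln (real g)"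
proof (induction g rule: nat_induct_at_least)
  case (Suc g)
  have "ln (real g / real (Suc g)) \<le> real g / real (Suc g) - 1" using Suc.hyps by (intro ln_le_minus_one) simp
  then have "1 / real (Suc g) \<le> ln (real (Suc g)) - ln (real g)"
    using Suc.hyps by (simp add: ln_div field_simps)
  then show ?case using Suc.IH by simp
qed simp

lemma quadratic_le_power: "(real g + 2)\<^sup>2 \<le> 8 * 2 ^ g"
proof (induction g)
  case (Suc g)
  show ?case
  proof (cases "g = 0")
    case False
    then have g: "real g \<ge> 1" by simp
    define y where "y = real g"
    have y: "y \<ge> 1" using g by (simp add: y_def)
    have "2 * (y + 2)\<^sup>2 - (y + 3)\<^sup>2 = y * y + 2 * y - 1" by (simp add: power2_eq_square algebra_simps)
    moreover have "0 \<le> y * y" by simp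
    ultimately have "(y + 3)\<^sup>2 \<le> 2 * (y + 2)\<^sup>2" using y by linarith
    then have "(real (Suc g) + 2)\<^sup>2 \<le> 2 * (real g + 2)\<^sup>2" by (simp add: y_def add.commute add.left_commute)
    also have "\<dots> \<le> 2 * (8 * 2 ^ g)" using Suc by simp
    finally show ?thesis by simp
  qed simp
qed simp

lemma mult_power_half_le:
  fixes q :: real
  assumes "q \<ge> 2"
  shows "real n * q ^ (n div 2) \<le> 2 * q ^ n"
proof -
  have "real n \<le> 2 * real (n - n div 2)" by linarith
  also have "real (n - n div 2) \<le> q ^ (n - n div 2)"
  proof -
    have "real (n - n div 2) \<le> 2 ^ (n - n div 2)" by (metis less_exp less_imp_le of_nat_le_iff of_nat_numeral of_nat_power)
    also have "\<dots> \<le> q ^ (n - n div 2)" using assms by (intro power_mono) auto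
    finally show ?thesis .
  qed
  finally have "real n * q ^ (n div 2) \<le> 2 * q ^ (n - n div 2) * q ^ (n div 2)"
    using assms by (intro mult_right_mono) auto
  also have "\<dots> = 2 * q ^ n" by (simp add: power_add[symmetric])
  finally show ?thesis .
qed

text \<open>The constant 9 makes the induction close: from \<open>g\<close> to \<open>g + 1\<close>
  it needs \<open>9 * (1 + 1 / g)\<^sup>2 \<le> 8 * q\<close>, which for \<open>q = 2\<close> starts
  to hold at \<open>g = 3\<close>; the smaller cases are treated separately.\<close>

lemma sum_power_over_square_le:
  fixes q :: real
  assumes q: "q \<ge> 2" and "g \<ge> 1"
  shows "(\<Sum>r=1..g. q ^ r / (real r)\<^sup>2) \<le> 9 * q ^ g / (real g)\<^sup>2"
proof -
  consider "g = 1" | "g = 2" | "g \<ge> 3" using assms by linarith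
  then show ?thesis
  proof cases
    case 1
    then show ?thesis using q by simp
  next
    case 2
    have "q \<le> 8 * q\<^sup>2 / 4" using q by (simp add: power2_eq_square)
    then show ?thesis using 2 q by (simp add: numeral_2_eq_2)
  next
    case 3
    then show ?thesis
    proof (induction g rule: nat_induct_at_least)
      case base
      have 1: "q \<le> q ^ 3 / 4"
      proof -
        have "2 * 2 \<le> q * q" using q by (intro mult_mono) auto
        then have "4 * q \<le> q * q * q" using q by (intro mult_right_mono) auto
        then show ?thesis by (simp add: power3_eq_cube)
      qed
      have 2: "q ^ 2 \<le> q ^ 3 / 2" using q by (simp add: power3_eq_cube power2_eq_square)
      have "(\<Sum>r=1..3. q ^ r / (real r)\<^sup>2) = q + q ^ 2 / 4 + q ^ 3 / 9" by (simp add: numeral_3_eq_3 numeral_2_eq_2)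
      also have "\<dots> \<le> 9 * q ^ 3 / 9" using 1 2 q by (simp add: field_simps)
      finally show ?case by simp
    next
      case (Suc g)
      have g: "real g \<ge> 3" using Suc.hyps by simp
      have "9 * (real g + 1)\<^sup>2 \<le> 16 * (real g)\<^sup>2"
      proof -
        have "(3 * (real g + 1))\<^sup>2 \<le> (4 * real g)\<^sup>2" using g by (intro power_mono) auto
        then show ?thesis by (simp add: power2_eq_square algebra_simps)
      qed
      then have "1 / (real g)\<^sup>2 \<le> (16 / 9) / (real (Suc g))\<^sup>2"
        using g by (simp add: field_simps)
      then have "9 * q ^ g * (1 / (real g)\<^sup>2) \<le> 9 * q ^ g * ((16 / 9) / (real (Suc g))\<^sup>2)"
        using q by (intro mult_left_mono) auto
      also have "\<dots> = 16 * q ^ g / (real (Suc g))\<^sup>2" by simp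
      also have "\<dots> \<le> 8 * q ^ Suc g / (real (Suc g))\<^sup>2" using q by (intro divide_right_mono) auto
      finally have "9 * q ^ g / (real g)\<^sup>2 \<le> 8 * q ^ Suc g / (real (Suc g))\<^sup>2" by simp
      moreover have "(\<Sum>r=1..Suc g. q ^ r / (real r)\<^sup>2) = (\<Sum>r=1..g. q ^ r / (real r)\<^sup>2) + q ^ Suc g / (real (Suc g))\<^sup>2"
        by simp
      moreover have "9 * q ^ Suc g / (real (Suc g))\<^sup>2 = 8 * q ^ Suc g / (real (Suc g))\<^sup>2 + q ^ Suc g / (real (Suc g))\<^sup>2"
        by (simp add: add_divide_distrib[symmetric])
      ultimately show ?case using Suc.IH by linarith
    qed
  qed
qed

text \<open>Telescoping \<open>q\<^sup>r\<^sup>+\<^sup>1 / r\<close> gives the leading term.\<close>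

lemma sum_power_over_linear:
  fixes q :: real
  assumes q: "q \<ge> 2" and "g \<ge> 1"
  shows "\<bar>(q - 1) * (\<Sum>r=1..g. q ^ r / real r) - q ^ (g + 1) / real g\<bar> \<le> 18 * q ^ g / (real g)\<^sup>2"
proof -
  have "\<bar>(q - 1) * (\<Sum>r=1..g. q ^ r / real r) - q ^ (g + 1) / real g\<bar> \<le> 2 * (\<Sum>r=1..g. q ^ r / (real r)\<^sup>2)"
    using assms(2)
  proof (induction g rule: nat_induct_at_least)
    case base
    have "(q - 1) * q - q ^ 2 = - q" by (simp add: power2_eq_square algebra_simps)
    then show ?case using q by (simp add: numeral_2_eq_2)
  next
    case (Suc g)
    define x where "x = real g"
    have x: "x \<ge> 1" using Suc.hyps by (simp add: x_def)
    have "(q - 1) * (\<Sum>r=1..Suc g. q ^ r / real r) - q ^ (Suc g + 1) / real (Suc g)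
      = ((q - 1) * (\<Sum>r=1..g. q ^ r / real r) - q ^ (g + 1) / real g) + q ^ Suc g / (x * (x + 1))"
    proof -
      have "1 / (x * (x + 1)) = 1 / x - 1 / (x + 1)" using x by (simp add: field_simps)
      then have "q ^ Suc g * (1 / (x * (x + 1))) = q ^ Suc g * (1 / x - 1 / (x + 1))" by simp
      then have "q ^ Suc g / (x * (x + 1)) = q ^ Suc g / x - q ^ Suc g / (x + 1)" by (simp add: right_diff_distrib)
      moreover have "(q - 1) * (A / (x + 1)) - q * A / (x + 1) = - (A / (x + 1))" for A
        by (simp add: left_diff_distrib diff_divide_distrib)
      from this[of "q ^ Suc g"] have "(q - 1) * (q ^ Suc g / (x + 1)) - q ^ (Suc g + 1) / (x + 1) = - (q ^ Suc g / (x + 1))"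
        by simp
      ultimately have "(q - 1) * (q ^ Suc g / (x + 1)) - q ^ (Suc g + 1) / (x + 1) = - (q ^ (g + 1) / x) + q ^ Suc g / (x * (x + 1))"
        by simp
      then show ?thesis by (simp add: x_def algebra_simps)
    qed
    moreover have "\<bar>q ^ Suc g / (x * (x + 1))\<bar> \<le> 2 * (q ^ Suc g / (real (Suc g))\<^sup>2)"
    proof -
      have "(x + 1) * (x + 1) \<le> (2 * x) * (x + 1)" using x by (intro mult_right_mono) auto
      then have "(x + 1)\<^sup>2 \<le> 2 * (x * (x + 1))" by (simp only: power2_eq_square mult.assoc)
      then have "2 / (2 * (x * (x + 1))) \<le> 2 / (x + 1)\<^sup>2" using x by (intro divide_left_mono mult_pos_pos) auto
      then have "1 / (x * (x + 1)) \<le> 2 / (x + 1)\<^sup>2" by simp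
      then have "q ^ Suc g * (1 / (x * (x + 1))) \<le> q ^ Suc g * (2 / (x + 1)\<^sup>2)" using q by (intro mult_left_mono) auto
      then have "q ^ Suc g / (x * (x + 1)) \<le> 2 * (q ^ Suc g / (x + 1)\<^sup>2)" by (simp add: mult.commute)
      moreover have "0 \<le> q ^ Suc g / (x * (x + 1))" using q x by simp
      ultimately show ?thesis by (simp add: x_def add.commute)
    qed
    moreover have "(\<Sum>r=1..Suc g. q ^ r / (real r)\<^sup>2) = (\<Sum>r=1..g. q ^ r / (real r)\<^sup>2) + q ^ Suc g / (real (Suc g))\<^sup>2"
      by simp
    ultimately show ?case using Suc.IH by linarith
  qed
  also have "\<dots> \<le> 2 * (9 * q ^ g / (real g)\<^sup>2)" using sum_power_over_square_le[OF assms] by simp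
  finally show ?thesis by simp
qed

section \<open>Main terms and error terms\<close>

context even_const_field
begin

definition prime_count :: "nat \<Rightarrow> real" where
  "prime_count n = real (card (monic_irreducibles n :: 'a poly set))"

lemma prime_count_le: "n \<ge> 1 \<Longrightarrow> prime_count n \<le> real CARD('a) ^ n / real n"
proof -
  assume n: "n \<ge> 1"
  have "real (n * card (monic_irreducibles n :: 'a poly set)) \<le> real (CARD('a) ^ n)"
    using mult_card_monic_irreducibles_le[OF n, where 'a = 'a] by (rule of_nat_mono)
  then show ?thesis using n by (simp add: prime_count_def field_simps)
qed

lemma prime_count_nonneg: "prime_count n \<ge> 0"
  by (simp add: prime_count_def)

text \<open>What is approximated is the number of fractions \<open>a / P\<close> with nonzero
  \<open>a\<close> and \<open>degree P = n\<close>. Of the constant 5, four come from the primes of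
  degree at most \<open>n div 2\<close> in the lower bound for \<open>prime_count\<close>, and one
  from the excluded \<open>a = 0\<close>.\<close>

lemma prime_count_approx:
  assumes n: "n \<ge> 1"
  shows "\<bar>prime_count n * (real CARD('a) ^ n - 1) - real CARD('a) ^ (2 * n) / real n\<bar> \<le> 5 * real CARD('a) ^ (2 * n) / (real n)\<^sup>2"
proof -
  define x where "x = real n"
  have x: "x \<ge> 1" using n by (simp add: x_def)
  have "real (CARD('a) ^ n) \<le> real (n * card (monic_irreducibles n :: 'a poly set) + 2 * CARD('a) ^ (n div 2))"
    using mult_card_monic_irreducibles_ge[OF n, where 'a = 'a] by (rule of_nat_mono)
  then have "real CARD('a) ^ n - x * prime_count n \<le> 2 * real CARD('a) ^ (n div 2)" by (simp add: prime_count_def x_def)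
  moreover have "x * (2 * real CARD('a) ^ (n div 2)) \<le> 4 * real CARD('a) ^ n" using mult_power_half_le[OF q_ge_2, of n] by (simp add: x_def)
  moreover have "x * (real CARD('a) ^ n - x * prime_count n) \<le> x * (2 * real CARD('a) ^ (n div 2))" using x calculation(1) by (intro mult_left_mono) auto
  ultimately have "x * (real CARD('a) ^ n - x * prime_count n) \<le> 4 * real CARD('a) ^ n" by linarith
  then have "x * (real CARD('a) ^ n - x * prime_count n) / x\<^sup>2 \<le> 4 * real CARD('a) ^ n / x\<^sup>2" by (intro divide_right_mono) auto
  moreover have "x * (real CARD('a) ^ n - x * prime_count n) / x\<^sup>2 = real CARD('a) ^ n / x - prime_count n"
    using x by (simp add: diff_divide_distrib power2_eq_square)
  ultimately have lo: "real CARD('a) ^ n / x - prime_count n \<le> 4 * real CARD('a) ^ n / x\<^sup>2" by simp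
  have hi: "prime_count n \<le> real CARD('a) ^ n / x" using prime_count_le[OF n] by (simp add: x_def)
  have qn: "real CARD('a) ^ (2 * n) = real CARD('a) ^ n * real CARD('a) ^ n" by (simp add: mult_2 power_add)
  have 1: "(real CARD('a) ^ n / x - prime_count n) * real CARD('a) ^ n \<le> 4 * real CARD('a) ^ (2 * n) / x\<^sup>2"
    using mult_right_mono[OF lo, of "real CARD('a) ^ n"] by (simp add: qn)
  have 2: "0 \<le> (real CARD('a) ^ n / x - prime_count n) * real CARD('a) ^ n" using hi by simp
  have 3: "prime_count n \<le> real CARD('a) ^ (2 * n) / x\<^sup>2"
  proof -
    have "x \<le> real CARD('a) ^ n"
    proof -
      have "x \<le> 2 ^ n" unfolding x_def by (metis less_exp less_imp_le of_nat_le_iff of_nat_numeral of_nat_power)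
      also have "\<dots> \<le> real CARD('a) ^ n" using q_ge_2 by (intro power_mono) auto
      finally show ?thesis .
    qed
    then have "real CARD('a) ^ n * x \<le> real CARD('a) ^ n * real CARD('a) ^ n" by (intro mult_left_mono) auto
    then have "real CARD('a) ^ n * x / x\<^sup>2 \<le> real CARD('a) ^ (2 * n) / x\<^sup>2" unfolding qn by (intro divide_right_mono) auto
    moreover have "real CARD('a) ^ n * x / x\<^sup>2 = real CARD('a) ^ n / x" using x by (simp add: power2_eq_square)
    ultimately have "real CARD('a) ^ n / x \<le> real CARD('a) ^ (2 * n) / x\<^sup>2" by simp
    then show ?thesis using hi by linarith
  qed
  have "prime_count n * (real CARD('a) ^ n - 1) - real CARD('a) ^ (2 * n) / x = - ((real CARD('a) ^ n / x - prime_count n) * real CARD('a) ^ n) - prime_count n"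
    unfolding qn by (simp add: left_diff_distrib right_diff_distrib)
  then show ?thesis using 1 2 3 prime_count_nonneg[of n] unfolding x_def[symmetric] by (simp add: abs_le_iff)
qed

text \<open>The number of pairs with square product and total degree \<open>2 * m\<close>, divided
  by \<open>CARD('a) ^ m\<close>, which is exactly what the weight \<open>half ^ (2 * m)\<close>
  takes away.\<close>

definition square_coeff :: "nat \<Rightarrow> real" where
  "square_coeff m = real ((m + 1) * (m + 2)) / 2 - real (m * (m - 1)) / (2 * real CARD('a))"

lemma square_coeff_bounds: "0 \<le> square_coeff m" "square_coeff m \<le> (real m + 2)\<^sup>2"
proof -
  have "real (m * (m - 1)) / (2 * real CARD('a)) \<le> real (m * (m - 1)) / (2 * 1)"
    using q_ge_2 by (intro divide_left_mono) auto
  also have "\<dots> \<le> real ((m + 1) * (m + 2)) / 2"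
  proof -
    have "m * (m - 1) \<le> (m + 1) * (m + 2)" by (intro mult_le_mono) auto
    then have "real (m * (m - 1)) \<le> real ((m + 1) * (m + 2))" by (rule of_nat_mono)
    then show ?thesis by (simp del: of_nat_mult)
  qed
  finally show "0 \<le> square_coeff m" by (simp add: square_coeff_def)
  have "0 \<le> real (m * (m - 1)) / (2 * real CARD('a))" by (intro divide_nonneg_nonneg) auto
  then have "square_coeff m \<le> real ((m + 1) * (m + 2)) / 2" unfolding square_coeff_def by linarith
  also have "\<dots> \<le> (real m + 2)\<^sup>2" by (simp add: power2_eq_square algebra_simps)
  finally show "square_coeff m \<le> (real m + 2)\<^sup>2" .
qed

lemma sum_square_coeff:
  "2 * (\<Sum>m\<le>g. square_coeff m)
    = (real g + 1) * (real g + 2) * (real g + 3) / 3 - (real g + 1) * real g * (real g - 1) / (3 * real CARD('a))"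
proof (induction g)
  case 0
  then show ?case by (simp add: square_coeff_def)
next
  case (Suc g)
  have "real (Suc g * (Suc g - 1)) = (real g + 1) * real g" by (simp add: algebra_simps)
  then have "2 * square_coeff (Suc g) = (real g + 2) * (real g + 3) - (real g + 1) * real g / real CARD('a)"
    by (simp add: square_coeff_def field_simps)
  moreover have "(real g + 1) * (real g + 2) * (real g + 3) / 3 - (real g + 1) * real g * (real g - 1) / (3 * real CARD('a))
     + ((real g + 2) * (real g + 3) - (real g + 1) * real g / real CARD('a))
    = (real (Suc g) + 1) * (real (Suc g) + 2) * (real (Suc g) + 3) / 3 - (real (Suc g) + 1) * real (Suc g) * (real (Suc g) - 1) / (3 * real CARD('a))"
    by (simp add: field_simps)
  ultimately show ?case using Suc.IH by (simp add: distrib_left)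
qed

text \<open>Main terms are wanted in \<open>g\<close> for the family with a polynomial part and in
  \<open>g + 1\<close>, the logarithm of \<open>|P|\<close>, for the others; the difference is
  absorbed in the quadratic error.\<close>

lemma sum_square_coeff_approx:
  assumes "x = real g \<or> x = real g + 1"
  shows "\<bar>2 * (\<Sum>m\<le>g. square_coeff m) - (1 - 1 / real CARD('a)) * x ^ 3 / 3\<bar> \<le> 4 * (real g + 2)\<^sup>2"
proof -
  define y where "y = real g"
  have y: "y \<ge> 0" by (simp add: y_def)
  define A where "A = (y + 1) * (y + 2) * (y + 3) - x ^ 3"
  define C where "C = x ^ 3 - (y + 1) * y * (y - 1)"
  have e: "2 * (\<Sum>m\<le>g. square_coeff m) - (1 - 1 / real CARD('a)) * x ^ 3 / 3 = A / 3 + C / (3 * real CARD('a))"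
    unfolding sum_square_coeff A_def C_def y_def by (simp add: field_simps)
  have yy: "0 \<le> y * y" by simp
  have A: "0 \<le> A" "A \<le> 6 * (y + 2)\<^sup>2" and C: "0 \<le> C" "C \<le> 6 * (y + 2)\<^sup>2"
    using assms y yy unfolding A_def C_def y_def[symmetric]
    by (auto simp: power2_eq_square power3_eq_cube algebra_simps)
  have "C / (3 * real CARD('a)) \<le> C / (3 * 1)" using C q_ge_2 by (intro divide_left_mono) auto
  moreover have "0 \<le> C / (3 * real CARD('a))" using C q_ge_2 by simp
  ultimately show ?thesis unfolding e y_def[symmetric] using A C by simp
qed

lemma card_square_pairs': "real (card (square_pairs (2 * m))) = real CARD('a) ^ m * square_coeff m"
  by (simp add: card_square_pairs square_coeff_def)

lemma half_bounds: "0 < half" "half \<le> 1"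
  using q_ge_2 by (auto simp: half_def)

lemma half_power_even: "half ^ (2 * m) = 1 / real CARD('a) ^ m"
  by (simp add: power_mult power2_eq_square half_square power_divide)

lemma half_mult_q: "half * real CARD('a) = sqrt (real CARD('a))"
  using q_ge_2 by (simp add: half_def real_div_sqrt)

text \<open>All pairs, weighted and with a bound of one each. Because
  \<open>half * q = sqrt q\<close>, the sum is dominated by its last terms.\<close>

lemma sum_half_powers_le: "(\<Sum>n\<le>2 * g. half ^ n * (real (n + 1) * real CARD('a) ^ n)) \<le> 4 * (2 * real g + 1) * real CARD('a) ^ g"
proof -
  have "(\<Sum>n\<le>2 * g. half ^ n * (real (n + 1) * real CARD('a) ^ n)) \<le> (\<Sum>n\<le>2 * g. (2 * real g + 1) * sqrt (real CARD('a)) ^ n)"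
  proof (rule sum_mono)
    fix n assume "n \<in> {..2 * g}"
    then have "real (n + 1) \<le> 2 * real g + 1" by simp
    moreover have "half ^ n * (real (n + 1) * real CARD('a) ^ n) = real (n + 1) * sqrt (real CARD('a)) ^ n"
      by (simp add: half_mult_q[symmetric] power_mult_distrib)
    ultimately show "half ^ n * (real (n + 1) * real CARD('a) ^ n) \<le> (2 * real g + 1) * sqrt (real CARD('a)) ^ n"
      using q_ge_2 by (simp only:) (intro mult_right_mono, auto)
  qed
  also have "\<dots> = (2 * real g + 1) * (\<Sum>n\<le>2 * g. sqrt (real CARD('a)) ^ n)" by (simp add: sum_distrib_left)
  also have "\<dots> \<le> (2 * real g + 1) * (4 * sqrt (real CARD('a)) ^ (2 * g))"
    using q_ge_2 by (intro mult_left_mono sum_powers_le) auto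
  also have "sqrt (real CARD('a)) ^ (2 * g) = real CARD('a) ^ g" by (simp add: power_mult)
  also have "(2 * real g + 1) * (4 * real CARD('a) ^ g) = 4 * (2 * real g + 1) * real CARD('a) ^ g" by simp
  finally show ?thesis .
qed

lemma afe_weight_bounds: "0 \<le> afe_weight g n" "afe_weight g n \<le> 2"
  by (auto simp: afe_weight_def)

text \<open>Odd totals admit no square product, and \<open>square_coeff g\<close> is deducted
  because the weight at \<open>n = 2 * g\<close> is 1 instead of 2.\<close>

lemma sum_afe_square_pairs:
  "(\<Sum>n\<le>2 * g. afe_weight g n * half ^ n * real (card (square_pairs n))) = 2 * (\<Sum>m\<le>g. square_coeff m) - square_coeff g"
proof -
  have "(\<Sum>n\<le>2 * g. afe_weight g n * half ^ n * real (card (square_pairs n)))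
    = (\<Sum>m\<le>g. afe_weight g (2 * m) * half ^ (2 * m) * real (card (square_pairs (2 * m))))"
    by (rule sum_even_terms) (simp add: square_pairs_odd)
  also have "\<dots> = (\<Sum>m\<le>g. afe_weight g (2 * m) * square_coeff m)"
    using q_ge_2 by (intro sum.cong) (auto simp: half_power_even card_square_pairs')
  also have "\<dots> = (\<Sum>m\<le>g. 2 * square_coeff m - (if m = g then square_coeff g else 0))"
    by (intro sum.cong) (auto simp: afe_weight_def)
  also have "\<dots> = 2 * (\<Sum>m\<le>g. square_coeff m) - square_coeff g"
    by (simp add: sum_subtractf sum_distrib_left)
  finally show ?thesis .
qed

text \<open>Apart from \<open>q ^ r\<close> the sum is only cubic in \<open>g\<close>, but bounding
  \<open>(g + 2)\<^sup>2\<close> by \<open>8 * q ^ g\<close> gives it the shape of the error from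
  nonsquare products, with which it is merged once multiplied by the \<open>q ^ r - 1\<close> values
  of \<open>a\<close>.\<close>

lemma sum_half_square_pairs_dvd_le:
  assumes P: "monic_irreducible P" "degree P = r"
  shows "(\<Sum>n\<le>2 * g. half ^ n * real (card {(e, f) \<in> square_pairs n. P dvd e * f})) \<le> 12 * (real g + 2) * real CARD('a) ^ g / real CARD('a) ^ r"
proof -
  have "(\<Sum>n\<le>2 * g. half ^ n * real (card {(e, f) \<in> square_pairs n. P dvd e * f}))
    = (\<Sum>m\<le>g. half ^ (2 * m) * real (card {(e, f) \<in> square_pairs (2 * m). P dvd e * f}))"
    by (rule sum_even_terms) (simp add: square_pairs_odd)
  also have "\<dots> \<le> (\<Sum>m\<le>g. 3 / 2 * (real g + 2)\<^sup>2 / real CARD('a) ^ r)"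
  proof (rule sum_mono)
    fix m assume m: "m \<in> {..g}"
    have "half ^ (2 * m) * real (card {(e, f) \<in> square_pairs (2 * m). P dvd e * f})
      \<le> half ^ (2 * m) * (3 * (real ((m + 1) * (m + 2)) / 2 * real CARD('a) ^ m / real CARD('a) ^ degree P))"
      by (intro mult_left_mono card_square_pairs_dvd P) (use half_bounds in auto)
    also have "\<dots> = 3 / 2 * real ((m + 1) * (m + 2)) / real CARD('a) ^ r"
      using q_ge_2 P by (simp add: half_power_even)
    also have "\<dots> \<le> 3 / 2 * (real g + 2)\<^sup>2 / real CARD('a) ^ r"
    proof -
      have "(real m + 1) * (real m + 2) \<le> (real g + 2) * (real g + 2)" using m by (intro mult_mono) auto
      then show ?thesis using q_ge_2 by (intro divide_right_mono) (auto simp: power2_eq_square algebra_simps)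
    qed
    finally show "half ^ (2 * m) * real (card {(e, f) \<in> square_pairs (2 * m). P dvd e * f}) \<le> 3 / 2 * (real g + 2)\<^sup>2 / real CARD('a) ^ r" .
  qed
  also have "\<dots> = (3 / 2 * (real g + 1)) * (real g + 2)\<^sup>2 / real CARD('a) ^ r" by simp
  also have "\<dots> \<le> (3 / 2 * (real g + 2)) * (8 * real CARD('a) ^ g) / real CARD('a) ^ r"
  proof -
    have "(real g + 2)\<^sup>2 \<le> 8 * real CARD('a) ^ g"
      using quadratic_le_power[of g] power_mono[OF q_ge_2, of g] by simp
    then show ?thesis using q_ge_2 by (intro divide_right_mono mult_mono) auto
  qed
  also have "(3 / 2 * (real g + 2)) * (8 * real CARD('a) ^ g) = 12 * (real g + 2) * real CARD('a) ^ g" by simp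
  finally show ?thesis .
qed

text \<open>Error bookkeeping common to the families: \<open>T\<close> collects averaged
  coefficients, \<open>X\<close> counts square pairs, \<open>D\<close> the exceptional ones
  divisible by \<open>P\<close>, and \<open>E\<close> bounds the nonsquare pairs. The factor 2 is
  the largest value of \<open>afe_weight\<close>.\<close>

lemma abs_diff_sum_le:
  fixes T X D :: "nat \<Rightarrow> real"
  assumes "\<And>n. n \<le> N \<Longrightarrow> \<bar>T n - K * (X n - D n)\<bar> \<le> E n" "\<And>n. 0 \<le> D n" "0 \<le> K" "\<And>n. \<bar>w n\<bar> \<le> 2 * v n"
  shows "\<bar>(\<Sum>n\<le>N. w n * T n) - K * (\<Sum>n\<le>N. w n * X n)\<bar> \<le> 2 * (\<Sum>n\<le>N. v n * E n) + 2 * K * (\<Sum>n\<le>N. v n * D n)"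
proof -
  have "(\<Sum>n\<le>N. w n * T n) - K * (\<Sum>n\<le>N. w n * X n) = (\<Sum>n\<le>N. w n * (T n - K * (X n - D n)) - K * (w n * D n))"
    by (simp add: sum_distrib_left sum_subtractf[symmetric] algebra_simps)
  also have "\<bar>\<dots>\<bar> \<le> (\<Sum>n\<le>N. \<bar>w n * (T n - K * (X n - D n)) - K * (w n * D n)\<bar>)" by (rule sum_abs)
  also have "\<dots> \<le> (\<Sum>n\<le>N. 2 * (v n * E n) + 2 * K * (v n * D n))"
  proof (rule sum_mono)
    fix n assume n: "n \<in> {..N}"
    have "\<bar>w n * (T n - K * (X n - D n)) - K * (w n * D n)\<bar> \<le> \<bar>w n\<bar> * \<bar>T n - K * (X n - D n)\<bar> + K * (\<bar>w n\<bar> * D n)"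
      using assms(2)[of n] assms(3) by (intro order.trans[OF abs_triangle_ineq4]) (simp add: abs_mult)
    also have "\<dots> \<le> (2 * v n) * E n + K * ((2 * v n) * D n)"
      using assms(1)[of n] assms(2,4)[of n] assms(3) n by (intro add_mono mult_mono mult_left_mono) auto
    finally show "\<bar>w n * (T n - K * (X n - D n)) - K * (w n * D n)\<bar> \<le> 2 * (v n * E n) + 2 * K * (v n * D n)"
      by (simp add: mult_ac)
  qed
  finally show ?thesis by (simp add: sum.distrib sum_distrib_left)
qed

text \<open>The first term of the bound covers nonsquare products and square ones divisible by
  \<open>P\<close>, together \<open>40 * g + 56\<close>, rounded up. The second comes from replacing
  the count of square pairs by its leading term; its 5 is the 4 of
  \<open>sum_square_coeff_approx\<close> plus one for \<open>square_coeff g\<close>.\<close>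

lemma second_moment_ramified:
  assumes P: "monic_irreducible P" "degree P = r" and s: "s \<ge> 1" "r + s = Suc g"
  shows "\<bar>(\<Sum>a\<in>lowdeg r - {0}. \<Sum>F\<in>G_deg \<xi> s. (L_poly (a + F * P) P (2 * g) half)\<^sup>2)
      - (real CARD('a) ^ r - 1) * real (card (G_deg \<xi> s)) * ((1 - 1 / real CARD('a)) * real g ^ 3 / 3)\<bar>
    \<le> real (card (G_deg \<xi> s)) * (64 * (real g + 1) * real CARD('a) ^ g + 5 * (real g + 2)\<^sup>2 * real CARD('a) ^ r)"
proof -
  define G where "G = real (card (G_deg \<xi> s))"
  define K where "K = (real CARD('a) ^ r - 1) * G"
  define T where "T n = (\<Sum>a\<in>lowdeg r - {0}. \<Sum>F\<in>G_deg \<xi> s. bcoeff (a + F * P) P n)" for n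
  define X where "X n = real (card (square_pairs n))" for n
  define D where "D n = real (card {(e, f) \<in> square_pairs n. P dvd e * f})" for n
  define Z where "Z = (1 - 1 / real CARD('a)) * real g ^ 3 / 3"
  have qr: "real CARD('a) ^ r \<ge> 1" using q_ge_2 by simp
  have G0: "G \<ge> 0" by (simp add: G_def)
  have K: "0 \<le> K" "K \<le> real CARD('a) ^ r * G" using qr G0 by (auto simp: K_def mult_right_mono)
  have "(\<Sum>a\<in>lowdeg r - {0}. \<Sum>F\<in>G_deg \<xi> s. (L_poly (a + F * P) P (2 * g) half)\<^sup>2)
    = (\<Sum>a\<in>lowdeg r - {0}. \<Sum>F\<in>G_deg \<xi> s. \<Sum>n\<le>2 * g. afe_weight g n * half ^ n * bcoeff (a + F * P) P n)"
    using assms by (intro sum.cong refl L_poly_ramified_square) auto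
  also have "\<dots> = (\<Sum>a\<in>lowdeg r - {0}. \<Sum>n\<le>2 * g. \<Sum>F\<in>G_deg \<xi> s. afe_weight g n * half ^ n * bcoeff (a + F * P) P n)"
    by (intro sum.cong refl sum.swap)
  also have "\<dots> = (\<Sum>n\<le>2 * g. \<Sum>a\<in>lowdeg r - {0}. \<Sum>F\<in>G_deg \<xi> s. afe_weight g n * half ^ n * bcoeff (a + F * P) P n)"
    by (rule sum.swap)
  also have "\<dots> = (\<Sum>n\<le>2 * g. (afe_weight g n * half ^ n) * T n)"
    by (simp add: T_def sum_distrib_left)
  finally have M: "(\<Sum>a\<in>lowdeg r - {0}. \<Sum>F\<in>G_deg \<xi> s. (L_poly (a + F * P) P (2 * g) half)\<^sup>2)
    = (\<Sum>n\<le>2 * g. (afe_weight g n * half ^ n) * T n)" .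
  have "\<bar>(\<Sum>n\<le>2 * g. (afe_weight g n * half ^ n) * T n) - K * (\<Sum>n\<le>2 * g. (afe_weight g n * half ^ n) * X n)\<bar>
    \<le> 2 * (\<Sum>n\<le>2 * g. half ^ n * (G * (real (n + 1) * real CARD('a) ^ n))) + 2 * K * (\<Sum>n\<le>2 * g. half ^ n * D n)"
  proof (rule abs_diff_sum_le)
    fix n assume "n \<le> 2 * g"
    then have "n < 2 * (r + s)" using s by simp
    then show "\<bar>T n - K * (X n - D n)\<bar> \<le> G * (real (n + 1) * real CARD('a) ^ n)"
      unfolding T_def K_def X_def D_def G_def using P by (intro sum_bcoeff_ramified)
  next
    fix n show "\<bar>afe_weight g n * half ^ n\<bar> \<le> 2 * half ^ n"
      using afe_weight_bounds[of g n] half_bounds by (simp add: abs_mult)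
  qed (use K in \<open>auto simp: D_def\<close>)
  also have "(\<Sum>n\<le>2 * g. half ^ n * (G * (real (n + 1) * real CARD('a) ^ n))) = G * (\<Sum>n\<le>2 * g. half ^ n * (real (n + 1) * real CARD('a) ^ n))"
    by (simp add: sum_distrib_left mult_ac)
  also have "2 * \<dots> + 2 * K * (\<Sum>n\<le>2 * g. half ^ n * D n)
    \<le> 2 * (G * (4 * (2 * real g + 1) * real CARD('a) ^ g)) + 2 * (real CARD('a) ^ r * G) * (12 * (real g + 2) * real CARD('a) ^ g / real CARD('a) ^ r)"
    using K G0 sum_half_powers_le[of g] sum_half_square_pairs_dvd_le[OF P, of g] half_bounds
    by (intro add_mono mult_left_mono mult_mono) (auto simp: D_def intro!: sum_nonneg)
  also have "\<dots> = G * ((40 * real g + 56) * real CARD('a) ^ g)"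
  proof -
    have "2 * (real CARD('a) ^ r * G) * (12 * (real g + 2) * real CARD('a) ^ g / real CARD('a) ^ r) = 24 * G * (real g + 2) * real CARD('a) ^ g * (real CARD('a) ^ r / real CARD('a) ^ r)"
      by simp
    also have "\<dots> = 24 * G * (real g + 2) * real CARD('a) ^ g" using q_ge_2 by simp
    finally show ?thesis by (simp add: algebra_simps)
  qed
  also have "\<dots> \<le> G * (64 * (real g + 1) * real CARD('a) ^ g)" using G0 by (intro mult_left_mono mult_right_mono) auto
  finally have 1: "\<bar>(\<Sum>n\<le>2 * g. (afe_weight g n * half ^ n) * T n) - K * (\<Sum>n\<le>2 * g. (afe_weight g n * half ^ n) * X n)\<bar>
    \<le> G * (64 * (real g + 1) * real CARD('a) ^ g)" .
  have "\<bar>(\<Sum>n\<le>2 * g. (afe_weight g n * half ^ n) * X n) - Z\<bar> \<le> 5 * (real g + 2)\<^sup>2"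
    unfolding X_def sum_afe_square_pairs Z_def
    using sum_square_coeff_approx[of "real g" g] square_coeff_bounds[of g] by (simp add: abs_le_iff)
  then have "\<bar>K * (\<Sum>n\<le>2 * g. (afe_weight g n * half ^ n) * X n) - K * Z\<bar> \<le> K * (5 * (real g + 2)\<^sup>2)"
    using K(1) by (simp add: right_diff_distrib[symmetric] abs_mult mult_left_mono)
  also have "\<dots> \<le> (real CARD('a) ^ r * G) * (5 * (real g + 2)\<^sup>2)" using K by (intro mult_right_mono) auto
  finally have 2: "\<bar>K * (\<Sum>n\<le>2 * g. (afe_weight g n * half ^ n) * X n) - K * Z\<bar> \<le> (real CARD('a) ^ r * G) * (5 * (real g + 2)\<^sup>2)" .
  have "\<bar>(\<Sum>n\<le>2 * g. (afe_weight g n * half ^ n) * T n) - K * Z\<bar> \<le> G * (64 * (real g + 1) * real CARD('a) ^ g) + (real CARD('a) ^ r * G) * (5 * (real g + 2)\<^sup>2)"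
    using 1 2 by linarith
  then show ?thesis unfolding M G_def[symmetric] K_def[symmetric] Z_def[symmetric] by (simp add: algebra_simps)
qed

definition split_main :: "nat \<Rightarrow> real \<Rightarrow> real" where
  "split_main g Y = (1 - Y)\<^sup>2 * (\<Sum>n\<le>2 * g. afe_weight g n * Y ^ n * (\<Sum>k\<le>n. real (n - k + 1) * real (card (square_pairs k))))"

text \<open>Collected by their total degree \<open>k\<close>, the square pairs are multiplied by
  \<open>(1 - Y)\<^sup>2\<close> times a truncation of
  \<open>2 * (\<Sum>j. (j + 1) * Y ^ j)\<close>, which tends to 2 as \<open>2 * g - k\<close> grows.
  So the trivial factor cancels and both signs of \<open>Y\<close> have the same main term; the
  deviation decays geometrically, hence the error is only quadratic.\<close>

lemma split_main_approx:
  assumes Y: "\<bar>Y\<bar> = half"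
  shows "\<bar>split_main g Y - 2 * (\<Sum>m\<le>g. square_coeff m)\<bar> \<le> 64 * (real g + 2)\<^sup>2"
proof -
  have YY: "Y * Y = 1 / real CARD('a)" using Y half_square by (metis abs_mult_self_eq)
  have Ye: "Y ^ (2 * m) = 1 / real CARD('a) ^ m" for m by (simp add: power_mult power2_eq_square YY power_divide)
  have Y1: "\<bar>Y\<bar> \<le> 1" using Y half_bounds by simp
  \<comment> \<open>The factor belonging to the remaining degree \<open>J = 2 * g - k\<close>: the
    closed form of \<open>sum_linear_geometric\<close> with weight 2, minus one copy of the last
    term, whose weight is 1.\<close>
  define V where "V J = 2 * (1 - real (J + 2) * Y ^ (J + 1) + real (J + 1) * Y ^ (J + 2)) - (1 - Y)\<^sup>2 * (real (J + 1) * Y ^ J)" for J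
  have Y4: "(1 - Y)\<^sup>2 \<le> 4"
  proof -
    have "\<bar>1 - Y\<bar> \<le> 2" using Y1 by linarith
    then have "\<bar>1 - Y\<bar>\<^sup>2 \<le> 2\<^sup>2" by (intro power_mono) auto
    then show ?thesis by simp
  qed
  have "split_main g Y = (1 - Y)\<^sup>2 * (\<Sum>n\<le>2 * g. \<Sum>k\<le>n. real (card (square_pairs k)) * Y ^ k * (afe_weight g (k + (n - k)) * (real ((n - k) + 1) * Y ^ (n - k))))"
    unfolding split_main_def
  proof (intro arg_cong[where f = "\<lambda>x. (1 - Y)\<^sup>2 * x"] sum.cong refl)
    fix n
    show "afe_weight g n * Y ^ n * (\<Sum>k\<le>n. real (n - k + 1) * real (card (square_pairs k)))
      = (\<Sum>k\<le>n. real (card (square_pairs k)) * Y ^ k * (afe_weight g (k + (n - k)) * (real ((n - k) + 1) * Y ^ (n - k))))"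
      unfolding sum_distrib_left
    proof (rule sum.cong[OF refl])
      fix k assume "k \<in> {..n}"
      then have "Y ^ n = Y ^ k * Y ^ (n - k)" "k + (n - k) = n" by (simp_all add: power_add[symmetric])
      then show "afe_weight g n * Y ^ n * (real (n - k + 1) * real (card (square_pairs k)))
        = real (card (square_pairs k)) * Y ^ k * (afe_weight g (k + (n - k)) * (real ((n - k) + 1) * Y ^ (n - k)))"
        by (simp only: mult_ac)
    qed
  qed
  also have "\<dots> = (1 - Y)\<^sup>2 * (\<Sum>k\<le>2 * g. \<Sum>j\<le>2 * g - k. real (card (square_pairs k)) * Y ^ k * (afe_weight g (k + j) * (real (j + 1) * Y ^ j)))"
    by (simp only: sum_triangle_swap[of "\<lambda>k j. real (card (square_pairs k)) * Y ^ k * (afe_weight g (k + j) * (real (j + 1) * Y ^ j))"])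
  also have "\<dots> = (\<Sum>k\<le>2 * g. (1 - Y)\<^sup>2 * (\<Sum>j\<le>2 * g - k. real (card (square_pairs k)) * Y ^ k * (afe_weight g (k + j) * (real (j + 1) * Y ^ j))))"
    by (rule sum_distrib_left)
  also have "\<dots> = (\<Sum>k\<le>2 * g. real (card (square_pairs k)) * Y ^ k * V (2 * g - k))"
  proof (rule sum.cong[OF refl])
    fix k assume k: "k \<in> {..2 * g}"
    define J where "J = 2 * g - k"
    have "(\<Sum>j\<le>J. afe_weight g (k + j) * (real (j + 1) * Y ^ j)) = (\<Sum>j\<le>J. 2 * (real (j + 1) * Y ^ j) - (if j = J then real (J + 1) * Y ^ J else 0))"
      using k by (intro sum.cong) (auto simp: afe_weight_def J_def)
    also have "\<dots> = 2 * (\<Sum>j\<le>J. real (j + 1) * Y ^ j) - real (J + 1) * Y ^ J"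
      by (simp add: sum_subtractf sum_distrib_left)
    finally have "(1 - Y)\<^sup>2 * (\<Sum>j\<le>J. afe_weight g (k + j) * (real (j + 1) * Y ^ j))
      = 2 * ((1 - Y)\<^sup>2 * (\<Sum>j\<le>J. real (j + 1) * Y ^ j)) - (1 - Y)\<^sup>2 * (real (J + 1) * Y ^ J)"
      by (simp only: right_diff_distrib mult.left_commute)
    then have V: "(1 - Y)\<^sup>2 * (\<Sum>j\<le>J. afe_weight g (k + j) * (real (j + 1) * Y ^ j)) = V J"
      unfolding sum_linear_geometric V_def .
    have "(1 - Y)\<^sup>2 * (\<Sum>j\<le>J. real (card (square_pairs k)) * Y ^ k * (afe_weight g (k + j) * (real (j + 1) * Y ^ j)))
      = real (card (square_pairs k)) * Y ^ k * ((1 - Y)\<^sup>2 * (\<Sum>j\<le>J. afe_weight g (k + j) * (real (j + 1) * Y ^ j)))"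
      by (simp only: sum_distrib_left mult_ac)
    then show "(1 - Y)\<^sup>2 * (\<Sum>j\<le>2 * g - k. real (card (square_pairs k)) * Y ^ k * (afe_weight g (k + j) * (real (j + 1) * Y ^ j)))
      = real (card (square_pairs k)) * Y ^ k * V (2 * g - k)"
      unfolding V J_def[symmetric] .
  qed
  also have "\<dots> = (\<Sum>m\<le>g. real (card (square_pairs (2 * m))) * Y ^ (2 * m) * V (2 * g - 2 * m))"
    by (rule sum_even_terms) (simp add: square_pairs_odd)
  also have "\<dots> = (\<Sum>m\<le>g. square_coeff m * V (2 * (g - m)))"
    using q_ge_2 by (intro sum.cong refl) (simp add: card_square_pairs' Ye right_diff_distrib' diff_mult_distrib2)
  finally have main: "split_main g Y = (\<Sum>m\<le>g. square_coeff m * V (2 * (g - m)))" .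
  have V2: "\<bar>V (2 * i) - 2\<bar> \<le> 16 * real (i + 1) * (1 / 2) ^ i" for i
  proof -
    define J where "J = 2 * i"
    define y where "y = \<bar>Y\<bar> ^ J"
    have y0: "0 \<le> y" by (simp add: y_def)
    have y1: "\<bar>Y ^ (J + 1)\<bar> \<le> y" "\<bar>Y ^ (J + 2)\<bar> \<le> y" "\<bar>Y ^ J\<bar> = y"
    proof -
      have "\<bar>Y\<bar> ^ (J + 1) \<le> \<bar>Y\<bar> ^ J" by (rule power_decreasing) (use Y1 in auto)
      then show "\<bar>Y ^ (J + 1)\<bar> \<le> y" by (simp only: y_def power_abs)
      have "\<bar>Y\<bar> ^ (J + 2) \<le> \<bar>Y\<bar> ^ J" by (rule power_decreasing) (use Y1 in auto)
      then show "\<bar>Y ^ (J + 2)\<bar> \<le> y" by (simp only: y_def power_abs)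
    qed (simp add: y_def power_abs)
    have "V J - 2 = 2 * (real (J + 1) * Y ^ (J + 2)) - 2 * (real (J + 2) * Y ^ (J + 1)) - (1 - Y)\<^sup>2 * (real (J + 1) * Y ^ J)"
      by (simp add: V_def)
    also have "\<bar>\<dots>\<bar> \<le> 2 * (real (J + 1) * y) + 2 * (real (J + 2) * y) + 4 * (real (J + 1) * y)"
    proof -
      have "\<bar>real (J + 1) * Y ^ (J + 2)\<bar> \<le> real (J + 1) * y" "\<bar>real (J + 2) * Y ^ (J + 1)\<bar> \<le> real (J + 2) * y"
        using y1 by (simp_all only: abs_mult abs_of_nat mult_left_mono of_nat_0_le_iff)
      moreover have "\<bar>(1 - Y)\<^sup>2 * (real (J + 1) * Y ^ J)\<bar> \<le> 4 * (real (J + 1) * y)"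
        unfolding abs_mult using Y4 y1 y0 by (intro mult_mono) auto
      ultimately show ?thesis by linarith
    qed
    also have "\<dots> \<le> 16 * real (i + 1) * y" using y0 by (simp add: J_def algebra_simps)
    also have "\<dots> \<le> 16 * real (i + 1) * (1 / 2) ^ i"
    proof -
      have "y = (1 / real CARD('a)) ^ i" using Ye[of i] by (simp add: y_def J_def power_abs[symmetric] power_divide)
      also have "\<dots> \<le> (1 / 2) ^ i" using q_ge_2 by (intro power_mono) (auto simp: field_simps)
      finally show ?thesis by (intro mult_left_mono) auto
    qed
    finally show ?thesis by (simp add: J_def)
  qed
  have "split_main g Y - 2 * (\<Sum>m\<le>g. square_coeff m) = (\<Sum>m\<le>g. square_coeff m * (V (2 * (g - m)) - 2))"
    unfolding main by (simp add: sum_distrib_left sum_subtractf[symmetric] algebra_simps)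
  also have "\<bar>\<dots>\<bar> \<le> (\<Sum>m\<le>g. \<bar>square_coeff m * (V (2 * (g - m)) - 2)\<bar>)" by (rule sum_abs)
  also have "\<dots> \<le> (\<Sum>m\<le>g. (real g + 2)\<^sup>2 * (16 * (real (g - m + 1) * 2 ^ m / 2 ^ g)))"
  proof (rule sum_mono)
    fix m assume m: "m \<in> {..g}"
    have "square_coeff m \<le> (real g + 2)\<^sup>2"
    proof -
      have "(real m + 2)\<^sup>2 \<le> (real g + 2)\<^sup>2" using m by (intro power_mono) auto
      then show ?thesis using square_coeff_bounds(2)[of m] by linarith
    qed
    moreover have "(1 / 2 :: real) ^ (g - m) = 2 ^ m / 2 ^ g"
    proof -
      have "(2::real) ^ g = 2 ^ (g - m) * 2 ^ m" using m by (simp add: power_add[symmetric])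
      then show ?thesis by (simp add: power_divide)
    qed
    then have "\<bar>V (2 * (g - m)) - 2\<bar> \<le> 16 * (real (g - m + 1) * 2 ^ m / 2 ^ g)" using V2[of "g - m"] by (simp add: mult_ac)
    ultimately show "\<bar>square_coeff m * (V (2 * (g - m)) - 2)\<bar> \<le> (real g + 2)\<^sup>2 * (16 * (real (g - m + 1) * 2 ^ m / 2 ^ g))"
      unfolding abs_mult using square_coeff_bounds(1)[of m] by (intro mult_mono) auto
  qed
  also have "\<dots> = (real g + 2)\<^sup>2 * (16 * ((\<Sum>m\<le>g. real (g - m + 1) * 2 ^ m) / 2 ^ g))"
    by (simp only: sum_distrib_left sum_divide_distrib)
  also have "\<dots> \<le> (real g + 2)\<^sup>2 * (16 * (4 * 2 ^ g / 2 ^ g))"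
    using sum_linear_powers_le[of 2 g] by (intro mult_left_mono divide_right_mono) auto
  finally show ?thesis by simp
qed

text \<open>The constant 128 is made of 4 from \<open>(1 - Y)\<^sup>2\<close>, 4 from the partial
  sums via \<open>sum_linear_powers_le\<close>, 4 from \<open>sum_half_powers_le\<close> and the
  largest weight 2. The 68 adds the 64 of \<open>split_main_approx\<close> and the 4 of
  \<open>sum_square_coeff_approx\<close>.\<close>

lemma second_moment_split:
  assumes P: "monic_irreducible P" "degree P = Suc g" and Y: "\<bar>Y\<bar> = half"
  shows "\<bar>(\<Sum>a\<in>lowdeg (Suc g) - {0}. (L_poly a P (Suc (2 * g)) Y)\<^sup>2) - (real CARD('a) ^ Suc g - 1) * ((1 - 1 / real CARD('a)) * (real g + 1) ^ 3 / 3)\<bar>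
    \<le> 128 * (2 * real g + 1) * real CARD('a) ^ g + 68 * (real g + 2)\<^sup>2 * real CARD('a) ^ Suc g"
proof -
  define K where "K = real CARD('a) ^ Suc g - 1"
  define T where "T k = (\<Sum>a\<in>lowdeg (Suc g) - {0}. bcoeff a P k)" for k
  define X where "X k = real (card (square_pairs k))" for k
  have YY: "Y * Y = 1 / real CARD('a)" using Y half_square by (metis abs_mult_self_eq)
  have Y1: "\<bar>Y\<bar> \<le> 1" using Y half_bounds by simp
  have Y4: "(1 - Y)\<^sup>2 \<le> 4"
  proof -
    have "\<bar>1 - Y\<bar> \<le> 2" using Y1 by linarith
    then have "\<bar>1 - Y\<bar>\<^sup>2 \<le> 2\<^sup>2" by (intro power_mono) auto
    then show ?thesis by simp
  qed
  have "real CARD('a) ^ Suc g \<ge> 1" using q_ge_2 by (intro one_le_power) simp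
  then have K: "0 \<le> K" "K \<le> real CARD('a) ^ Suc g" by (auto simp: K_def)
  have "(\<Sum>a\<in>lowdeg (Suc g) - {0}. (L_poly a P (Suc (2 * g)) Y)\<^sup>2)
    = (\<Sum>a\<in>lowdeg (Suc g) - {0}. (1 - Y)\<^sup>2 * (\<Sum>n\<le>2 * g. afe_weight g n * Y ^ n * (\<Sum>k\<le>n. real (n - k + 1) * bcoeff a P k)))"
    using P YY by (intro sum.cong refl L_poly_split_square) auto
  also have "\<dots> = (1 - Y)\<^sup>2 * (\<Sum>n\<le>2 * g. \<Sum>a\<in>lowdeg (Suc g) - {0}. afe_weight g n * Y ^ n * (\<Sum>k\<le>n. real (n - k + 1) * bcoeff a P k))"
    by (subst sum.swap) (simp add: sum_distrib_left)
  also have "\<dots> = (1 - Y)\<^sup>2 * (\<Sum>n\<le>2 * g. afe_weight g n * Y ^ n * (\<Sum>k\<le>n. real (n - k + 1) * T k))"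
  proof (intro arg_cong[where f = "\<lambda>x. (1 - Y)\<^sup>2 * x"] sum.cong refl)
    fix n
    have "(\<Sum>a\<in>lowdeg (Suc g) - {0}. \<Sum>k\<le>n. real (n - k + 1) * bcoeff a P k) = (\<Sum>k\<le>n. real (n - k + 1) * T k)"
      by (subst sum.swap) (simp add: T_def sum_distrib_left)
    then show "(\<Sum>a\<in>lowdeg (Suc g) - {0}. afe_weight g n * Y ^ n * (\<Sum>k\<le>n. real (n - k + 1) * bcoeff a P k))
      = afe_weight g n * Y ^ n * (\<Sum>k\<le>n. real (n - k + 1) * T k)"
      by (simp add: sum_distrib_left[symmetric])
  qed
  finally have M: "(\<Sum>a\<in>lowdeg (Suc g) - {0}. (L_poly a P (Suc (2 * g)) Y)\<^sup>2)
    = (1 - Y)\<^sup>2 * (\<Sum>n\<le>2 * g. afe_weight g n * Y ^ n * (\<Sum>k\<le>n. real (n - k + 1) * T k))" .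
  have "\<bar>(\<Sum>n\<le>2 * g. (afe_weight g n * Y ^ n) * (\<Sum>k\<le>n. real (n - k + 1) * T k))
      - K * (\<Sum>n\<le>2 * g. (afe_weight g n * Y ^ n) * (\<Sum>k\<le>n. real (n - k + 1) * X k))\<bar>
    \<le> 2 * (\<Sum>n\<le>2 * g. half ^ n * (4 * (real (n + 1) * real CARD('a) ^ n))) + 2 * K * (\<Sum>n\<le>2 * g. half ^ n * 0)"
  proof (rule abs_diff_sum_le)
    fix n assume n: "n \<le> 2 * g"
    have "(\<Sum>k\<le>n. real (n - k + 1) * T k) - K * ((\<Sum>k\<le>n. real (n - k + 1) * X k) - 0)
      = (\<Sum>k\<le>n. real (n - k + 1) * (T k - K * X k))"
      by (simp add: sum_distrib_left sum_subtractf[symmetric] algebra_simps)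
    also have "\<bar>\<dots>\<bar> \<le> (\<Sum>k\<le>n. \<bar>real (n - k + 1) * (T k - K * X k)\<bar>)" by (rule sum_abs)
    also have "\<dots> \<le> (\<Sum>k\<le>n. real (n + 1) * (real (n - k + 1) * real CARD('a) ^ k))"
    proof (rule sum_mono)
      fix k assume k: "k \<in> {..n}"
      have "\<bar>T k - K * X k\<bar> \<le> real (k + 1) * real CARD('a) ^ k"
        unfolding T_def K_def X_def using P k n by (intro sum_bcoeff_split) auto
      also have "\<dots> \<le> real (n + 1) * real CARD('a) ^ k" using k by (intro mult_right_mono) auto
      finally have "real (n - k + 1) * \<bar>T k - K * X k\<bar> \<le> real (n - k + 1) * (real (n + 1) * real CARD('a) ^ k)"
        by (intro mult_left_mono) auto
      then show "\<bar>real (n - k + 1) * (T k - K * X k)\<bar> \<le> real (n + 1) * (real (n - k + 1) * real CARD('a) ^ k)"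
        by (simp only: abs_mult abs_of_nat mult.left_commute)
    qed
    also have "\<dots> = real (n + 1) * (\<Sum>k\<le>n. real (n - k + 1) * real CARD('a) ^ k)" by (simp only: sum_distrib_left)
    also have "\<dots> \<le> real (n + 1) * (4 * real CARD('a) ^ n)" using sum_linear_powers_le[OF q_ge_2] by (intro mult_left_mono) auto
    finally show "\<bar>(\<Sum>k\<le>n. real (n - k + 1) * T k) - K * ((\<Sum>k\<le>n. real (n - k + 1) * X k) - 0)\<bar> \<le> 4 * (real (n + 1) * real CARD('a) ^ n)"
      by simp
  next
    fix n show "\<bar>afe_weight g n * Y ^ n\<bar> \<le> 2 * half ^ n"
      using afe_weight_bounds[of g n] half_bounds by (simp add: abs_mult power_abs Y)
  qed (use K in auto)
  also have "\<dots> = 8 * (\<Sum>n\<le>2 * g. half ^ n * (real (n + 1) * real CARD('a) ^ n))"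
    by (simp add: sum_distrib_left mult_ac)
  also have "\<dots> \<le> 8 * (4 * (2 * real g + 1) * real CARD('a) ^ g)" using sum_half_powers_le[of g] by (intro mult_left_mono) auto
  also have "\<dots> = 32 * (2 * real g + 1) * real CARD('a) ^ g" by simp
  finally have "\<bar>(\<Sum>n\<le>2 * g. (afe_weight g n * Y ^ n) * (\<Sum>k\<le>n. real (n - k + 1) * T k))
      - K * (\<Sum>n\<le>2 * g. (afe_weight g n * Y ^ n) * (\<Sum>k\<le>n. real (n - k + 1) * X k))\<bar> \<le> 32 * (2 * real g + 1) * real CARD('a) ^ g" .
  then have "(1 - Y)\<^sup>2 * \<bar>(\<Sum>n\<le>2 * g. (afe_weight g n * Y ^ n) * (\<Sum>k\<le>n. real (n - k + 1) * T k))
      - K * (\<Sum>n\<le>2 * g. (afe_weight g n * Y ^ n) * (\<Sum>k\<le>n. real (n - k + 1) * X k))\<bar> \<le> 4 * (32 * (2 * real g + 1) * real CARD('a) ^ g)"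
    using Y4 by (intro mult_mono) auto
  moreover have "4 * (32 * (2 * real g + 1) * real CARD('a) ^ g) = 128 * (2 * real g + 1) * real CARD('a) ^ g" by simp
  moreover have "(1 - Y)\<^sup>2 * \<bar>A - K * B\<bar> = \<bar>(1 - Y)\<^sup>2 * A - K * ((1 - Y)\<^sup>2 * B)\<bar>" for A B
  proof -
    have "(1 - Y)\<^sup>2 * A - K * ((1 - Y)\<^sup>2 * B) = (1 - Y)\<^sup>2 * (A - K * B)"
      by (simp only: right_diff_distrib mult.left_commute)
    then show ?thesis by (simp add: abs_mult)
  qed
  ultimately have 1: "\<bar>(\<Sum>a\<in>lowdeg (Suc g) - {0}. (L_poly a P (Suc (2 * g)) Y)\<^sup>2) - K * split_main g Y\<bar> \<le> 128 * (2 * real g + 1) * real CARD('a) ^ g"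
    unfolding M split_main_def X_def by (simp only:)
  have "\<bar>split_main g Y - (1 - 1 / real CARD('a)) * (real g + 1) ^ 3 / 3\<bar> \<le> 68 * (real g + 2)\<^sup>2"
    using split_main_approx[OF Y, of g] sum_square_coeff_approx[of "real g + 1" g] by (simp add: abs_le_iff)
  then have "K * \<bar>split_main g Y - (1 - 1 / real CARD('a)) * (real g + 1) ^ 3 / 3\<bar> \<le> real CARD('a) ^ Suc g * (68 * (real g + 2)\<^sup>2)"
    using K by (intro mult_mono) auto
  moreover have "K * \<bar>split_main g Y - (1 - 1 / real CARD('a)) * (real g + 1) ^ 3 / 3\<bar> = \<bar>K * split_main g Y - K * ((1 - 1 / real CARD('a)) * (real g + 1) ^ 3 / 3)\<bar>"
    using K(1) by (simp only: right_diff_distrib[symmetric] abs_mult abs_of_nonneg)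
  moreover have "\<bar>u - w\<bar> \<le> e + d" if "\<bar>u - v\<bar> \<le> e" "r \<le> d" "r = \<bar>v - w\<bar>" for u v w d e r :: real
    using that by linarith
  ultimately have "\<bar>(\<Sum>a\<in>lowdeg (Suc g) - {0}. (L_poly a P (Suc (2 * g)) Y)\<^sup>2) - K * ((1 - 1 / real CARD('a)) * (real g + 1) ^ 3 / 3)\<bar>
    \<le> 128 * (2 * real g + 1) * real CARD('a) ^ g + real CARD('a) ^ Suc g * (68 * (real g + 2)\<^sup>2)" using 1 by blast
  then show ?thesis unfolding K_def by (simp add: mult_ac)
qed

text \<open>\<open>W\<close> is the number of elements of \<open>H_deg \<xi> (g + 1)\<close>, about
  \<open>2 * q ^ (2 * g + 1) / g\<close>, and \<open>Z\<close> is the mean value, cubic in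
  \<open>g\<close>. For primes of degree \<open>r\<close> the nonsquare pairs contribute an error of
  order \<open>g * q ^ (2 * g) / r\<close>, the last factor being the density of primes; the sum
  over \<open>r\<close> produces the logarithm.\<close>

lemma second_moment_H:
  assumes g: "g \<ge> 2"
  shows "\<bar>(\<Sum>r=1..g. \<Sum>P\<in>monic_irreducibles r. \<Sum>a\<in>lowdeg r - {0}. \<Sum>F\<in>G_deg \<xi> (g + 1 - r). (L_poly (a + F * P) P (2 * g) half)\<^sup>2)
      - 2 / 3 * (1 - 1 / real CARD('a)) * real g ^ 2 * real CARD('a) ^ (2 * g + 1)\<bar>
    \<le> 3000 * real CARD('a) * (ln (real g) * real g * real CARD('a) ^ (2 * g))"
proof -
  define q where "q = real CARD('a)"
  define x where "x = real g"
  define Q where "Q = q ^ (2 * g)"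
  define Z where "Z = (1 - 1 / q) * x ^ 3 / 3"
  define M where "M r P = (\<Sum>a\<in>lowdeg r - {0}. \<Sum>F\<in>G_deg \<xi> (g + 1 - r). (L_poly (a + F * P) P (2 * g) half)\<^sup>2)" for r P
  define W where "W = (\<Sum>r=1..g. prime_count r * ((q ^ r - 1) * (2 * (q - 1) * q ^ (g - r))))"
  have q: "q \<ge> 2" using q_ge_2 by (simp add: q_def)
  have x: "x \<ge> 2" using g by (simp add: x_def)
  have Q: "Q \<ge> 0" "Q = q ^ g * q ^ g" using q by (auto simp: Q_def mult_2 power_add)
  have g1: "g \<ge> 1" using g by simp
  have Z: "0 \<le> Z" "Z \<le> x ^ 3 / 3"
  proof -
    have "0 \<le> 1 - 1 / q" "1 - 1 / q \<le> 1" using q by auto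
    then show "0 \<le> Z" "Z \<le> x ^ 3 / 3" using x by (auto simp: Z_def intro: mult_left_le_one_le)
  qed
  have qr: "q ^ (g - r) * q ^ r = q ^ g" if "r \<in> {1..g}" for r
    using that by (simp add: power_add[symmetric])
  have dbl: "q ^ (2 * n) = q ^ n * q ^ n" for n by (simp only: mult_2 power_add)
  have card_G: "real (card (G_deg \<xi> (g + 1 - r))) = 2 * (q - 1) * q ^ (g - r)" if "r \<in> {1..g}" for r
  proof -
    have "g + 1 - r - 1 = g - r" "g + 1 - r \<ge> 1" using that by auto
    then show ?thesis using card_G_deg[OF _ xi_nonzero, of "g + 1 - r"] by (simp add: q_def)
  qed
  have "\<bar>(\<Sum>r=1..g. \<Sum>P\<in>monic_irreducibles r. M r P) - W * Z\<bar>
    \<le> (\<Sum>r=1..g. prime_count r * (2 * (q - 1) * q ^ (g - r) * (64 * (x + 1) * q ^ g + 5 * (x + 2)\<^sup>2 * q ^ r)))"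
  proof -
    have "(\<Sum>r=1..g. \<Sum>P\<in>monic_irreducibles r. M r P) - W * Z
      = (\<Sum>r=1..g. \<Sum>P\<in>monic_irreducibles r. M r P - (q ^ r - 1) * (2 * (q - 1) * q ^ (g - r)) * Z)"
      by (simp add: W_def sum_distrib_left sum_subtractf prime_count_def mult_ac)
    also have "\<bar>\<dots>\<bar> \<le> (\<Sum>r=1..g. \<bar>\<Sum>P\<in>monic_irreducibles r. M r P - (q ^ r - 1) * (2 * (q - 1) * q ^ (g - r)) * Z\<bar>)"
      by (rule sum_abs)
    also have "\<dots> \<le> (\<Sum>r=1..g. \<Sum>P\<in>(monic_irreducibles r :: 'a poly set). 2 * (q - 1) * q ^ (g - r) * (64 * (x + 1) * q ^ g + 5 * (x + 2)\<^sup>2 * q ^ r))"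
    proof (intro sum_mono order.trans[OF sum_abs])
      fix r and P :: "'a poly" assume r: "r \<in> {1..g}" and P: "P \<in> monic_irreducibles r"
      then have "monic_irreducible P" "degree P = r" "g + 1 - r \<ge> 1" "r + (g + 1 - r) = Suc g" by (auto simp: monic_irreducibles_def)
      from second_moment_ramified[OF this]
      show "\<bar>M r P - (q ^ r - 1) * (2 * (q - 1) * q ^ (g - r)) * Z\<bar>
        \<le> 2 * (q - 1) * q ^ (g - r) * (64 * (x + 1) * q ^ g + 5 * (x + 2)\<^sup>2 * q ^ r)"
        unfolding card_G[OF r] M_def Z_def x_def q_def[symmetric] .
    qed
    finally show ?thesis by (simp add: prime_count_def)
  qed
  also have "\<dots> \<le> (\<Sum>r=1..g. 128 * (q - 1) * (x + 1) * Q * (1 / real r) + 10 * (x + 2)\<^sup>2 * q ^ g * ((q - 1) * (q ^ r / real r)))"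
  proof (rule sum_mono)
    fix r assume r: "r \<in> {1..g}"
    have "prime_count r * (2 * (q - 1) * q ^ (g - r) * (64 * (x + 1) * q ^ g + 5 * (x + 2)\<^sup>2 * q ^ r))
      \<le> q ^ r / real r * (2 * (q - 1) * q ^ (g - r) * (64 * (x + 1) * q ^ g + 5 * (x + 2)\<^sup>2 * q ^ r))"
      using r q x prime_count_le[of r] by (intro mult_right_mono mult_nonneg_nonneg add_nonneg_nonneg) (auto simp: q_def)
    also have "\<dots> = 2 * (q - 1) * (q ^ (g - r) * q ^ r) * (64 * (x + 1) * q ^ g + 5 * (x + 2)\<^sup>2 * q ^ r) * (1 / real r)"
      by (simp add: mult_ac)
    also have "\<dots> = 128 * (q - 1) * (x + 1) * Q * (1 / real r) + 10 * (x + 2)\<^sup>2 * q ^ g * ((q - 1) * (q ^ r / real r))"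
      unfolding qr[OF r] Q(2) by (simp add: algebra_simps add_divide_distrib diff_divide_distrib)
    finally show "prime_count r * (2 * (q - 1) * q ^ (g - r) * (64 * (x + 1) * q ^ g + 5 * (x + 2)\<^sup>2 * q ^ r))
      \<le> 128 * (q - 1) * (x + 1) * Q * (1 / real r) + 10 * (x + 2)\<^sup>2 * q ^ g * ((q - 1) * (q ^ r / real r))" .
  qed
  also have "\<dots> = 128 * (q - 1) * (x + 1) * Q * (\<Sum>r=1..g. 1 / real r) + 10 * (x + 2)\<^sup>2 * q ^ g * ((q - 1) * (\<Sum>r=1..g. q ^ r / real r))"
    by (simp only: sum.distrib sum_distrib_left)
  also have "\<dots> \<le> 128 * (q - 1) * (x + 1) * Q * (1 + ln x) + 10 * (x + 2)\<^sup>2 * q ^ g * ((q + 18) * q ^ g / x)"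
  proof (intro add_mono mult_left_mono)
    show "(\<Sum>r=1..g. 1 / real r) \<le> 1 + ln x" using harmonic_le[OF g1] by (simp add: x_def)
    have "(q - 1) * (\<Sum>r=1..g. q ^ r / real r) \<le> q ^ (g + 1) / x + 18 * q ^ g / x\<^sup>2"
      using sum_power_over_linear[OF q g1] unfolding x_def by linarith
    also have "18 * q ^ g / x\<^sup>2 \<le> 18 * q ^ g / x"
      using q x by (intro divide_left_mono) (auto simp: power2_eq_square)
    also have "q ^ (g + 1) / x + 18 * q ^ g / x = (q + 18) * q ^ g / x" by (simp add: algebra_simps add_divide_distrib)
    finally show "(q - 1) * (\<Sum>r=1..g. q ^ r / real r) \<le> (q + 18) * q ^ g / x" by simp
  qed (use q x Q in auto)
  finally have 1: "\<bar>(\<Sum>r=1..g. \<Sum>P\<in>monic_irreducibles r. M r P) - W * Z\<bar>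
    \<le> 128 * (q - 1) * (x + 1) * Q * (1 + ln x) + 10 * (x + 2)\<^sup>2 * q ^ g * ((q + 18) * q ^ g / x)" .
  have "\<bar>W - 2 * q ^ g * (q ^ (g + 1) / x)\<bar> \<le> 90 * q * Q / x\<^sup>2"
  proof -
    \<comment> \<open>The deviation from the main term of \<open>prime_count_approx\<close>; what
      remains is a sum of \<open>q ^ r / r\<close>, evaluated by
      \<open>sum_power_over_linear\<close>.\<close>
    define e where "e r = prime_count r * (q ^ r - 1) - q ^ (2 * r) / real r" for r
    have "W = (\<Sum>r=1..g. 2 * q ^ g * ((q - 1) * (q ^ r / real r)) + 2 * (q - 1) * (e r * q ^ (g - r)))"
      unfolding W_def
    proof (rule sum.cong[OF refl])
      fix r assume r: "r \<in> {1..g}"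
      have "2 * (q - 1) * (q ^ (2 * r) / real r * q ^ (g - r)) = 2 * (q - 1) * ((q ^ (g - r) * q ^ r) * q ^ r / real r)"
        unfolding dbl by simp
      also have "\<dots> = 2 * q ^ g * ((q - 1) * (q ^ r / real r))" unfolding qr[OF r] by simp
      finally have *: "2 * (q - 1) * (q ^ (2 * r) / real r * q ^ (g - r)) = 2 * q ^ g * ((q - 1) * (q ^ r / real r))" .
      have "prime_count r * ((q ^ r - 1) * (2 * (q - 1) * q ^ (g - r))) = 2 * (q - 1) * ((q ^ (2 * r) / real r + e r) * q ^ (g - r))"
        by (simp add: e_def)
      also have "\<dots> = 2 * (q - 1) * (q ^ (2 * r) / real r * q ^ (g - r)) + 2 * (q - 1) * (e r * q ^ (g - r))"
        by (simp only: distrib_left distrib_right)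
      finally show "prime_count r * ((q ^ r - 1) * (2 * (q - 1) * q ^ (g - r)))
        = 2 * q ^ g * ((q - 1) * (q ^ r / real r)) + 2 * (q - 1) * (e r * q ^ (g - r))" unfolding * .
    qed
    then have W: "W = 2 * q ^ g * ((q - 1) * (\<Sum>r=1..g. q ^ r / real r)) + 2 * (q - 1) * (\<Sum>r=1..g. e r * q ^ (g - r))"
      by (simp only: sum.distrib sum_distrib_left)
    have "\<bar>\<Sum>r=1..g. e r * q ^ (g - r)\<bar> \<le> (\<Sum>r=1..g. 5 * q ^ g * (q ^ r / (real r)\<^sup>2))"
    proof (rule order.trans[OF sum_abs], rule sum_mono)
      fix r assume r: "r \<in> {1..g}"
      have "\<bar>e r\<bar> \<le> 5 * q ^ (2 * r) / (real r)\<^sup>2" using prime_count_approx[of r] r by (simp add: e_def q_def)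
      then have "\<bar>e r * q ^ (g - r)\<bar> \<le> 5 * q ^ (2 * r) / (real r)\<^sup>2 * q ^ (g - r)"
        unfolding abs_mult using q by (intro mult_mono) auto
      also have "\<dots> = 5 * (q ^ (g - r) * q ^ r) * (q ^ r / (real r)\<^sup>2)" unfolding dbl by simp
      finally show "\<bar>e r * q ^ (g - r)\<bar> \<le> 5 * q ^ g * (q ^ r / (real r)\<^sup>2)" unfolding qr[OF r] .
    qed
    also have "\<dots> = 5 * q ^ g * (\<Sum>r=1..g. q ^ r / (real r)\<^sup>2)" by (simp only: sum_distrib_left)
    also have "\<dots> \<le> 5 * q ^ g * (9 * q ^ g / x\<^sup>2)"
      using sum_power_over_square_le[OF q g1] q by (intro mult_left_mono) (auto simp: x_def)
    finally have S: "\<bar>\<Sum>r=1..g. e r * q ^ (g - r)\<bar> \<le> 5 * q ^ g * (9 * q ^ g / x\<^sup>2)" .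
    have "\<bar>2 * (q - 1) * (\<Sum>r=1..g. e r * q ^ (g - r))\<bar> = 2 * (q - 1) * \<bar>\<Sum>r=1..g. e r * q ^ (g - r)\<bar>"
      using q by (simp add: abs_mult)
    also have "\<dots> \<le> 2 * (q - 1) * (5 * q ^ g * (9 * q ^ g / x\<^sup>2))"
      using q by (intro mult_left_mono[OF S]) auto
    also have "\<dots> = (q - 1) * (90 * Q / x\<^sup>2)" unfolding Q(2) by simp
    finally have E: "\<bar>2 * (q - 1) * (\<Sum>r=1..g. e r * q ^ (g - r))\<bar> \<le> (q - 1) * (90 * Q / x\<^sup>2)" .
    have "2 * q ^ g * \<bar>(q - 1) * (\<Sum>r=1..g. q ^ r / real r) - q ^ (g + 1) / x\<bar> \<le> 2 * q ^ g * (18 * q ^ g / x\<^sup>2)"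
      using sum_power_over_linear[OF q g1] q by (intro mult_left_mono) (auto simp: x_def)
    moreover have "2 * q ^ g * \<bar>(q - 1) * (\<Sum>r=1..g. q ^ r / real r) - q ^ (g + 1) / x\<bar>
      = \<bar>2 * q ^ g * ((q - 1) * (\<Sum>r=1..g. q ^ r / real r)) - 2 * q ^ g * (q ^ (g + 1) / x)\<bar>"
      unfolding right_diff_distrib[symmetric] abs_mult using q by simp
    moreover have "2 * q ^ g * (18 * q ^ g / x\<^sup>2) = 36 * Q / x\<^sup>2" by (simp add: Q(2))
    moreover have "36 * Q / x\<^sup>2 \<le> 90 * Q / x\<^sup>2" using Q by (intro divide_right_mono) auto
    ultimately have "\<bar>W - 2 * q ^ g * (q ^ (g + 1) / x)\<bar> \<le> 90 * Q / x\<^sup>2 + (q - 1) * (90 * Q / x\<^sup>2)"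
      unfolding W using E by linarith
    also have "\<dots> = 90 * q * Q / x\<^sup>2" by (simp add: algebra_simps diff_divide_distrib)
    finally show ?thesis .
  qed
  then have "\<bar>W - 2 * q ^ g * (q ^ (g + 1) / x)\<bar> * Z \<le> 90 * q * Q / x\<^sup>2 * (x ^ 3 / 3)"
    using Z Q q by (intro mult_mono) auto
  also have "\<dots> = 30 * q * Q * x" using x by (simp add: power2_eq_square power3_eq_cube)
  also have "\<bar>W - 2 * q ^ g * (q ^ (g + 1) / x)\<bar> * Z = \<bar>W * Z - 2 * q ^ g * (q ^ (g + 1) / x) * Z\<bar>"
    unfolding left_diff_distrib[symmetric] abs_mult using Z(1) by simp
  also have "2 * q ^ g * (q ^ (g + 1) / x) * Z = 2 / 3 * (1 - 1 / q) * x ^ 2 * q ^ (2 * g + 1)"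
    unfolding power_add dbl using x by (simp add: Z_def power2_eq_square power3_eq_cube)
  finally have 2: "\<bar>W * Z - 2 / 3 * (1 - 1 / q) * x ^ 2 * q ^ (2 * g + 1)\<bar> \<le> 30 * q * Q * x" .
  \<comment> \<open>A positive lower bound for the logarithm absorbs the error terms that lack it;
    it rests on \<open>g \<ge> 2\<close>.\<close>
  have L: "1 / 2 \<le> ln x"
  proof -
    have "ln (2::real) \<le> ln x" using x by simp
    then show ?thesis using ln2_ge_two_thirds by linarith
  qed
  have close: "\<bar>u - v\<bar> \<le> d + e \<Longrightarrow> d \<le> d' \<Longrightarrow> e \<le> e' \<Longrightarrow> \<bar>v - w\<bar> \<le> f \<Longrightarrow> \<bar>u - w\<bar> \<le> f + (e' + d')"
    for u v w d d' e e' f :: real by linarith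
  define t where "t = q * Q * x"
  have t: "0 \<le> t" using q Q x by (simp add: t_def)
  have "128 * (q - 1) * (x + 1) * Q * (1 + ln x) \<le> 128 * q * (2 * x) * Q * (3 * ln x)"
    using q x Q L by (intro mult_mono mult_nonneg_nonneg) auto
  also have "\<dots> = 768 * (t * ln x)" by (simp add: t_def)
  finally have A: "128 * (q - 1) * (x + 1) * Q * (1 + ln x) \<le> 768 * (t * ln x)" .
  have "10 * (x + 2)\<^sup>2 * q ^ g * ((q + 18) * q ^ g / x) = 10 * (x + 2)\<^sup>2 * ((q + 18) * Q / x)" by (simp add: Q(2))
  also have "\<dots> \<le> 10 * (2 * x)\<^sup>2 * ((10 * q) * Q / x)"
    using q x Q by (intro mult_mono divide_right_mono mult_right_mono mult_left_mono power_mono) auto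
  also have "\<dots> = 400 * t" using x by (simp add: t_def power2_eq_square)
  finally have B: "10 * (x + 2)\<^sup>2 * q ^ g * ((q + 18) * q ^ g / x) \<le> 400 * t" .
  have C: "t * 1 \<le> t * (2 * ln x)" using L t by (intro mult_left_mono) auto
  have D: "\<bar>W * Z - 2 / 3 * (1 - 1 / q) * x ^ 2 * q ^ (2 * g + 1)\<bar> \<le> 30 * t" using 2 by (simp add: t_def mult.assoc)
  have "\<bar>(\<Sum>r=1..g. \<Sum>P\<in>monic_irreducibles r. M r P) - 2 / 3 * (1 - 1 / q) * x ^ 2 * q ^ (2 * g + 1)\<bar>
    \<le> 30 * t + (400 * t + 768 * (t * ln x))"
    by (rule close[OF 1 A B D])
  also have "\<dots> \<le> 3000 * (t * ln x)"
  proof -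
    have "0 \<le> t * ln x" using t L by (intro mult_nonneg_nonneg) auto
    then show ?thesis using C by simp
  qed
  also have "\<dots> = 3000 * q * (ln x * x * Q)" by (simp add: t_def)
  finally show ?thesis unfolding M_def q_def x_def Q_def .
qed

text \<open>The density of primes takes one power from the cubic mean value, and as only one degree
  occurs, no harmonic sum arises. The two signs of \<open>Y\<close> cover the two families.\<close>

lemma second_moment_F:
  assumes Y: "\<bar>Y\<bar> = half"
  shows "\<bar>(\<Sum>P\<in>monic_irreducibles (Suc g). \<Sum>a\<in>lowdeg (Suc g) - {0}. (L_poly a P (Suc (2 * g)) Y)\<^sup>2)
      - 1 / 3 * (1 - 1 / real CARD('a)) * (real CARD('a) ^ Suc g)\<^sup>2 * (real (Suc g))\<^sup>2\<bar>
    \<le> 533 * ((real CARD('a) ^ Suc g)\<^sup>2 * real (Suc g))"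
proof -
  define q where "q = real CARD('a)"
  define x where "x = real (Suc g)"
  define Q where "Q = q ^ Suc g"
  define Z where "Z = (1 - 1 / q) * x ^ 3 / 3"
  define M where "M P = (\<Sum>a\<in>lowdeg (Suc g) - {0}. (L_poly a P (Suc (2 * g)) Y)\<^sup>2)" for P
  have q: "q \<ge> 2" using q_ge_2 by (simp add: q_def)
  have x: "x \<ge> 1" "real g = x - 1" by (auto simp: x_def)
  have Q: "Q \<ge> 0" "q ^ g \<le> Q" using q by (auto simp: Q_def)
  have Z: "0 \<le> Z" "Z \<le> x ^ 3"
  proof -
    have "0 \<le> 1 - 1 / q" "1 - 1 / q \<le> 1" using q by auto
    then have "(1 - 1 / q) * x ^ 3 \<le> x ^ 3" "0 \<le> (1 - 1 / q) * x ^ 3" using x by (auto intro: mult_left_le_one_le)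
    then show "0 \<le> Z" "Z \<le> x ^ 3" by (simp_all add: Z_def)
  qed
  define E where "E = 256 * x * Q + 272 * x\<^sup>2 * Q"
  have "(\<Sum>P\<in>monic_irreducibles (Suc g). M P) - prime_count (Suc g) * (Q - 1) * Z
    = (\<Sum>P\<in>monic_irreducibles (Suc g). M P - (Q - 1) * Z)"
    by (simp add: sum_subtractf prime_count_def)
  also have "\<bar>\<dots>\<bar> \<le> (\<Sum>P\<in>(monic_irreducibles (Suc g) :: 'a poly set). E)"
  proof (rule order.trans[OF sum_abs], rule sum_mono)
    fix P :: "'a poly" assume "P \<in> monic_irreducibles (Suc g)"
    then have "monic_irreducible P" "degree P = Suc g" by (auto simp: monic_irreducibles_def)
    from second_moment_split[OF this Y]
    have "\<bar>M P - (Q - 1) * Z\<bar> \<le> 128 * (2 * real g + 1) * q ^ g + 68 * (real g + 2)\<^sup>2 * Q"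
      unfolding M_def Q_def Z_def q_def x_def by (simp add: add.commute)
    also have "\<dots> \<le> 128 * (2 * x) * Q + 68 * (2 * x)\<^sup>2 * Q"
      using x q Q by (intro add_mono mult_mono mult_nonneg_nonneg mult_right_mono mult_left_mono power_mono) auto
    also have "\<dots> = E" by (simp add: E_def power_mult_distrib)
    finally show "\<bar>M P - (Q - 1) * Z\<bar> \<le> E" .
  qed
  also have "\<dots> = prime_count (Suc g) * E" by (simp add: prime_count_def)
  also have "\<dots> \<le> Q / x * E"
  proof (rule mult_right_mono)
    show "prime_count (Suc g) \<le> Q / x" using prime_count_le[of "Suc g"] unfolding Q_def q_def x_def by (simp only: le_add1 plus_1_eq_Suc)
    show "0 \<le> E" unfolding E_def using x Q by (intro add_nonneg_nonneg mult_nonneg_nonneg) auto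
  qed
  also have "\<dots> = 256 * Q\<^sup>2 + 272 * x * Q\<^sup>2" using x by (simp add: E_def power2_eq_square distrib_left)
  also have "\<dots> \<le> 528 * (Q\<^sup>2 * x)"
  proof -
    have "Q\<^sup>2 * 1 \<le> Q\<^sup>2 * x" using x by (intro mult_left_mono) auto
    then show ?thesis by (simp add: mult_ac)
  qed
  finally have 1: "\<bar>(\<Sum>P\<in>monic_irreducibles (Suc g). M P) - prime_count (Suc g) * (Q - 1) * Z\<bar> \<le> 528 * (Q\<^sup>2 * x)" .
  have "\<bar>prime_count (Suc g) * (Q - 1) - Q\<^sup>2 / x\<bar> \<le> 5 * Q\<^sup>2 / x\<^sup>2"
  proof -
    have "Q\<^sup>2 = q ^ (2 * Suc g)" unfolding Q_def by (simp only: power_mult[symmetric] mult.commute)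
    then show ?thesis using prime_count_approx[of "Suc g"] by (simp only: Q_def q_def x_def le_add1 plus_1_eq_Suc)
  qed
  then have "\<bar>prime_count (Suc g) * (Q - 1) - Q\<^sup>2 / x\<bar> * Z \<le> 5 * Q\<^sup>2 / x\<^sup>2 * x ^ 3"
    using Z x by (intro mult_mono) auto
  also have "\<dots> = 5 * (Q\<^sup>2 * x)" using x by (simp add: power2_eq_square power3_eq_cube)
  also have "\<bar>prime_count (Suc g) * (Q - 1) - Q\<^sup>2 / x\<bar> * Z = \<bar>prime_count (Suc g) * (Q - 1) * Z - Q\<^sup>2 / x * Z\<bar>"
    unfolding left_diff_distrib[symmetric] abs_mult using Z(1) by simp
  also have "Q\<^sup>2 / x * Z = 1 / 3 * (1 - 1 / q) * Q\<^sup>2 * x\<^sup>2"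
    using x by (simp add: Z_def power2_eq_square power3_eq_cube)
  finally have "\<bar>(\<Sum>P\<in>monic_irreducibles (Suc g). M P) - 1 / 3 * (1 - 1 / q) * Q\<^sup>2 * x\<^sup>2\<bar> \<le> 533 * (Q\<^sup>2 * x)"
    using 1 by linarith
  then show ?thesis unfolding M_def Q_def q_def x_def .
qed

lemma inverse_zeta_A_2: "1 / (3 * zeta_A TYPE('a) 2) = 1 / 3 * (1 - 1 / real CARD('a))"
  using q_ge_2 by (simp add: zeta_A_def powr_minus inverse_eq_divide)

lemma sum_hasse_L_H:
  "(\<Sum>u\<in>H_deg \<xi> (g + 1). hasse_L (1 / 2) u ^ 2) = complex_of_real
    (\<Sum>r=1..g. \<Sum>P\<in>monic_irreducibles r. \<Sum>a\<in>lowdeg r - {0}. \<Sum>F\<in>G_deg \<xi> (g + 1 - r). (L_poly (a + F * P) P (2 * g) half)\<^sup>2)"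
  unfolding sum_H_deg of_real_sum
proof (intro sum.cong refl)
  fix r and P a F :: "'a poly" assume "r \<in> {1..g}" "P \<in> monic_irreducibles r" "a \<in> lowdeg r - {0}" "F \<in> G_deg \<xi> (g + 1 - r)"
  then have "hasse_L (1 / 2) (Fract (a + F * P) P) = complex_of_real (L_poly (a + F * P) P (2 * g) half)"
    by (intro L_poly_ramified_square(1)) (auto simp: monic_irreducibles_def)
  then show "hasse_L (1 / 2) (Fract (a + F * P) P) ^ 2 = complex_of_real ((L_poly (a + F * P) P (2 * g) half)\<^sup>2)"
    by simp
qed

lemma sum_hasse_L_F:
  "(\<Sum>P\<in>(monic_irreducibles (g + 1) :: 'a poly set). \<Sum>u\<in>F_prime P. hasse_L (1 / 2) u ^ 2) = complex_of_real
    (\<Sum>P\<in>monic_irreducibles (Suc g). \<Sum>a\<in>lowdeg (Suc g) - {0}. (L_poly a P (Suc (2 * g)) half)\<^sup>2)"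
  "(\<Sum>P\<in>(monic_irreducibles (g + 1) :: 'a poly set). \<Sum>u\<in>F_prime' \<xi> P. hasse_L (1 / 2) u ^ 2) = complex_of_real
    (\<Sum>P\<in>monic_irreducibles (Suc g). \<Sum>a\<in>lowdeg (Suc g) - {0}. (L_poly a P (Suc (2 * g)) (- half))\<^sup>2)"
proof -
  have P: "monic_irreducible P" "degree P = Suc g" "P \<noteq> 0" if "P \<in> monic_irreducibles (Suc g)" for P :: "'a poly"
    using that by (auto simp: monic_irreducibles_def)
  have Y: "half * half = 1 / real CARD('a)" by (rule half_square)
  show "(\<Sum>P\<in>(monic_irreducibles (g + 1) :: 'a poly set). \<Sum>u\<in>F_prime P. hasse_L (1 / 2) u ^ 2) = complex_of_real
    (\<Sum>P\<in>monic_irreducibles (Suc g). \<Sum>a\<in>lowdeg (Suc g) - {0}. (L_poly a P (Suc (2 * g)) half)\<^sup>2)"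
    unfolding of_real_sum Suc_eq_plus1[symmetric]
    by (intro sum.cong refl) (simp add: sum_F_prime P L_poly_split_square(1)[OF P(1,2) _ Y])
  show "(\<Sum>P\<in>(monic_irreducibles (g + 1) :: 'a poly set). \<Sum>u\<in>F_prime' \<xi> P. hasse_L (1 / 2) u ^ 2) = complex_of_real
    (\<Sum>P\<in>monic_irreducibles (Suc g). \<Sum>a\<in>lowdeg (Suc g) - {0}. (L_poly a P (Suc (2 * g)) (- half))\<^sup>2)"
    unfolding of_real_sum Suc_eq_plus1[symmetric]
    by (intro sum.cong refl) (simp add: sum_F_prime' P L_poly_split_square(2)[OF P(1,2) _ Y] del: mult_pCons_left)
qed

end

text \<open>Every element is fixed by raising to the power \<open>CARD('a)\<close>, and this
  exponent is even; applied to \<open>- 1\<close> this gives \<open>1 = - 1\<close>.\<close>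

lemma even_const_fieldI:
  fixes \<xi> :: "'a::finite_field"
  assumes "CARD('a) = 2 ^ m" "\<xi> \<notin> range artin_schreier"
  shows "even_const_field \<xi>"
proof
  have "m \<noteq> 0" using assms(1) card_field_gt_1[where 'a = 'a] by (intro notI) simp
  then have "even CARD('a)" by (simp add: assms(1))
  then have "(- 1 :: 'a) ^ CARD('a) = 1" by simp
  then have "(1 :: 'a) = - 1" by (simp add: finite_field_power_card_eq_same)
  then have "(1 :: 'a) + 1 = 0" by (metis add.right_inverse)
  then show "(2 :: 'a) = 0" by simp
qed (rule assms(2))

theorem theorem2p15:
  fixes \<xi> :: "'a::finite_field" and q m :: nat
  assumes "q = CARD('a)" and "q = 2 ^ m"
    and "\<xi> \<notin> range artin_schreier"
  shows
    "(\<lambda>g::nat. (\<Sum>u\<in>H_deg \<xi> (g + 1). hasse_L (1/2) u ^ 2)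
        - complex_of_real (2 / (3 * zeta_A TYPE('a) 2) * real g ^ 2 * real q ^ (2 * g + 1)))
      \<in> O(\<lambda>g. complex_of_real (ln (real g) * real g * real q ^ (2 * g)))
    \<and> (\<lambda>g::nat. (\<Sum>P\<in>(monic_irreducibles (g + 1) :: 'a poly set). \<Sum>u\<in>F_prime P. hasse_L (1/2) u ^ 2)
        - complex_of_real (1 / (3 * zeta_A TYPE('a) 2)
            * (real q ^ (g + 1)) ^ 2 * (log (real q) (real q ^ (g + 1))) ^ 2))
      \<in> O(\<lambda>g. complex_of_real ((real q ^ (g + 1)) ^ 2 * log (real q) (real q ^ (g + 1))))
    \<and> (\<lambda>g::nat. (\<Sum>P\<in>(monic_irreducibles (g + 1) :: 'a poly set). \<Sum>u\<in>F_prime' \<xi> P. hasse_L (1/2) u ^ 2)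
        - complex_of_real (1 / (3 * zeta_A TYPE('a) 2)
            * (real q ^ (g + 1)) ^ 2 * (log (real q) (real q ^ (g + 1))) ^ 2))
      \<in> O(\<lambda>g. complex_of_real ((real q ^ (g + 1)) ^ 2 * log (real q) (real q ^ (g + 1))))"
proof -
  interpret even_const_field \<xi> using assms by (intro even_const_fieldI[of m]) auto
  have q: "real q \<ge> 2" using q_ge_2 assms(1) by simp
  have lg: "log (real q) (real q ^ (g + 1)) = real (Suc g)" for g
    using q by (simp add: log_pow_cancel del: power_Suc)
  have z1: "1 / (3 * zeta_A TYPE('a) 2) = 1 / 3 * (1 - 1 / real q)"
    unfolding assms(1) by (rule inverse_zeta_A_2)
  have "2 / (3 * zeta_A TYPE('a) 2) = 2 * (1 / (3 * zeta_A TYPE('a) 2))" by simp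
  also have "\<dots> = 2 / 3 * (1 - 1 / real q)" unfolding z1 by simp
  finally have z2: "2 / (3 * zeta_A TYPE('a) 2) = 2 / 3 * (1 - 1 / real q)" .
  have split: "(\<lambda>g. complex_of_real (\<Sum>P\<in>monic_irreducibles (Suc g). \<Sum>a\<in>lowdeg (Suc g) - {0}. (L_poly a P (Suc (2 * g)) Y)\<^sup>2)
      - complex_of_real (1 / 3 * (1 - 1 / real q) * (real q ^ (g + 1)) ^ 2 * (real (Suc g)) ^ 2))
    \<in> O(\<lambda>g. complex_of_real ((real q ^ (g + 1)) ^ 2 * real (Suc g)))" if "\<bar>Y\<bar> = half" for Y
  proof (rule bigoI[where c = 533], rule always_eventually, rule allI)
    fix g
    show "norm (complex_of_real (\<Sum>P\<in>monic_irreducibles (Suc g). \<Sum>a\<in>lowdeg (Suc g) - {0}. (L_poly a P (Suc (2 * g)) Y)\<^sup>2)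
        - complex_of_real (1 / 3 * (1 - 1 / real q) * (real q ^ (g + 1)) ^ 2 * (real (Suc g)) ^ 2))
      \<le> 533 * norm (complex_of_real ((real q ^ (g + 1)) ^ 2 * real (Suc g)))"
      unfolding of_real_diff[symmetric] norm_of_real Suc_eq_plus1[symmetric]
      using second_moment_F[OF that, of g] unfolding assms(1) by (simp only: abs_mult abs_power2 abs_of_nat)
  qed
  show ?thesis
  proof (intro conjI)
    show "(\<lambda>g::nat. (\<Sum>u\<in>H_deg \<xi> (g + 1). hasse_L (1/2) u ^ 2)
        - complex_of_real (2 / (3 * zeta_A TYPE('a) 2) * real g ^ 2 * real q ^ (2 * g + 1)))
      \<in> O(\<lambda>g. complex_of_real (ln (real g) * real g * real q ^ (2 * g)))"
    proof (rule bigoI[where c = "3000 * real q"], rule eventually_mono[OF eventually_ge_at_top[of 2]])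
      fix g :: nat assume g: "2 \<le> g"
      have "0 \<le> ln (real g) * real g * real q ^ (2 * g)" using g by simp
      then show "norm ((\<Sum>u\<in>H_deg \<xi> (g + 1). hasse_L (1/2) u ^ 2)
          - complex_of_real (2 / (3 * zeta_A TYPE('a) 2) * real g ^ 2 * real q ^ (2 * g + 1)))
        \<le> 3000 * real q * norm (complex_of_real (ln (real g) * real g * real q ^ (2 * g)))"
        unfolding sum_hasse_L_H z2 of_real_diff[symmetric] norm_of_real
        using second_moment_H[OF g] unfolding assms(1) by (simp only: abs_of_nonneg)
    qed
    show "(\<lambda>g::nat. (\<Sum>P\<in>(monic_irreducibles (g + 1) :: 'a poly set). \<Sum>u\<in>F_prime P. hasse_L (1/2) u ^ 2)
        - complex_of_real (1 / (3 * zeta_A TYPE('a) 2)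
            * (real q ^ (g + 1)) ^ 2 * (log (real q) (real q ^ (g + 1))) ^ 2))
      \<in> O(\<lambda>g. complex_of_real ((real q ^ (g + 1)) ^ 2 * log (real q) (real q ^ (g + 1))))"
      unfolding sum_hasse_L_F(1) z1 lg by (rule split) (use half_bounds in simp)
    show "(\<lambda>g::nat. (\<Sum>P\<in>(monic_irreducibles (g + 1) :: 'a poly set). \<Sum>u\<in>F_prime' \<xi> P. hasse_L (1/2) u ^ 2)
        - complex_of_real (1 / (3 * zeta_A TYPE('a) 2)
            * (real q ^ (g + 1)) ^ 2 * (log (real q) (real q ^ (g + 1))) ^ 2))
      \<in> O(\<lambda>g. complex_of_real ((real q ^ (g + 1)) ^ 2 * log (real q) (real q ^ (g + 1))))"
      unfolding sum_hasse_L_F(2) z1 lg by (rule split) (use half_bounds in simp)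
  qed
qed

end
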